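(* Suppose $P_1$ and $P_2$ are disjoint and non-parallel planes in $\mathbb{H}^3$, and $B_3$ and $B_4$ are horoballs respectively defined by positive light-like vectors $\mathbf{x}_3$ and $\mathbf{x}_4$ with $[\mathbf{x}_3]\neq[\mathbf{x}_4]$, neither in the ideal boundary of either $P_i$, such that for each $i\in\{1,2\}$, a single half-space $H_i$ bounded by $P_i$ contains $P_{3-i}$ and, in its ideal boundary, each of $\mathbf{x}_3$ and $\mathbf{x}_4$. Let $\tilde\lambda_{12}$ be the geodesic intersecting $P_1$ and $P_2$ at right angles; for $i\in\{1,2\}$ and $j\in\{3,4\}$ let $\tilde\lambda_{ij}$ be the perpendicular geodesic to $P_i$ in the direction of $\mathbf{x}_j$; and let $\tilde\lambda_{34}$ be the geodesic with ideal endpoints at $\mathbf{x}_3$ and $\mathbf{x}_4$. Fix parametrizations $\tilde\lambda_{13}(s)$ and $\tilde\lambda_{24}(t)$ by arclength. Then: \begin{enumerate} \item the function $D(s,t)$ that records the hyperbolic cosine of the distance from $\tilde\lambda_{13}(s)$ to $\tilde\lambda_{24}(t)$ has a unique critical point $(s_0,t_0)$ in $\mathbb{R}^2$, at which it attains an absolute minimum; \item the absolute minimum value $D(s_0,t_0)$ depends only on the distance $\ell_{12}$ between $P_1$ and $P_2$, the signed distances $h_{ij}$ from the $P_i$ ($i\in\{1,2\}$) to the $B_j$ ($j\in\{3,4\}$), and the signed distance $d_{34}$ from $B_3$ to $B_4$; \item the points $\tilde\lambda_{13}(s_0)$ and $\tilde\lambda_{24}(t_0)$ lie in the partially truncated tetrahedron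 $\Delta$ determined by the $P_i$ and $B_j$, so $D(s_0,t_0)$ is the hyperbolic cosine of a transversal length of $\Delta$; and \item written as $T_2^{rr}(x,y;a;b,c;d)$, where $x=e^{h_{13}}$, $y=e^{h_{24}}$, $a=\cosh\ell_{12}$, $b=e^{h_{14}}$, $c=e^{h_{23}}$, and $d=e^{d_{34}}$, this transversal length is increasing in each of $a$, $b$, $c$, and $d$ individually. \end{enumerate} For $x,y,a,b,c,d$ as in (4), $T_2^{rr}(x,y;a;b,c;d)$ is explicitly given by \[ \cosh T_2^{rr}(x,y;a;b,c;d)=\sqrt{\frac{1}{xy}\left(\frac{d}{y}+c\right)\left(\frac{d}{x}+b\right)}+\sqrt{\frac{d}{xy}\left(\frac{d}{xy}+\frac{c}{x}+\frac{b}{y}+2a\right)}. \]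
   Context: Hyperboloid model. On $\mathbb{R}^{4}$ put $\mathbf{x}\circ\mathbf{y}=-x_1y_1+x_2y_2+x_3y_3+x_4y_4$. A nonzero vector $\mathbf{x}$ is light-like if $\mathbf{x}\circ\mathbf{x}=0$, and time-like if $\mathbf{x}\circ\mathbf{x}<0$; such a vector is positive if its first entry is positive. $\mathbb{H}^3$ is the set of positive $\mathbf{x}$ with $\mathbf{x}\circ\mathbf{x}=-1$, with $\cosh d_H(\mathbf{u},\mathbf{v})=-\mathbf{u}\circ\mathbf{v}$. Ideal points of $\mathbb{H}^3$ are projective classes $[\mathbf{x}]$ of positive light-like vectors. A positive light-like $\mathbf{x}$ determines the horosphere $S=\{\mathbf{v}\in\mathbb{H}^3: \mathbf{v}\circ\mathbf{x}=-1\}$ and the horoball $B=\{\mathbf{v}\in\mathbb{H}^3:\mathbf{v}\circ\mathbf{x}\ge -1\}$, with ideal point $[\mathbf{x}]$. A plane is $P=V\cap\mathbb{H}^3$ for a 3-dimensional subspace $V$ containing a time-like vector; a half-space is the closure of a component of $\mathbb{H}^3-P$. The ideal boundary of $P$ (resp. of a half-space $H$ bounded by $P$) is the intersection of the set of positive light-like vectors with $V$ (resp. with the closure of the component of $\mathbb{R}^4-V$ containing the interior of $H$). Two disjoint planes are parallel if their ideal boundaries intersect. The geodesic perpendicular to $P$ in the direction of $\mathbf{x}$ is the geodesic meeting $P$ at a right angle and having $[\mathbf{x}]$ as an ideal endpoint. The signed distance from a point to a horoball $B$ is the distance to $\partial B$, positive outside $B$ and negative inside. The signed distance from a plane to $B$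 is the minimum over points of the plane of the signed distance to $B$. The signed distance between two horoballs with distinct ideal points is the minimum of the signed distance to one over points of the boundary of the other (negative if they overlap). Partially truncated tetrahedron (two planes, two horoballs). With the data of the claim, for each $i\in\{1,2,3,4\}$ there is a unique plane $\widehat P_i$ meeting $P_j$ at right angles for each $j\le 2$, $j\ne i$, and having $\mathbf{x}_j$ in its ideal boundary for each $j\in\{3,4\}$, $j\neq i$. If $\widehat P_1$ does not meet $P_1$ orthogonally, then $\Delta=H_1\cap H_2\cap\left(\bigcap_{i=1}^4\widehat H_i\right)$, where $\widehat H_i$ is the half-space bounded by $\widehat P_i$ that contains: for $i\le 2$, the shortest arc from $P_{3-i}$ to $P_i$ and the geodesic rays from $P_i$, perpendicular to $P_i$, in the directions of $\mathbf{x}_3$ and $\mathbf{x}_4$; for $i\in\{3,4\}$, the geodesics perpendicular to $P_1$ and to $P_2$ in the direction of $\mathbf{x}_i$, and the geodesic joining $\mathbf{x}_3$ to $\mathbf{x}_4$. If $\widehat P_1$ meets $P_1$ orthogonally, all $\widehat P_i$ equal a single plane $\widehat P$; after renumbering so that the line in $\widehat P$ joining the objects numbered $1$ and $3$ separates the objects numbered $2$ and $4$ (the objects being the lines $P_i\cap\widehat P$ and the ideal points $[\mathbf{x}_j]$, and the line joining two objects being the common perpendicular, the perpendicular in the direction of the ideal point, or the geodesic with the two given ideal endpoints, as appropriate), the (degenerate) $\Delta$ is $\widehat P\cap H_1\cap H_2\cap h_{12}\cap h_{23}\cap h_{34}\cap h_{14}$ (with $H_1,H_2$ the half-spaces of the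 two planes), where $h_{pq}$ is the half-plane of $\widehat P$ bounded by the line joining objects $p$ and $q$ and containing the other two objects (in its ideal boundary, for ideal points). Edges: $\lambda_{12}$ is the shortest arc joining $P_1$ to $P_2$; for $i\le2<j$, $\lambda_{ij}$ is the geodesic ray from $P_i$, perpendicular to $P_i$, in the direction of $\mathbf{x}_j$; $\lambda_{34}$ is the geodesic joining $\mathbf{x}_3$ to $\mathbf{x}_4$. The edge opposite $\lambda_{13}$ is $\lambda_{24}$. The transversal of $\Delta$ joining an edge to its opposite is the shortest geodesic arc with one endpoint on each edge, or their point of intersection if they intersect (length $0$); here the transversal length in question is that joining $\lambda_{13}$ to $\lambda_{24}$. *)

theory Defs
  imports "HOL-Analysis.Analysis"
begin

section \<open>The hyperboloid model\<close>

definition lform :: "real^4 \<Rightarrow> real^4 \<Rightarrow> real"  (infixl \<open>\<circ>\<^sub>L\<close> 70)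
  where "x \<circ>\<^sub>L y = - (x$1 * y$1) + x$2 * y$2 + x$3 * y$3 + x$4 * y$4"

definition hyp3 :: "(real^4) set"
  where "hyp3 = {x. x$1 > 0 \<and> x \<circ>\<^sub>L x = -1}"

definition hdist :: "real^4 \<Rightarrow> real^4 \<Rightarrow> real"
  where "hdist u v = arcosh (- (u \<circ>\<^sub>L v))"

definition timelike :: "real^4 \<Rightarrow> bool"
  where "timelike x \<longleftrightarrow> x \<circ>\<^sub>L x < 0"

definition pos_lightlike :: "real^4 \<Rightarrow> bool"
  where "pos_lightlike x \<longleftrightarrow> x \<noteq> 0 \<and> x \<circ>\<^sub>L x = 0 \<and> x$1 > 0"

definition proj_class :: "real^4 \<Rightarrow> (real^4) set"
  where "proj_class x = {c *\<^sub>R x | c. c \<noteq> 0}"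

definition hset_dist :: "(real^4) set \<Rightarrow> (real^4) set \<Rightarrow> real"
  where "hset_dist A B = Inf {hdist p q | p q. p \<in> A \<and> q \<in> B}"


section \<open>Planes, geodesics and half-spaces\<close>

definition is_plane :: "(real^4) set \<Rightarrow> bool"
  where "is_plane P \<longleftrightarrow> (\<exists>V. subspace V \<and> dim V = 3 \<and> (\<exists>v\<in>V. timelike v) \<and> P = V \<inter> hyp3)"

definition is_geodesic :: "(real^4) set \<Rightarrow> bool"
  where "is_geodesic L \<longleftrightarrow> (\<exists>V. subspace V \<and> dim V = 2 \<and> (\<exists>v\<in>V. timelike v) \<and> L = V \<inter> hyp3)"

text \<open>If \<^term>\<open>F = V \<inter> hyp3\<close> for a subspace \<^term>\<open>V\<close> containing a time-like vector, then
  \<^term>\<open>V = span F\<close>; so the subspace carrying a plane or a geodesic is recovered as its span.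
  The ideal endpoints of a geodesic are the elements of its ideal boundary, up to scaling.\<close>

definition ideal_boundary :: "(real^4) set \<Rightarrow> (real^4) set"
  where "ideal_boundary F = {x. pos_lightlike x} \<inter> span F"

definition parallel_planes :: "(real^4) set \<Rightarrow> (real^4) set \<Rightarrow> bool"
  where "parallel_planes P Q \<longleftrightarrow> P \<inter> Q = {} \<and> ideal_boundary P \<inter> ideal_boundary Q \<noteq> {}"

text \<open>\<open>half_of Q F K\<close>: \<^term>\<open>K\<close> is one of the two closed halves into which \<^term>\<open>F\<close> cuts \<^term>\<open>Q\<close>.
  This is used with \<^term>\<open>Q = hyp3\<close> and a plane \<^term>\<open>F\<close> (half-spaces; here \<^term>\<open>span Q = UNIV\<close>),
  and with a plane \<^term>\<open>Q\<close> and a geodesic \<^term>\<open>F\<close> in it (half-planes).\<close>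

definition half_of :: "(real^4) set \<Rightarrow> (real^4) set \<Rightarrow> (real^4) set \<Rightarrow> bool"
  where "half_of Q F K \<longleftrightarrow> (\<exists>C \<in> components (Q - F). K = closure C)"

definition half_ideal_boundary :: "(real^4) set \<Rightarrow> (real^4) set \<Rightarrow> (real^4) set \<Rightarrow> (real^4) set"
  where "half_ideal_boundary Q F K =
    {x. pos_lightlike x \<and>
        (\<exists>C \<in> components (span Q - span F). (top_of_set Q) interior_of K \<subseteq> C \<and> x \<in> closure C)}"

text \<open>Two planes meet at right angles if they meet and their normal vectors are orthogonal.\<close>

definition planes_perp :: "(real^4) set \<Rightarrow> (real^4) set \<Rightarrow> bool"
  where "planes_perp P Q \<longleftrightarrow> P \<inter> Q \<noteq> {} \<and>
    (\<forall>m n. (\<forall>v\<in>P. m \<circ>\<^sub>L v = 0) \<and> (\<forall>v\<in>Q. n \<circ>\<^sub>L v = 0) \<longrightarrow> m \<circ>\<^sub>L n = 0)"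

text \<open>A geodesic \<^term>\<open>L\<close> meets a plane or geodesic \<^term>\<open>F\<close> at a right angle: at some common point
  \<^term>\<open>p\<close>, every tangent vector of \<^term>\<open>L\<close> is orthogonal to every tangent vector of \<^term>\<open>F\<close>.
  The tangent space at \<^term>\<open>p\<close> of \<^term>\<open>V \<inter> hyp3\<close> is \<^term>\<open>{u \<in> V. u \<circ>\<^sub>L p = 0}\<close>.\<close>

definition geodesic_perp :: "(real^4) set \<Rightarrow> (real^4) set \<Rightarrow> bool"
  where "geodesic_perp L F \<longleftrightarrow> (\<exists>p \<in> L \<inter> F. \<forall>u \<in> span L. \<forall>w \<in> span F.
    u \<circ>\<^sub>L p = 0 \<and> w \<circ>\<^sub>L p = 0 \<longrightarrow> u \<circ>\<^sub>L w = 0)"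

definition common_perp :: "(real^4) set \<Rightarrow> (real^4) set \<Rightarrow> (real^4) set"
  where "common_perp F G = (THE L. is_geodesic L \<and> geodesic_perp L F \<and> geodesic_perp L G)"

definition perp_geodesic :: "(real^4) set \<Rightarrow> real^4 \<Rightarrow> (real^4) set"
  where "perp_geodesic F x = (THE L. is_geodesic L \<and> geodesic_perp L F \<and> x \<in> ideal_boundary L)"

definition ideal_geodesic :: "real^4 \<Rightarrow> real^4 \<Rightarrow> (real^4) set"
  where "ideal_geodesic x y = (THE L. is_geodesic L \<and> x \<in> ideal_boundary L \<and> y \<in> ideal_boundary L)"

text \<open>The geodesic segment joining two points \<^term>\<open>p\<close>, \<^term>\<open>q\<close> of \<^term>\<open>hyp3\<close>, or the geodesic ray from
  \<^term>\<open>p\<close> with ideal endpoint \<^term>\<open>q\<close> if \<^term>\<open>q\<close> is positive light-like.\<close>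

definition hsegment :: "real^4 \<Rightarrow> real^4 \<Rightarrow> (real^4) set"
  where "hsegment p q = hyp3 \<inter> {a *\<^sub>R p + b *\<^sub>R q | a b. a \<ge> 0 \<and> b \<ge> 0}"

definition shortest_arc :: "(real^4) set \<Rightarrow> (real^4) set \<Rightarrow> (real^4) set"
  where "shortest_arc A B = (THE S. \<exists>p\<in>A. \<exists>q\<in>B. S = hsegment p q \<and>
    (\<forall>p'\<in>A. \<forall>q'\<in>B. hdist p q \<le> hdist p' q'))"

definition perp_ray :: "(real^4) set \<Rightarrow> real^4 \<Rightarrow> (real^4) set"
  where "perp_ray F x = (THE R. \<exists>p\<in>F. R = hsegment p x \<and> R \<subseteq> perp_geodesic F x)"

definition arclength_param :: "(real \<Rightarrow> real^4) \<Rightarrow> (real^4) set \<Rightarrow> bool"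
  where "arclength_param \<gamma> L \<longleftrightarrow> range \<gamma> = L \<and> (\<forall>s t. hdist (\<gamma> s) (\<gamma> t) = \<bar>s - t\<bar>)"


section \<open>Horoballs and signed distances\<close>

definition horosphere :: "real^4 \<Rightarrow> (real^4) set"
  where "horosphere x = {v \<in> hyp3. v \<circ>\<^sub>L x = -1}"

definition horoball :: "real^4 \<Rightarrow> (real^4) set"
  where "horoball x = {v \<in> hyp3. v \<circ>\<^sub>L x \<ge> -1}"

text \<open>In the settings below all the infima are attained minima. A horoball is represented by the
  positive light-like vector defining it.\<close>

definition sdist_point_horoball :: "real^4 \<Rightarrow> real^4 \<Rightarrow> real"
  where "sdist_point_horoball v x =
    (if v \<in> horoball x then - hset_dist {v} (horosphere x) else hset_dist {v} (horosphere x))"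

definition sdist_plane_horoball :: "(real^4) set \<Rightarrow> real^4 \<Rightarrow> real"
  where "sdist_plane_horoball P x = (INF v\<in>P. sdist_point_horoball v x)"

definition sdist_horoballs :: "real^4 \<Rightarrow> real^4 \<Rightarrow> real"
  where "sdist_horoballs x y = (INF v\<in>horosphere x. sdist_point_horoball v y)"


section \<open>Two planes and two horoballs\<close>

text \<open>The planes are \<^term>\<open>P 1\<close>, \<^term>\<open>P 2\<close>, the distinguished half-spaces \<^term>\<open>H 1\<close>, \<^term>\<open>H 2\<close>, and the
  light-like vectors \<^term>\<open>x 3\<close>, \<^term>\<open>x 4\<close>; other values of \<^term>\<open>P\<close>, \<^term>\<open>H\<close>, \<^term>\<open>x\<close> are irrelevant.\<close>

definition tet_data :: "(nat \<Rightarrow> (real^4) set) \<Rightarrow> (nat \<Rightarrow> (real^4) set) \<Rightarrow> (nat \<Rightarrow> real^4) \<Rightarrow> bool"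
  where "tet_data P H x \<longleftrightarrow>
    is_plane (P 1) \<and> is_plane (P 2) \<and> P 1 \<inter> P 2 = {} \<and> \<not> parallel_planes (P 1) (P 2) \<and>
    pos_lightlike (x 3) \<and> pos_lightlike (x 4) \<and> proj_class (x 3) \<noteq> proj_class (x 4) \<and>
    (\<forall>i\<in>{1,2}. \<forall>j\<in>{3,4}. x j \<notin> ideal_boundary (P i)) \<and>
    (\<forall>i\<in>{1,2}. half_of hyp3 (P i) (H i) \<and> P (3 - i) \<subseteq> H i \<and>
       (\<forall>j\<in>{3,4}. x j \<in> half_ideal_boundary hyp3 (P i) (H i)))"

text \<open>\<open>edge_line F x i j\<close> is the complete geodesic joining the objects numbered \<^term>\<open>i\<close> and \<^term>\<open>j\<close>, where
  objects 1, 2 are the planes or geodesics \<^term>\<open>F 1\<close>, \<^term>\<open>F 2\<close>, and objects 3, 4 are the ideal points of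
  \<^term>\<open>x 3\<close>, \<^term>\<open>x 4\<close>; \<open>edge\<close> is the edge of the truncated tetrahedron on that geodesic.\<close>

definition edge_line :: "(nat \<Rightarrow> (real^4) set) \<Rightarrow> (nat \<Rightarrow> real^4) \<Rightarrow> nat \<Rightarrow> nat \<Rightarrow> (real^4) set"
  where "edge_line F x i j =
    (if i \<le> 2 \<and> j \<le> 2 then common_perp (F i) (F j)
     else if i \<le> 2 then perp_geodesic (F i) (x j)
     else if j \<le> 2 then perp_geodesic (F j) (x i)
     else ideal_geodesic (x i) (x j))"

definition edge :: "(nat \<Rightarrow> (real^4) set) \<Rightarrow> (nat \<Rightarrow> real^4) \<Rightarrow> nat \<Rightarrow> nat \<Rightarrow> (real^4) set"
  where "edge F x i j =
    (if i \<le> 2 \<and> j \<le> 2 then shortest_arc (F i) (F j)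
     else if i \<le> 2 then perp_ray (F i) (x j)
     else if j \<le> 2 then perp_ray (F j) (x i)
     else ideal_geodesic (x i) (x j))"

definition hat_plane :: "(nat \<Rightarrow> (real^4) set) \<Rightarrow> (nat \<Rightarrow> real^4) \<Rightarrow> nat \<Rightarrow> (real^4) set"
  where "hat_plane P x i = (THE Q. is_plane Q \<and>
    (\<forall>j\<in>{1,2} - {i}. planes_perp Q (P j)) \<and> (\<forall>j\<in>{3,4} - {i}. x j \<in> ideal_boundary Q))"

definition hat_half :: "(nat \<Rightarrow> (real^4) set) \<Rightarrow> (nat \<Rightarrow> real^4) \<Rightarrow> nat \<Rightarrow> (real^4) set"
  where "hat_half P x i = (THE K. half_of hyp3 (hat_plane P x i) K \<and>
    (if i \<le> 2
     then edge P x (3 - i) i \<subseteq> K \<and> edge P x i 3 \<subseteq> K \<and> edge P x i 4 \<subseteq> K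
     else edge_line P x 1 i \<subseteq> K \<and> edge_line P x 2 i \<subseteq> K \<and> edge_line P x 3 4 \<subseteq> K))"

text \<open>The degenerate case. Here \<^term>\<open>Q\<close> is the plane with which all \<open>hat_plane P x i\<close> coincide, and the
  objects numbered 1, 2 are the geodesics \<open>F i = P i \<inter> Q\<close>.\<close>

definition object_in_half ::
  "(real^4) set \<Rightarrow> (nat \<Rightarrow> (real^4) set) \<Rightarrow> (nat \<Rightarrow> real^4) \<Rightarrow> (real^4) set \<Rightarrow> (real^4) set \<Rightarrow> nat \<Rightarrow> bool"
  where "object_in_half Q F x L h r \<longleftrightarrow>
    (if r \<le> 2 then F r \<subseteq> h else x r \<in> half_ideal_boundary Q L h)"

definition separates ::
  "(real^4) set \<Rightarrow> (nat \<Rightarrow> (real^4) set) \<Rightarrow> (nat \<Rightarrow> real^4) \<Rightarrow> (real^4) set \<Rightarrow> nat \<Rightarrow> nat \<Rightarrow> bool"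
  where "separates Q F x L r s \<longleftrightarrow> (\<exists>h h'. half_of Q L h \<and> half_of Q L h' \<and> h \<noteq> h' \<and>
    object_in_half Q F x L h r \<and> object_in_half Q F x L h' s)"

definition side_half ::
  "(real^4) set \<Rightarrow> (nat \<Rightarrow> (real^4) set) \<Rightarrow> (nat \<Rightarrow> real^4) \<Rightarrow> nat \<Rightarrow> nat \<Rightarrow> (real^4) set"
  where "side_half Q F x p q = (THE h. half_of Q (edge_line F x p q) h \<and>
    (\<forall>r \<in> {1..4} - {p, q}. object_in_half Q F x (edge_line F x p q) h r))"

text \<open>\<^term>\<open>\<sigma>\<close> is a renumbering of the four objects, putting them in cyclic order around \<^term>\<open>Q\<close>.\<close>

definition is_flat_tet :: "(real^4) set \<Rightarrow> (nat \<Rightarrow> (real^4) set) \<Rightarrow> (nat \<Rightarrow> (real^4) set) \<Rightarrow>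
    (nat \<Rightarrow> real^4) \<Rightarrow> (real^4) set \<Rightarrow> bool"
  where "is_flat_tet Q F H x \<Delta> \<longleftrightarrow> (\<exists>\<sigma>. \<sigma> permutes {1..4} \<and>
    separates Q F x (edge_line F x (\<sigma> 1) (\<sigma> 3)) (\<sigma> 2) (\<sigma> 4) \<and>
    \<Delta> = Q \<inter> H 1 \<inter> H 2 \<inter> side_half Q F x (\<sigma> 1) (\<sigma> 2) \<inter> side_half Q F x (\<sigma> 2) (\<sigma> 3)
          \<inter> side_half Q F x (\<sigma> 3) (\<sigma> 4) \<inter> side_half Q F x (\<sigma> 1) (\<sigma> 4))"

definition trunc_tet :: "(nat \<Rightarrow> (real^4) set) \<Rightarrow> (nat \<Rightarrow> (real^4) set) \<Rightarrow> (nat \<Rightarrow> real^4) \<Rightarrow> (real^4) set"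
  where "trunc_tet P H x =
    (if planes_perp (hat_plane P x 1) (P 1)
     then (THE \<Delta>. is_flat_tet (hat_plane P x 1) (\<lambda>i. P i \<inter> hat_plane P x 1) H x \<Delta>)
     else H 1 \<inter> H 2 \<inter> (\<Inter>i\<in>{1..4}. hat_half P x i))"


section \<open>The transversal length\<close>

definition cosh_dist :: "(real \<Rightarrow> real^4) \<Rightarrow> (real \<Rightarrow> real^4) \<Rightarrow> real \<times> real \<Rightarrow> real"
  where "cosh_dist \<gamma> \<delta> = (\<lambda>(s, t). cosh (hdist (\<gamma> s) (\<delta> t)))"

definition critical_point :: "(real \<times> real \<Rightarrow> real) \<Rightarrow> real \<times> real \<Rightarrow> bool"
  where "critical_point f p \<longleftrightarrow> (f has_derivative (\<lambda>_. 0)) (at p)"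

definition transversal_length :: "(real^4) set \<Rightarrow> (real^4) set \<Rightarrow> real"
  where "transversal_length A B = (THE l. \<exists>p\<in>A. \<exists>q\<in>B. l = hdist p q \<and>
    (\<forall>p'\<in>A. \<forall>q'\<in>B. hdist p q \<le> hdist p' q'))"

text \<open>\<open>tet_lengths P x\<close> is \<open>(l\<^sub>1\<^sub>2, h\<^sub>1\<^sub>3, h\<^sub>1\<^sub>4, h\<^sub>2\<^sub>3, h\<^sub>2\<^sub>4, d\<^sub>3\<^sub>4)\<close>, and \<open>tet_params P x\<close> is
  \<open>(x, y, a, b, c, d) = (exp h\<^sub>1\<^sub>3, exp h\<^sub>2\<^sub>4, cosh l\<^sub>1\<^sub>2, exp h\<^sub>1\<^sub>4, exp h\<^sub>2\<^sub>3, exp d\<^sub>3\<^sub>4)\<close>.\<close>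

definition tet_lengths ::
  "(nat \<Rightarrow> (real^4) set) \<Rightarrow> (nat \<Rightarrow> real^4) \<Rightarrow> real \<times> real \<times> real \<times> real \<times> real \<times> real"
  where "tet_lengths P x =
    (hset_dist (P 1) (P 2),
     sdist_plane_horoball (P 1) (x 3), sdist_plane_horoball (P 1) (x 4),
     sdist_plane_horoball (P 2) (x 3), sdist_plane_horoball (P 2) (x 4),
     sdist_horoballs (x 3) (x 4))"

definition tet_params ::
  "(nat \<Rightarrow> (real^4) set) \<Rightarrow> (nat \<Rightarrow> real^4) \<Rightarrow> real \<times> real \<times> real \<times> real \<times> real \<times> real"
  where "tet_params P x =
    (exp (sdist_plane_horoball (P 1) (x 3)), exp (sdist_plane_horoball (P 2) (x 4)),
     cosh (hset_dist (P 1) (P 2)),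
     exp (sdist_plane_horoball (P 1) (x 4)), exp (sdist_plane_horoball (P 2) (x 3)),
     exp (sdist_horoballs (x 3) (x 4)))"

definition realizable :: "real \<Rightarrow> real \<Rightarrow> real \<Rightarrow> real \<Rightarrow> real \<Rightarrow> real \<Rightarrow> bool"
  where "realizable X Y a b c d \<longleftrightarrow> (\<exists>P H x. tet_data P H x \<and> tet_params P x = (X, Y, a, b, c, d))"

text \<open>\<^term>\<open>T2rr X Y a b c d\<close> is meaningful on realizable parameters only: not every tuple with
  \<^term>\<open>a > 1\<close> and positive other entries comes from a configuration in hyperbolic 3-space.\<close>

definition T2rr :: "real \<Rightarrow> real \<Rightarrow> real \<Rightarrow> real \<Rightarrow> real \<Rightarrow> real \<Rightarrow> real"
  where "T2rr X Y a b c d = (THE l. \<exists>P H x. tet_data P H x \<and> tet_params P x = (X, Y, a, b, c, d) \<and>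
    l = transversal_length (edge P x 1 3) (edge P x 2 4))"

end

theory Submission
  imports Defs
begin

text \<open>Let \<open>e 1\<close>, \<open>e 2\<close> be the outward unit normals of the two planes and \<open>e 3\<close>, \<open>e 4\<close> the two
  light-like vectors. The hypotheses say that these four vectors have pairwise negative products, and
  the parameters are, up to normalization, these products. The geodesic joining objects \<open>i\<close> and \<open>j\<close>
  is cut out by \<open>span {e i, e j}\<close>, the faces by the spans of three of the vectors, and the points of
  the edges are non-negative combinations of the \<open>e i\<close>; such a combination lies in the tetrahedron
  as soon as it lies in the half-spaces of the two planes. In the degenerate case the \<open>e i\<close> satisfy a
  single linear relation, the negative products force two positive and two negative coefficients, and
  the coefficient signs tell which pairs of objects are opposite.

  In arclength parameters the hyperbolic cosine of the distance between the two geodesics is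
  \<open>A exp (s + t) + B exp (s - t) + C exp (t - s) + E exp (- s - t)\<close> with positive coefficients, so the
  AM-GM inequality gives the minimum \<open>2 sqrt (A E) + 2 sqrt (B C)\<close>, attained exactly where the
  partial derivatives vanish. As \<open>A < B < E\<close> and \<open>A < C < E\<close>, both parameters of the minimum are positive,
  that is, it is attained on the edges.\<close>

section \<open>Minkowski space\<close>

text \<open>The definitions describe objects by \<open>THE\<close>, \<open>Inf\<close>,
  \<open>closure\<close> and \<open>components\<close>, so most of the work turns these into sign
  conditions on products with the \<open>e i\<close>; the rest is a computation with their Gram
  matrix, whose off-diagonal entries are the parameters up to sign and a factor 2. This is why the
  minimum depends on the lengths alone. Uniqueness behind the \<open>THE\<close> of a geodesic comes
  from two facts: a geodesic is determined by two independent vectors of its span, and two points of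
  \<open>hyp3\<close> with product -1 coincide. Membership in the tetrahedron is tested dually.
  Coefficients of \<open>v\<close> in the \<open>e i\<close> are not unique when the
  \<open>e i\<close> are dependent; the hypothesis used instead is that every \<open>m\<close> with
  nonnegative products with all \<open>e i\<close> has a nonnegative product with \<open>v\<close>.
  It serves the solid and the degenerate tetrahedron alike. In the degenerate case the renumbering
  \<open>\<sigma>\<close> is not unique either, so the result must be shown not to depend on it.
  Perpendiculars are described relative to a subspace \<open>W\<close>, the whole space or the span
  of the degenerate plane, so that both cases share one proof.\<close>

lemma lform_commute: "x \<circ>\<^sub>L y = y \<circ>\<^sub>L x"
  by (simp add: lform_def algebra_simps)

lemma lform_add_left: "(x + y) \<circ>\<^sub>L z = x \<circ>\<^sub>L z + y \<circ>\<^sub>L z"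
  and lform_add_right: "z \<circ>\<^sub>L (x + y) = z \<circ>\<^sub>L x + z \<circ>\<^sub>L y"
  and lform_diff_left: "(x - y) \<circ>\<^sub>L z = x \<circ>\<^sub>L z - y \<circ>\<^sub>L z"
  and lform_diff_right: "z \<circ>\<^sub>L (x - y) = z \<circ>\<^sub>L x - z \<circ>\<^sub>L y"
  and lform_minus_left: "(- x) \<circ>\<^sub>L z = - (x \<circ>\<^sub>L z)"
  and lform_minus_right: "z \<circ>\<^sub>L (- x) = - (z \<circ>\<^sub>L x)"
  and lform_scale_left: "(c *\<^sub>R x) \<circ>\<^sub>L z = c * (x \<circ>\<^sub>L z)"
  and lform_scale_right: "z \<circ>\<^sub>L (c *\<^sub>R x) = c * (z \<circ>\<^sub>L x)"
  and lform_zero_left: "0 \<circ>\<^sub>L z = 0"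
  and lform_zero_right: "z \<circ>\<^sub>L 0 = 0"
  by (simp_all add: lform_def algebra_simps)

lemmas lform_simps = lform_add_left lform_add_right lform_diff_left lform_diff_right
  lform_minus_left lform_minus_right lform_scale_left lform_scale_right
  lform_zero_left lform_zero_right

lemma continuous_on_lform [continuous_intros]:
  "continuous_on S f \<Longrightarrow> continuous_on S g \<Longrightarrow> continuous_on S (\<lambda>z. f z \<circ>\<^sub>L g z)"
  unfolding lform_def by (intro continuous_intros)

lemma tendsto_lform [tendsto_intros]:
  "(f \<longlongrightarrow> a) F \<Longrightarrow> (g \<longlongrightarrow> b) F \<Longrightarrow> ((\<lambda>z. f z \<circ>\<^sub>L g z) \<longlongrightarrow> a \<circ>\<^sub>L b) F"
  unfolding lform_def by (intro tendsto_intros)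

abbreviation "orth n \<equiv> {v. n \<circ>\<^sub>L v = 0}"
abbreviation "hplane n \<equiv> {v \<in> hyp3. n \<circ>\<^sub>L v = 0}"
abbreviation "hhalf n \<equiv> {v \<in> hyp3. n \<circ>\<^sub>L v \<ge> 0}"

lemma lform_orthogonal_span:
  assumes "\<And>v. v \<in> B \<Longrightarrow> m \<circ>\<^sub>L v = 0" and "u \<in> span B"
  shows "m \<circ>\<^sub>L u = 0"
  using assms(2) by (induction rule: span_induct_alt) (auto simp: lform_simps assms(1))

lemma subspace_lform_orthogonal: "subspace (orth m)"
  by (auto simp: subspace_def lform_simps)

text \<open>Flipping the sign of the first coordinate turns one form into the other, so library
  facts on Euclidean hyperplanes and orthogonal complements become available for the Lorentz
  form.\<close>

lemma inner_eq_lform: "\<exists>m. (\<forall>v. a \<bullet> v = m \<circ>\<^sub>L v) \<and> (a \<noteq> 0 \<longrightarrow> m \<noteq> 0)" for a :: "real^4"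
proof -
  define m :: "real^4" where "m = (\<chi> i. if i = 1 then - a $ 1 else a $ i)"
  have "\<forall>v. a \<bullet> v = m \<circ>\<^sub>L v"
    by (auto simp: m_def lform_def inner_vec_def sum_4)
  moreover have "a = 0" if "m = 0"
    using calculation that by (metis lform_zero_left inner_eq_zero_iff)
  ultimately show ?thesis by blast
qed

lemma lform_eq_inner: "\<exists>a. (\<forall>v. m \<circ>\<^sub>L v = a \<bullet> v) \<and> (m \<noteq> 0 \<longrightarrow> a \<noteq> 0)"
proof -
  define a :: "real^4" where "a = (\<chi> i. if i = 1 then - m $ 1 else m $ i)"
  have "\<forall>v. m \<circ>\<^sub>L v = a \<bullet> v"
    by (auto simp: a_def lform_def inner_vec_def sum_4)
  moreover have "m = 0" if "a = 0"
    using that by (auto simp: a_def vec_eq_iff split: if_splits)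
  ultimately show ?thesis by blast
qed

lemma dim_lform_orthogonal:
  assumes "m \<noteq> 0" shows "dim (orth m) = 3"
proof -
  obtain a where "\<forall>v. m \<circ>\<^sub>L v = a \<bullet> v" "a \<noteq> 0" using lform_eq_inner assms by metis
  then show ?thesis using dim_hyperplane[of a] by simp
qed

section \<open>Causal character of vectors and signs of products\<close>

lemma spatial_Cauchy_Schwarz:
  "(x$2 * y$2 + x$3 * y$3 + x$4 * y$4)\<^sup>2
    \<le> ((x$2)\<^sup>2 + (x$3)\<^sup>2 + (x$4)\<^sup>2) * ((y$2)\<^sup>2 + (y$3)\<^sup>2 + (y$4)\<^sup>2)" for x y :: "real^4"
proof -
  have "((x$2)\<^sup>2 + (x$3)\<^sup>2 + (x$4)\<^sup>2) * ((y$2)\<^sup>2 + (y$3)\<^sup>2 + (y$4)\<^sup>2)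
      - (x$2 * y$2 + x$3 * y$3 + x$4 * y$4)\<^sup>2
    = (x$2 * y$3 - x$3 * y$2)\<^sup>2 + (x$2 * y$4 - x$4 * y$2)\<^sup>2 + (x$3 * y$4 - x$4 * y$3)\<^sup>2"
    by (simp add: power2_eq_square algebra_simps)
  moreover have "0 \<le> (x$2 * y$3 - x$3 * y$2)\<^sup>2 + (x$2 * y$4 - x$4 * y$2)\<^sup>2 + (x$3 * y$4 - x$4 * y$3)\<^sup>2"
    by simp
  ultimately show ?thesis by linarith
qed

text \<open>The form is positive definite on the complement of a time-like vector. Most inequalities
  below apply this to the component of some vector orthogonal to a point of
  \<open>hyp3\<close>.\<close>

lemma orthogonal_timelike_pos:
  assumes "timelike v" "w \<circ>\<^sub>L v = 0" "w \<noteq> 0"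
  shows "w \<circ>\<^sub>L w > 0"
proof -
  define V W where "V = (v$2)\<^sup>2 + (v$3)\<^sup>2 + (v$4)\<^sup>2" and "W = (w$2)\<^sup>2 + (w$3)\<^sup>2 + (w$4)\<^sup>2"
  have V: "V < (v$1)\<^sup>2" "V \<ge> 0" "W \<ge> 0"
    using assms(1) by (auto simp: timelike_def lform_def V_def W_def power2_eq_square)
  have "w$1 * v$1 = w$2 * v$2 + w$3 * v$3 + w$4 * v$4" using assms(2) by (simp add: lform_def)
  then have le: "(w$1)\<^sup>2 * (v$1)\<^sup>2 \<le> W * V"
    using spatial_Cauchy_Schwarz[of w v] by (simp add: V_def W_def flip: power_mult_distrib)
  have pos: "(v$1)\<^sup>2 > 0" using V by linarith
  have "(w$1)\<^sup>2 < W"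
  proof (cases "W = 0")
    case True
    then have "(w$1)\<^sup>2 = 0" using le pos by (simp add: mult_le_0_iff)
    with True have "w = 0"
      by (simp add: W_def vec_eq_iff forall_4 add_nonneg_eq_0_iff)
    with assms show ?thesis by simp
  next
    case False
    then have "W * V < W * (v$1)\<^sup>2" using V by simp
    then have "(w$1)\<^sup>2 * (v$1)\<^sup>2 < W * (v$1)\<^sup>2" using le by simp
    then show ?thesis using pos by (simp add: mult_less_cancel_right)
  qed
  then show ?thesis by (simp add: lform_def W_def power2_eq_square)
qed

lemma orthogonal_timelike_nonneg:
  assumes "timelike v" "w \<circ>\<^sub>L v = 0"
  shows "w \<circ>\<^sub>L w \<ge> 0"
  using orthogonal_timelike_pos[OF assms] by (cases "w = 0") (auto simp: lform_simps)

text \<open>Reversed Cauchy-Schwarz: the time coordinates dominate the spatial parts, strictly for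
  \<open>v\<close>, so the time term decides the sign.\<close>

lemma causal_lform_neg:
  assumes "timelike v" "v$1 > 0" "x \<circ>\<^sub>L x \<le> 0" "x$1 > 0"
  shows "v \<circ>\<^sub>L x < 0"
proof -
  define V X where "V = (v$2)\<^sup>2 + (v$3)\<^sup>2 + (v$4)\<^sup>2" and "X = (x$2)\<^sup>2 + (x$3)\<^sup>2 + (x$4)\<^sup>2"
  have V: "V < (v$1)\<^sup>2" "V \<ge> 0" "X \<le> (x$1)\<^sup>2" "X \<ge> 0"
    using assms by (auto simp: timelike_def lform_def V_def X_def power2_eq_square)
  have "(v$2 * x$2 + v$3 * x$3 + v$4 * x$4)\<^sup>2 \<le> V * X"
    using spatial_Cauchy_Schwarz[of v x] by (simp add: V_def X_def)
  also have "\<dots> \<le> V * (x$1)\<^sup>2" using V by (simp add: mult_left_mono)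
  also have "\<dots> < (v$1)\<^sup>2 * (x$1)\<^sup>2" using V assms by simp
  finally have "(v$2 * x$2 + v$3 * x$3 + v$4 * x$4)\<^sup>2 < (v$1 * x$1)\<^sup>2"
    by (simp add: power_mult_distrib)
  then have "v$2 * x$2 + v$3 * x$3 + v$4 * x$4 < v$1 * x$1"
    by (rule power2_less_imp_less) (use assms in simp)
  then show ?thesis by (simp add: lform_def)
qed

lemma timelike_nth_nonzero: assumes "timelike v" shows "v$1 \<noteq> 0"
proof
  assume "v$1 = 0"
  then have "v \<circ>\<^sub>L v = (v$2)\<^sup>2 + (v$3)\<^sup>2 + (v$4)\<^sup>2" by (simp add: lform_def power2_eq_square)
  then have "v \<circ>\<^sub>L v \<ge> 0" by simp
  with assms show False by (simp add: timelike_def)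
qed

text \<open>If \<open>v\<close> were in the past cone, \<open>- v\<close> would be in the future
  cone and \<open>causal_lform_neg\<close> would give the opposite sign. Together with
  \<open>hyp3_futureI\<close> this decides on which sheet of the hyperboloid a constructed vector
  lies.\<close>

lemma timelike_future:
  assumes "timelike v" "x \<circ>\<^sub>L x \<le> 0" "x$1 > 0" "v \<circ>\<^sub>L x < 0"
  shows "v$1 > 0"
proof (rule ccontr)
  assume "\<not> v$1 > 0"
  moreover have "v$1 \<noteq> 0" using assms(1) by (rule timelike_nth_nonzero)
  ultimately have "(- v) \<circ>\<^sub>L x < 0"
    using assms by (intro causal_lform_neg) (auto simp: timelike_def lform_simps)
  then show False using assms by (simp add: lform_simps)
qed

lemma hyp3_futureI:
  assumes "v \<circ>\<^sub>L v = -1" "x \<circ>\<^sub>L x \<le> 0" "x$1 > 0" "v \<circ>\<^sub>L x < 0"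
  shows "v \<in> hyp3"
  using assms timelike_future[of v x] by (simp add: hyp3_def timelike_def)

lemma hyp3_self: "v \<in> hyp3 \<Longrightarrow> v \<circ>\<^sub>L v = -1"
  and hyp3_timelike: "v \<in> hyp3 \<Longrightarrow> timelike v"
  and hyp3_pos: "v \<in> hyp3 \<Longrightarrow> v$1 > 0"
  by (auto simp: hyp3_def timelike_def)

lemma hyp3_lform_lightlike: "v \<in> hyp3 \<Longrightarrow> pos_lightlike x \<Longrightarrow> v \<circ>\<^sub>L x < 0"
  by (intro causal_lform_neg) (auto simp: hyp3_timelike hyp3_pos pos_lightlike_def)

lemma hyp3_lform_neg: "v \<in> hyp3 \<Longrightarrow> w \<in> hyp3 \<Longrightarrow> v \<circ>\<^sub>L w < 0"
  by (intro causal_lform_neg) (auto simp: hyp3_timelike hyp3_pos hyp3_self)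

lemma hyp3_lform_le: assumes "v \<in> hyp3" "w \<in> hyp3" shows "v \<circ>\<^sub>L w \<le> -1"
proof -
  \<comment> \<open>As \<open>v\<close> has square -1, this is the component of \<open>w\<close>
    orthogonal to \<open>v\<close>.\<close>
  let ?u = "w + (v \<circ>\<^sub>L w) *\<^sub>R v"
  have "?u \<circ>\<^sub>L v = 0" using assms by (simp add: lform_simps hyp3_self lform_commute)
  then have "?u \<circ>\<^sub>L ?u \<ge> 0" using assms orthogonal_timelike_nonneg hyp3_timelike by blast
  then have "(v \<circ>\<^sub>L w)\<^sup>2 \<ge> 1"
    using assms by (simp add: lform_simps hyp3_self lform_commute[of w v] power2_eq_square)
  then have "1\<^sup>2 \<le> (- (v \<circ>\<^sub>L w))\<^sup>2" by simp
  then have "1 \<le> - (v \<circ>\<^sub>L w)"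
    by (rule power2_le_imp_le) (use hyp3_lform_neg[OF assms] in simp)
  then show ?thesis by simp
qed

lemma hyp3_eqI: assumes "v \<in> hyp3" "w \<in> hyp3" "(v \<circ>\<^sub>L w)\<^sup>2 = 1" shows "v = w"
proof -
  have e: "v \<circ>\<^sub>L w = -1" using assms hyp3_lform_le[OF assms(1,2)] by (auto simp: power2_eq_1_iff)
  let ?u = "w - v"
  have "?u \<circ>\<^sub>L v = 0" using assms e by (simp add: lform_simps hyp3_self lform_commute)
  moreover have "?u \<circ>\<^sub>L ?u = 0"
    using assms e by (simp add: lform_simps hyp3_self lform_commute[of w v])
  ultimately show ?thesis using assms orthogonal_timelike_pos hyp3_timelike
    by (metis less_irrefl right_minus_eq)
qed

lemma lform_Cauchy_Schwarz:
  assumes "timelike v" "u \<circ>\<^sub>L v = 0" "w \<circ>\<^sub>L v = 0"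
  shows "(u \<circ>\<^sub>L w)\<^sup>2 \<le> (u \<circ>\<^sub>L u) * (w \<circ>\<^sub>L w)"
proof (cases "w = 0")
  case False
  let ?z = "(w \<circ>\<^sub>L w) *\<^sub>R u - (u \<circ>\<^sub>L w) *\<^sub>R w"
  have w: "w \<circ>\<^sub>L w > 0" using orthogonal_timelike_pos assms False by blast
  have "?z \<circ>\<^sub>L v = 0" using assms by (simp add: lform_simps)
  then have "?z \<circ>\<^sub>L ?z \<ge> 0" using assms orthogonal_timelike_nonneg by blast
  moreover have "?z \<circ>\<^sub>L ?z = (w \<circ>\<^sub>L w) * ((u \<circ>\<^sub>L u) * (w \<circ>\<^sub>L w) - (u \<circ>\<^sub>L w)\<^sup>2)"
    by (simp add: lform_simps lform_commute[of w u] power2_eq_square algebra_simps)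
  ultimately show ?thesis using w by (simp add: zero_le_mult_iff)
qed (simp add: lform_simps)

text \<open>The radial projection of the future cone onto \<open>hyp3\<close>. On time-like vectors
  the factor is positive, so linear subspaces and signs of linear functionals are preserved.\<close>

definition hnormalize :: "real^4 \<Rightarrow> real^4" where
  "hnormalize v = (1 / sqrt (- (v \<circ>\<^sub>L v))) *\<^sub>R v"

lemma hnormalize_in_hyp3:
  assumes "timelike v" "v$1 > 0" shows "hnormalize v \<in> hyp3"
proof -
  have "v \<circ>\<^sub>L v < 0" using assms by (simp add: timelike_def)
  then have "v \<circ>\<^sub>L v / (sqrt (- (v \<circ>\<^sub>L v)) * sqrt (- (v \<circ>\<^sub>L v))) = -1"
    by (simp add: divide_eq_eq)
  then show ?thesis using assms
    by (simp add: hyp3_def hnormalize_def lform_simps timelike_def)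
qed

lemma hnormalize_lform_sgn:
  assumes "timelike v"
  shows "g \<circ>\<^sub>L hnormalize v > 0 \<longleftrightarrow> g \<circ>\<^sub>L v > 0" "g \<circ>\<^sub>L hnormalize v = 0 \<longleftrightarrow> g \<circ>\<^sub>L v = 0"
    "g \<circ>\<^sub>L hnormalize v < 0 \<longleftrightarrow> g \<circ>\<^sub>L v < 0"
  using assms by (auto simp: hnormalize_def lform_simps timelike_def zero_less_divide_iff divide_less_0_iff)

lemma hnormalize_hyp3: "v \<in> hyp3 \<Longrightarrow> hnormalize v = v"
  by (simp add: hnormalize_def hyp3_self)

lemma hnormalize_subspace: "subspace U \<Longrightarrow> v \<in> U \<Longrightarrow> hnormalize v \<in> U"
  by (simp add: hnormalize_def subspace_scale)

lemma closed_hyp3: "closed hyp3"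
proof -
  have eq: "hyp3 = {v. v$1 \<ge> 1} \<inter> {v. v \<circ>\<^sub>L v = -1}"
  proof (safe)
    fix v :: "real^4" assume v: "v \<in> hyp3"
    then have "(v$1)\<^sup>2 = 1 + (v$2)\<^sup>2 + (v$3)\<^sup>2 + (v$4)\<^sup>2" and pos: "v$1 > 0"
      by (auto simp: hyp3_def lform_def power2_eq_square)
    then have "1\<^sup>2 \<le> (v$1)\<^sup>2" by simp
    then show "v$1 \<ge> 1" using pos by (rule power2_le_imp_le[OF _ less_imp_le])
  qed (auto simp: hyp3_def)
  have "closed {v::real^4. v$1 \<ge> 1}"
    by (intro closed_Collect_le continuous_intros)
  moreover have "closed {v::real^4. v \<circ>\<^sub>L v = -1}"
    by (intro closed_Collect_eq continuous_intros)
  ultimately show ?thesis unfolding eq by (rule closed_Int)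
qed

lemma timelike_exists_hyp3:
  assumes "subspace U" "v \<in> U" "timelike v" shows "\<exists>p. p \<in> U \<inter> hyp3"
proof -
  have "v$1 \<noteq> 0" using assms(3) by (rule timelike_nth_nonzero)
  then consider "v$1 > 0" | "(- v)$1 > 0" by (auto simp: neq_iff)
  then show ?thesis
  proof cases
    case 1
    then have "hnormalize v \<in> U \<inter> hyp3" using assms
      by (intro IntI hnormalize_in_hyp3 hnormalize_subspace)
    then show ?thesis by blast
  next
    case 2
    then have "hnormalize (- v) \<in> U \<inter> hyp3" using assms
      by (intro IntI hnormalize_in_hyp3 hnormalize_subspace)
        (auto simp: timelike_def lform_simps subspace_neg)
    then show ?thesis by blast
  qed
qed

text \<open>The future cone is open. It is phrased with a one-sided filter because
  \<open>perturb_in_C\<close> lets the perturbation tend to 0.\<close>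

lemma timelike_perturb:
  assumes "p \<in> hyp3"
  shows "\<forall>\<^sub>F \<epsilon> in at_right 0. timelike (p + \<epsilon> *\<^sub>R u) \<and> (p + \<epsilon> *\<^sub>R u)$1 > 0"
proof -
  have "((\<lambda>\<epsilon>. p + \<epsilon> *\<^sub>R u) \<longlongrightarrow> p + 0 *\<^sub>R u) (at_right 0)"
    by (intro tendsto_intros)
  then have lim: "((\<lambda>\<epsilon>. p + \<epsilon> *\<^sub>R u) \<longlongrightarrow> p) (at_right 0)" by simp
  have "((\<lambda>\<epsilon>. (p + \<epsilon> *\<^sub>R u) \<circ>\<^sub>L (p + \<epsilon> *\<^sub>R u)) \<longlongrightarrow> p \<circ>\<^sub>L p) (at_right 0)"
    by (intro tendsto_lform lim)
  then have "\<forall>\<^sub>F \<epsilon> in at_right 0. (p + \<epsilon> *\<^sub>R u) \<circ>\<^sub>L (p + \<epsilon> *\<^sub>R u) < 0"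
    using assms by (intro order_tendstoD) (auto simp: hyp3_self)
  moreover have "\<forall>\<^sub>F \<epsilon> in at_right 0. (p + \<epsilon> *\<^sub>R u)$1 > 0"
    using assms by (intro order_tendstoD[OF tendsto_vec_nth[OF lim]]) (auto simp: hyp3_pos)
  ultimately show ?thesis by eventually_elim (auto simp: timelike_def)
qed

lemma timelike_perturbE:
  assumes "p \<in> hyp3"
  obtains \<epsilon> where "\<epsilon> > 0" "timelike (p + \<epsilon> *\<^sub>R u)" "(p + \<epsilon> *\<^sub>R u)$1 > 0"
proof -
  have "\<forall>\<^sub>F \<epsilon> in at_right (0::real). \<epsilon> > 0" by (simp add: eventually_at_right_less)
  with timelike_perturb[OF assms, of u]
  have "\<forall>\<^sub>F \<epsilon> in at_right 0. \<epsilon> > 0 \<and> timelike (p + \<epsilon> *\<^sub>R u) \<and> (p + \<epsilon> *\<^sub>R u)$1 > 0"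
    by eventually_elim auto
  then obtain \<epsilon> where "\<epsilon> > 0 \<and> timelike (p + \<epsilon> *\<^sub>R u) \<and> (p + \<epsilon> *\<^sub>R u)$1 > 0"
    using eventually_happens trivial_limit_at_right_real by blast
  then show ?thesis using that[of \<epsilon>] by simp
qed

text \<open>For any \<open>u\<close> in \<open>V\<close> and a point \<open>p\<close>, the vector
  \<open>p + \<epsilon> u\<close> is still time-like for small \<open>\<epsilon>\<close>, so
  \<open>u\<close> is a combination of \<open>p\<close> and a second point of
  \<open>V \<inter> hyp3\<close>. This is what makes \<open>span\<close> recover the subspace
  carrying a plane or geodesic.\<close>

lemma span_Int_hyp3:
  assumes "subspace V" "v \<in> V" "timelike v"
  shows "span (V \<inter> hyp3) = V"
proof
  show "span (V \<inter> hyp3) \<subseteq> V" using assms(1) by (simp add: span_minimal)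
  show "V \<subseteq> span (V \<inter> hyp3)"
  proof
    fix u assume u: "u \<in> V"
    obtain p where p: "p \<in> V \<inter> hyp3" using timelike_exists_hyp3 assms by blast
    then have "p \<in> hyp3" by simp
    then obtain \<epsilon> where \<epsilon>: "\<epsilon> > 0" "timelike (p + \<epsilon> *\<^sub>R u)" "(p + \<epsilon> *\<^sub>R u)$1 > 0"
      by (rule timelike_perturbE)
    let ?w = "p + \<epsilon> *\<^sub>R u"
    have "?w \<in> V" using p u assms(1) by (simp add: subspace_add subspace_scale)
    then have "hnormalize ?w \<in> V \<inter> hyp3" using \<epsilon> assms(1)
      by (intro IntI hnormalize_in_hyp3 hnormalize_subspace)
    then have "sqrt (- (?w \<circ>\<^sub>L ?w)) *\<^sub>R hnormalize ?w \<in> span (V \<inter> hyp3)"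
      by (intro span_scale span_base)
    then have "?w \<in> span (V \<inter> hyp3)" using \<epsilon> by (simp add: hnormalize_def timelike_def)
    moreover have "p \<in> span (V \<inter> hyp3)" using p by (rule span_base)
    ultimately have "?w - p \<in> span (V \<inter> hyp3)" by (rule span_diff)
    then have "(1 / \<epsilon>) *\<^sub>R (?w - p) \<in> span (V \<inter> hyp3)" by (rule span_scale)
    then show "u \<in> span (V \<inter> hyp3)" using \<epsilon> by simp
  qed
qed

lemma span_hyperplane_section:
  assumes "subspace W" "p \<in> W \<inter> hyp3" "n \<circ>\<^sub>L p = 0"
  shows "span {v \<in> W \<inter> hyp3. n \<circ>\<^sub>L v = 0} = {v \<in> W. n \<circ>\<^sub>L v = 0}"
proof -
  have "subspace {v \<in> W. n \<circ>\<^sub>L v = 0}" using assms(1) by (auto simp: subspace_def lform_simps)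
  then have "span ({v \<in> W. n \<circ>\<^sub>L v = 0} \<inter> hyp3) = {v \<in> W. n \<circ>\<^sub>L v = 0}"
    by (rule span_Int_hyp3[of _ p]) (use assms hyp3_timelike in auto)
  moreover have "{v \<in> W. n \<circ>\<^sub>L v = 0} \<inter> hyp3 = {v \<in> W \<inter> hyp3. n \<circ>\<^sub>L v = 0}" by auto
  ultimately show ?thesis by simp
qed

section \<open>Planes by unit normals, geodesics by spanning pairs\<close>

lemma plane_normal:
  assumes "is_plane P"
  obtains n where "n \<circ>\<^sub>L n = 1" "P = hplane n" "span P = orth n"
proof -
  obtain V v where V: "subspace V" "dim V = 3" "v \<in> V" "timelike v" "P = V \<inter> hyp3"
    using assms by (auto simp: is_plane_def)
  have "\<exists>a. a \<noteq> 0 \<and> span V = {x. a \<bullet> x = 0}" using V(2) dim_eq_hyperplane[of V] by simp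
  then obtain a where a: "a \<noteq> 0" "V = {x. a \<bullet> x = 0}" using V(1) span_eq_iff by metis
  obtain m where m: "\<forall>v. a \<bullet> v = m \<circ>\<^sub>L v" "m \<noteq> 0" using inner_eq_lform a(1) by blast
  have mm: "m \<circ>\<^sub>L m > 0" using orthogonal_timelike_pos[of v m] V a m by auto
  define n where "n = (1 / sqrt (m \<circ>\<^sub>L m)) *\<^sub>R m"
  have "n \<circ>\<^sub>L n = 1" using mm by (simp add: n_def lform_simps)
  moreover have nV: "V = orth n" using mm a m by (auto simp: n_def lform_simps)
  moreover have "P = hplane n" using V nV by auto
  moreover have "span P = V" using V span_Int_hyp3 by metis
  ultimately show ?thesis by (intro that) simp_all
qed

lemma is_planeI:
  assumes "m \<noteq> 0" "p \<in> hyp3" "m \<circ>\<^sub>L p = 0" shows "is_plane (hplane m)"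
  unfolding is_plane_def
  using assms dim_lform_orthogonal subspace_lform_orthogonal hyp3_timelike
  by (intro exI[of _ "orth m"]) auto

lemma geodesic_span:
  assumes "is_geodesic L"
  shows "dim (span L) = 2" "L = span L \<inter> hyp3"
proof -
  obtain V v where V: "subspace V" "dim V = 2" "v \<in> V" "timelike v" "L = V \<inter> hyp3"
    using assms by (auto simp: is_geodesic_def)
  then have "span L = V" using span_Int_hyp3 by metis
  with V show "dim (span L) = 2" "L = span L \<inter> hyp3" by simp_all
qed

lemma dim_span_two:
  assumes "x \<noteq> 0" "\<And>k. y \<noteq> k *\<^sub>R x" shows "dim (span {x, y}) = 2"
proof -
  have "independent {y, x}" using assms
    by (subst independent_insert) (auto simp: span_singleton independent_insert)
  moreover have "x \<noteq> y" using assms(2)[of 1] by auto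
  ultimately show ?thesis using dim_span_eq_card_independent[of "{y, x}"] by (simp add: insert_commute)
qed

text \<open>A dimension count; it supplies the uniqueness half for every geodesic defined by
  \<open>THE\<close>.\<close>

lemma geodesic_eq_span:
  assumes "is_geodesic L" "x \<in> span L" "y \<in> span L" "x \<noteq> 0" "\<And>k. y \<noteq> k *\<^sub>R x"
  shows "span L = span {x, y}" "L = span {x, y} \<inter> hyp3"
proof -
  have "span {x, y} \<subseteq> span L" using assms by (simp add: span_minimal)
  moreover have "dim (span L) \<le> dim (span {x,y})"
    using geodesic_span(1)[OF assms(1)] dim_span_two[OF assms(4,5)] by simp
  ultimately show "span L = span {x, y}" using subspace_dim_equal subspace_span by metis
  then show "L = span {x, y} \<inter> hyp3" using geodesic_span[OF assms(1)] by simp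
qed

lemma span_pair: "span {x, y} = {a *\<^sub>R x + b *\<^sub>R y | a b. True}" for x y :: "'a::real_vector"
proof -
  have "\<exists>a b. v = a *\<^sub>R x + b *\<^sub>R y" if "v \<in> span {x, y}" for v
  proof -
    from that obtain a where "v - a *\<^sub>R x \<in> span {y}" by (auto simp: span_insert)
    then obtain b where "v - a *\<^sub>R x = b *\<^sub>R y" by (auto simp: span_singleton)
    then show ?thesis by (metis add.commute diff_add_cancel)
  qed
  moreover have "a *\<^sub>R x + b *\<^sub>R y \<in> span {x, y}" for a b
    by (intro span_add span_scale span_base) auto
  ultimately show ?thesis by auto
qed

lemma span_triple: "span {x, y, z} = {a *\<^sub>R x + b *\<^sub>R y + c *\<^sub>R z | a b c. True}" for x y z :: "'a::real_vector"
proof -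
  have "\<exists>a b c. v = a *\<^sub>R x + b *\<^sub>R y + c *\<^sub>R z" if "v \<in> span {x, y, z}" for v
  proof -
    from that obtain a where "v - a *\<^sub>R x \<in> span {y, z}" by (auto simp: span_insert)
    then obtain b c where "v - a *\<^sub>R x = b *\<^sub>R y + c *\<^sub>R z" by (auto simp: span_pair)
    then have "v = a *\<^sub>R x + b *\<^sub>R y + c *\<^sub>R z" by (simp add: algebra_simps)
    then show ?thesis by blast
  qed
  moreover have "a *\<^sub>R x + b *\<^sub>R y + c *\<^sub>R z \<in> span {x, y, z}" for a b c
    by (intro span_add span_scale span_base) auto
  ultimately show ?thesis by auto
qed

lemma is_geodesicI:
  assumes "x \<noteq> 0" "\<And>k. y \<noteq> k *\<^sub>R x" "v \<in> span {x, y}" "timelike v"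
  shows "is_geodesic (span {x, y} \<inter> hyp3)" "span (span {x, y} \<inter> hyp3) = span {x, y}"
proof -
  show "is_geodesic (span {x, y} \<inter> hyp3)"
    unfolding is_geodesic_def
    using assms(3,4) dim_span_two[OF assms(1,2)] subspace_span[of "{x, y}"]
    by (intro exI[of _ "span {x, y}"]) auto
  show "span (span {x, y} \<inter> hyp3) = span {x, y}"
    by (rule span_Int_hyp3[OF subspace_span assms(3,4)])
qed

section \<open>Half-spaces and half-planes\<close>

text \<open>A connected set containing one piece cannot meet the open set around the other, so each
  piece is a maximal connected subset.\<close>

lemma components_two_open:
  assumes "open O1" "open O2" "A \<subseteq> O1" "B \<subseteq> O2" "O1 \<inter> O2 = {}"
    and "connected A" "connected B" "A \<noteq> {}" "B \<noteq> {}"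
  shows "components (A \<union> B) = {A, B}"
proof -
  have maximal: "C \<in> components (C \<union> D)"
    if "open U" "open V" "C \<subseteq> U" "D \<subseteq> V" "U \<inter> V = {}" "connected C" "C \<noteq> {}" for C D U V :: "'a set"
  proof -
    have "T = C" if T: "C \<subseteq> T" "T \<subseteq> C \<union> D" "connected T" for T
    proof -
      have "U \<inter> V \<inter> T = {}" "T \<subseteq> U \<union> V" using that \<open>C \<subseteq> U\<close> \<open>D \<subseteq> V\<close> \<open>U \<inter> V = {}\<close> by auto
      then have "U \<inter> T = {} \<or> V \<inter> T = {}" by (rule connectedD[OF T(3) \<open>open U\<close> \<open>open V\<close>])
      moreover have "U \<inter> T \<noteq> {}" using T(1) \<open>C \<subseteq> U\<close> \<open>C \<noteq> {}\<close> by auto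
      ultimately show "T = C" using T(1,2) \<open>D \<subseteq> V\<close> by auto
    qed
    then show ?thesis unfolding in_components_maximal using \<open>connected C\<close> \<open>C \<noteq> {}\<close> by simp
  qed
  have A: "A \<in> components (A \<union> B)" using assms by (intro maximal[of O1 O2]) auto
  have "B \<in> components (B \<union> A)" using assms by (intro maximal[of O2 O1]) auto
  then have B: "B \<in> components (A \<union> B)" by (simp add: Un_commute)
  have "C = A \<or> C = B" if C: "C \<in> components (A \<union> B)" for C
  proof -
    have "C \<noteq> {}" "C \<subseteq> A \<union> B"
      using in_components_nonempty[OF C] in_components_subset[OF C] by auto
    then have "C \<inter> A \<noteq> {} \<or> C \<inter> B \<noteq> {}" by blast
    then show ?thesis using components_eq[OF C A] components_eq[OF C B] by blast
  qed
  then show ?thesis using A B by blast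
qed

text \<open>The convex cone over \<open>hyp3\<close>: connectedness of halves of \<open>hyp3\<close>
  is proved here by convexity and carried over by \<open>hnormalize\<close>.\<close>

definition future_cone :: "(real^4) set" where
  "future_cone = {v. timelike v \<and> v$1 > 0}"

lemma hyp3_future_cone: "v \<in> hyp3 \<Longrightarrow> v \<in> future_cone"
  by (simp add: future_cone_def hyp3_timelike hyp3_pos)

lemma future_cone_hnormalize: "v \<in> future_cone \<Longrightarrow> hnormalize v \<in> hyp3"
  by (simp add: future_cone_def hnormalize_in_hyp3)

lemma convex_future_cone: "convex future_cone"
proof (rule convexI)
  fix u v :: "real^4" and a b :: real
  assume uv: "u \<in> future_cone" "v \<in> future_cone" and ab: "a \<ge> 0" "b \<ge> 0" "a + b = 1"
  have neg: "u \<circ>\<^sub>L u < 0" "v \<circ>\<^sub>L v < 0" using uv by (auto simp: future_cone_def timelike_def)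
  have uv': "u \<circ>\<^sub>L v < 0" using uv neg by (intro causal_lform_neg) (auto simp: future_cone_def)
  have eq: "(a *\<^sub>R u + b *\<^sub>R v) \<circ>\<^sub>L (a *\<^sub>R u + b *\<^sub>R v)
      = a\<^sup>2 * (u \<circ>\<^sub>L u) + b\<^sup>2 * (v \<circ>\<^sub>L v) + 2 * (a * b) * (u \<circ>\<^sub>L v)"
    by (simp add: lform_simps lform_commute[of v u] power2_eq_square algebra_simps)
  have le: "a\<^sup>2 * (u \<circ>\<^sub>L u) \<le> 0" "b\<^sup>2 * (v \<circ>\<^sub>L v) \<le> 0" "2 * (a * b) * (u \<circ>\<^sub>L v) \<le> 0"
    using neg uv' ab by (simp_all add: mult_nonneg_nonpos)
  have pos: "u$1 > 0" "v$1 > 0" using uv by (auto simp: future_cone_def)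
  show "a *\<^sub>R u + b *\<^sub>R v \<in> future_cone"
  proof (cases "a = 0")
    case True
    then show ?thesis using ab uv by simp
  next
    case False
    then have "a > 0" using ab by simp
    then have "a\<^sup>2 * (u \<circ>\<^sub>L u) < 0" "a * u$1 > 0" "b * v$1 \<ge> 0"
      using neg pos ab by (simp_all add: mult_pos_neg)
    then show ?thesis using eq le by (simp add: future_cone_def timelike_def)
  qed
qed

lemma tendsto_hnormalize:
  assumes "p \<in> hyp3" shows "((\<lambda>\<epsilon>. hnormalize (p + \<epsilon> *\<^sub>R u)) \<longlongrightarrow> p) (at_right 0)"
proof -
  have "((\<lambda>\<epsilon>. p + \<epsilon> *\<^sub>R u) \<longlongrightarrow> p + 0 *\<^sub>R u) (at_right 0)" by (intro tendsto_intros)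
  then have lim: "((\<lambda>\<epsilon>. p + \<epsilon> *\<^sub>R u) \<longlongrightarrow> p) (at_right 0)" by simp
  have "sqrt (- (p \<circ>\<^sub>L p)) \<noteq> 0" using assms by (simp add: hyp3_self)
  then have "((\<lambda>\<epsilon>. hnormalize (p + \<epsilon> *\<^sub>R u)) \<longlongrightarrow> (1 / sqrt (- (p \<circ>\<^sub>L p))) *\<^sub>R p) (at_right 0)"
    unfolding hnormalize_def by (intro tendsto_intros tendsto_lform lim)
  then show ?thesis using assms by (simp add: hyp3_self)
qed

lemma continuous_on_hnormalize: "continuous_on future_cone hnormalize"
  unfolding hnormalize_def[abs_def]
  by (intro continuous_intros) (auto simp: future_cone_def timelike_def)

text \<open>One setting for half-spaces (\<open>U = UNIV\<close>) and for half-planes of a plane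
  (\<open>U\<close> its span). Since \<open>g\<close> lies in \<open>U\<close> and is space-like,
  moving along \<open>g\<close> stays in \<open>U\<close> and increases the product with
  \<open>g\<close>. Replacing \<open>g\<close> by \<open>- g\<close> yields every statement for the
  other side.\<close>

locale cut =
  fixes U :: "(real^4) set" and g :: "real^4"
  assumes subspace_U: "subspace U" and g_in: "g \<in> U" and g_pos: "g \<circ>\<^sub>L g > 0"
    and cut_nonempty: "\<exists>p. p \<in> U \<inter> hyp3 \<and> g \<circ>\<^sub>L p = 0"
begin

definition "Q = U \<inter> hyp3"
definition "F = {v \<in> Q. g \<circ>\<^sub>L v = 0}"
definition "K = {v \<in> Q. g \<circ>\<^sub>L v \<ge> 0}"
definition "C = {v \<in> Q. g \<circ>\<^sub>L v > 0}"

lemma cut_minus: "cut U (- g)"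
  using g_in g_pos cut_nonempty subspace_U
  by unfold_locales (auto simp: lform_simps subspace_neg)

lemma F_minus: "cut.F U (- g) = F"
  by (simp add: cut.F_def[OF cut_minus] F_def lform_simps)

lemma K_minus: "cut.K U (- g) = {v \<in> Q. g \<circ>\<^sub>L v \<le> 0}"
  and C_minus: "cut.C U (- g) = {v \<in> Q. g \<circ>\<^sub>L v < 0}"
  by (simp_all add: cut.K_def[OF cut_minus] cut.C_def[OF cut_minus] lform_simps)

text \<open>Pushing a boundary point along \<open>g\<close> enters the open side, and normalizing
  keeps the sign. This gives both nonemptiness of \<open>C\<close> and density of \<open>C\<close>
  in \<open>K\<close>.\<close>

lemma perturb_in_C:
  assumes "v \<in> Q" "g \<circ>\<^sub>L v \<ge> 0"
  shows "\<forall>\<^sub>F \<epsilon> in at_right 0. hnormalize (v + \<epsilon> *\<^sub>R g) \<in> C"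
proof -
  have v: "v \<in> U" "v \<in> hyp3" using assms by (auto simp: Q_def)
  have "\<forall>\<^sub>F \<epsilon> in at_right (0::real). \<epsilon> > 0" by (simp add: eventually_at_right_less)
  with timelike_perturb[OF v(2), of g] show ?thesis
  proof eventually_elim
    case (elim \<epsilon>)
    have "g \<circ>\<^sub>L (v + \<epsilon> *\<^sub>R g) > 0" using elim assms g_pos by (simp add: lform_simps add_nonneg_pos)
    moreover have "v + \<epsilon> *\<^sub>R g \<in> U" using v g_in subspace_U by (simp add: subspace_add subspace_scale)
    ultimately show ?case using elim subspace_U
      by (simp add: C_def Q_def hnormalize_lform_sgn hnormalize_subspace hnormalize_in_hyp3)
  qed
qed

lemma C_nonempty: "C \<noteq> {}"
proof -
  obtain p where "p \<in> U \<inter> hyp3" "g \<circ>\<^sub>L p = 0" using cut_nonempty by blast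
  then have "\<forall>\<^sub>F \<epsilon> in at_right 0. hnormalize (p + \<epsilon> *\<^sub>R g) \<in> C"
    by (intro perturb_in_C) (auto simp: Q_def)
  then have "\<exists>\<epsilon>. hnormalize (p + \<epsilon> *\<^sub>R g) \<in> C"
    using eventually_happens trivial_limit_at_right_real by blast
  then show ?thesis by blast
qed

lemma closed_K: "closed K"
proof -
  have "closed {v. g \<circ>\<^sub>L v \<ge> 0}" by (intro closed_Collect_le continuous_intros)
  then have "closed ((U \<inter> hyp3) \<inter> {v. g \<circ>\<^sub>L v \<ge> 0})"
    by (intro closed_Int closed_hyp3 closed_subspace[OF subspace_U])
  also have "(U \<inter> hyp3) \<inter> {v. g \<circ>\<^sub>L v \<ge> 0} = K" by (auto simp: K_def Q_def)
  finally show ?thesis .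
qed

lemma closure_C: "closure C = K"
proof
  show "closure C \<subseteq> K" by (intro closure_minimal closed_K) (auto simp: C_def K_def)
  show "K \<subseteq> closure C"
  proof
    fix v assume "v \<in> K"
    then have v: "v \<in> Q" "g \<circ>\<^sub>L v \<ge> 0" "v \<in> hyp3" by (auto simp: K_def Q_def)
    have "\<forall>\<^sub>F \<epsilon> in at_right 0. hnormalize (v + \<epsilon> *\<^sub>R g) \<in> closure C"
      using perturb_in_C[OF v(1,2)] by eventually_elim (simp add: closure_subset[THEN subsetD])
    then show "v \<in> closure C"
      by (rule Lim_in_closed_set[OF closed_closure _ trivial_limit_at_right_real tendsto_hnormalize[OF v(3)]])
  qed
qed

text \<open>The open side is the image under \<open>hnormalize\<close> of a convex set: the part of
  the future cone in \<open>U\<close> where the product with \<open>g\<close> is positive.\<close>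

lemma connected_C: "connected C"
proof -
  let ?W = "U \<inter> future_cone \<inter> {v. g \<circ>\<^sub>L v > 0}"
  have "convex {v. g \<circ>\<^sub>L v > 0}"
  proof -
    obtain a where "\<forall>v. g \<circ>\<^sub>L v = a \<bullet> v" using lform_eq_inner by metis
    then show ?thesis by (simp add: convex_halfspace_gt)
  qed
  then have "convex ?W" by (intro convex_Int convex_future_cone subspace_imp_convex[OF subspace_U])
  then have "connected (hnormalize ` ?W)"
    by (intro connected_continuous_image convex_connected continuous_on_subset[OF continuous_on_hnormalize]) auto
  moreover have "hnormalize ` ?W = C"
  proof
    show "hnormalize ` ?W \<subseteq> C"
      using subspace_U by (auto simp: C_def Q_def future_cone_hnormalize hnormalize_subspace)
        (auto simp: future_cone_def hnormalize_lform_sgn)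
    show "C \<subseteq> hnormalize ` ?W"
    proof
      fix v assume "v \<in> C"
      then have "v = hnormalize v" "v \<in> ?W" by (auto simp: C_def Q_def hnormalize_hyp3 hyp3_future_cone)
      then show "v \<in> hnormalize ` ?W" by (rule image_eqI)
    qed
  qed
  ultimately show ?thesis by simp
qed

lemma open_sides: "open {v. g \<circ>\<^sub>L v > 0}" "open {v. g \<circ>\<^sub>L v < 0}"
  by (intro open_Collect_less continuous_intros)+

lemma components_cut: "components (Q - F) = {C, {v \<in> Q. g \<circ>\<^sub>L v < 0}}"
proof -
  have "components (C \<union> {v \<in> Q. g \<circ>\<^sub>L v < 0}) = {C, {v \<in> Q. g \<circ>\<^sub>L v < 0}}"
    using cut.connected_C[OF cut_minus] cut.C_nonempty[OF cut_minus]
    by (intro components_two_open[OF open_sides] connected_C C_nonempty) (auto simp: C_minus C_def)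
  also have "C \<union> {v \<in> Q. g \<circ>\<^sub>L v < 0} = Q - F" by (auto simp: C_def F_def)
  finally show ?thesis .
qed

lemma half_of_iff: "half_of Q F L \<longleftrightarrow> L = K \<or> L = {v \<in> Q. g \<circ>\<^sub>L v \<le> 0}"
  unfolding half_of_def components_cut using closure_C cut.closure_C[OF cut_minus] unfolding C_minus K_minus
  by simp

lemma span_Q: "span Q = U"
proof -
  obtain p where "p \<in> U" "timelike p" using cut_nonempty hyp3_timelike by blast
  then show ?thesis unfolding Q_def by (intro span_Int_hyp3 subspace_U)
qed

lemma span_F: "span F = {u \<in> U. g \<circ>\<^sub>L u = 0}"
proof -
  obtain p where "p \<in> U \<inter> hyp3" "g \<circ>\<^sub>L p = 0" using cut_nonempty by blast
  then show ?thesis unfolding F_def Q_def by (rule span_hyperplane_section[OF subspace_U])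
qed

text \<open>The linear counterpart of \<open>closure_C\<close>; \<open>half_ideal_boundary\<close>
  is defined by components of \<open>span Q - span F\<close>, not of \<open>Q - F\<close>.\<close>

lemma closure_linear_side: "closure {u \<in> U. g \<circ>\<^sub>L u > 0} = {u \<in> U. g \<circ>\<^sub>L u \<ge> 0}"
proof
  have "closed {u. g \<circ>\<^sub>L u \<ge> 0}" by (intro closed_Collect_le continuous_intros)
  then have "closed (U \<inter> {u. g \<circ>\<^sub>L u \<ge> 0})" by (intro closed_Int closed_subspace[OF subspace_U])
  then show "closure {u \<in> U. g \<circ>\<^sub>L u > 0} \<subseteq> {u \<in> U. g \<circ>\<^sub>L u \<ge> 0}"
    by (intro closure_minimal) (auto simp: Collect_conj_eq)
  show "{u \<in> U. g \<circ>\<^sub>L u \<ge> 0} \<subseteq> closure {u \<in> U. g \<circ>\<^sub>L u > 0}"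
  proof
    fix u assume u: "u \<in> {u \<in> U. g \<circ>\<^sub>L u \<ge> 0}"
    have "((\<lambda>\<epsilon>. u + \<epsilon> *\<^sub>R g) \<longlongrightarrow> u + 0 *\<^sub>R g) (at_right 0)" by (intro tendsto_intros)
    then have lim: "((\<lambda>\<epsilon>. u + \<epsilon> *\<^sub>R g) \<longlongrightarrow> u) (at_right 0)" by simp
    have "\<forall>\<^sub>F \<epsilon> in at_right (0::real). \<epsilon> > 0" by (simp add: eventually_at_right_less)
    then have "\<forall>\<^sub>F \<epsilon> in at_right 0. u + \<epsilon> *\<^sub>R g \<in> closure {u \<in> U. g \<circ>\<^sub>L u > 0}"
    proof eventually_elim
      case (elim \<epsilon>)
      then have "u + \<epsilon> *\<^sub>R g \<in> {u \<in> U. g \<circ>\<^sub>L u > 0}"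
        using u g_in g_pos subspace_U by (simp add: subspace_add subspace_scale lform_simps add_nonneg_pos)
      then show ?case by (rule closure_subset[THEN subsetD])
    qed
    then show "u \<in> closure {u \<in> U. g \<circ>\<^sub>L u > 0}"
      by (rule Lim_in_closed_set[OF closed_closure _ trivial_limit_at_right_real lim])
  qed
qed

lemma connected_linear_side: "connected {u \<in> U. g \<circ>\<^sub>L u > 0}"
proof -
  obtain a where a: "\<forall>v. g \<circ>\<^sub>L v = a \<bullet> v" using lform_eq_inner by metis
  have "convex (U \<inter> {v. a \<bullet> v > 0})"
    by (intro convex_Int subspace_imp_convex[OF subspace_U] convex_halfspace_gt)
  moreover have "U \<inter> {v. a \<bullet> v > 0} = {u \<in> U. g \<circ>\<^sub>L u > 0}" using a by auto
  ultimately show ?thesis using convex_connected by fastforce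
qed

lemma components_linear_cut:
  "components (span Q - span F) = {{u \<in> U. g \<circ>\<^sub>L u > 0}, {u \<in> U. g \<circ>\<^sub>L u < 0}}"
proof -
  have "components ({u \<in> U. g \<circ>\<^sub>L u > 0} \<union> {u \<in> U. g \<circ>\<^sub>L u < 0})
      = {{u \<in> U. g \<circ>\<^sub>L u > 0}, {u \<in> U. g \<circ>\<^sub>L u < 0}}"
  proof (intro components_two_open[OF open_sides] connected_linear_side)
    show "connected {u \<in> U. g \<circ>\<^sub>L u < 0}"
      using cut.connected_linear_side[OF cut_minus] by (simp add: lform_simps)
    show "{u \<in> U. g \<circ>\<^sub>L u > 0} \<noteq> {}" using g_in g_pos by blast
    have "- g \<in> {u \<in> U. g \<circ>\<^sub>L u < 0}" using g_in g_pos subspace_U by (simp add: subspace_neg lform_simps)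
    then show "{u \<in> U. g \<circ>\<^sub>L u < 0} \<noteq> {}" by blast
  qed auto
  also have "{u \<in> U. g \<circ>\<^sub>L u > 0} \<union> {u \<in> U. g \<circ>\<^sub>L u < 0} = span Q - span F"
    by (auto simp: span_Q span_F)
  finally show ?thesis .
qed

text \<open>Points of \<open>F\<close> are limits of the opposite open side and hence not interior
  to \<open>K\<close>.\<close>

lemma interior_K: "(top_of_set Q) interior_of K = C"
proof
  have "openin (top_of_set Q) (Q \<inter> {v. g \<circ>\<^sub>L v > 0})" using open_sides(1) by (rule openin_open_Int)
  moreover have "Q \<inter> {v. g \<circ>\<^sub>L v > 0} = C" by (auto simp: C_def)
  ultimately show "C \<subseteq> (top_of_set Q) interior_of K"
    by (intro interior_of_maximal) (auto simp: C_def K_def)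
  show "(top_of_set Q) interior_of K \<subseteq> C"
  proof
    fix x assume "x \<in> (top_of_set Q) interior_of K"
    then obtain T where T: "openin (top_of_set Q) T" "x \<in> T" "T \<subseteq> K"
      by (auto simp: interior_of_def)
    then obtain V where V: "open V" "T = Q \<inter> V" by (auto simp: openin_open)
    have x: "x \<in> K" "x \<in> Q" using T by (auto simp: K_def)
    moreover have "g \<circ>\<^sub>L x \<noteq> 0"
    proof
      assume "g \<circ>\<^sub>L x = 0"
      then have "x \<in> closure {v \<in> Q. g \<circ>\<^sub>L v < 0}"
        using cut.closure_C[OF cut_minus] x by (simp add: C_minus K_minus)
      then have "V \<inter> {v \<in> Q. g \<circ>\<^sub>L v < 0} \<noteq> {}"
        using V T open_Int_closure_eq_empty[OF V(1)] by blast
      then show False using V T by (auto simp: K_def)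
    qed
    ultimately show "x \<in> C" by (auto simp: K_def C_def)
  qed
qed

lemma half_ideal_boundary_K:
  "half_ideal_boundary Q F K = {x. pos_lightlike x \<and> x \<in> U \<and> g \<circ>\<^sub>L x \<ge> 0}"
proof -
  have sub: "C \<subseteq> {u \<in> U. g \<circ>\<^sub>L u > 0}" by (auto simp: C_def Q_def)
  obtain c where "c \<in> C" using C_nonempty by blast
  \<comment> \<open>Exactly one of the two linear components contains the interior of
    \<open>K\<close>, so the existential in \<open>half_ideal_boundary\<close> has a single
    candidate.\<close>
  then have nsub: "\<not> C \<subseteq> {u \<in> U. g \<circ>\<^sub>L u < 0}" using sub by force
  have "half_ideal_boundary Q F K = {x. pos_lightlike x \<and> x \<in> closure {u \<in> U. g \<circ>\<^sub>L u > 0}}"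
    unfolding half_ideal_boundary_def components_linear_cut interior_K using sub nsub by simp
  then show ?thesis by (simp add: closure_linear_side)
qed

lemma half_ideal_boundary_minus:
  "half_ideal_boundary Q F {v \<in> Q. g \<circ>\<^sub>L v \<le> 0} = {x. pos_lightlike x \<and> x \<in> U \<and> g \<circ>\<^sub>L x \<le> 0}"
  using cut.half_ideal_boundary_K[OF cut_minus] unfolding F_minus K_minus by (simp add: lform_simps)

end

section \<open>Distances and signed distances\<close>

lemma cosh_hdist: "u \<in> hyp3 \<Longrightarrow> v \<in> hyp3 \<Longrightarrow> cosh (hdist u v) = - (u \<circ>\<^sub>L v)"
  and hdist_nonneg: "u \<in> hyp3 \<Longrightarrow> v \<in> hyp3 \<Longrightarrow> hdist u v \<ge> 0"
  using hyp3_lform_le[of u v] by (simp_all add: hdist_def)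

lemma hdist_le_iff:
  assumes "u \<in> hyp3" "v \<in> hyp3" "p \<in> hyp3" "q \<in> hyp3"
  shows "hdist u v \<le> hdist p q \<longleftrightarrow> - (u \<circ>\<^sub>L v) \<le> - (p \<circ>\<^sub>L q)"
proof -
  have "hdist u v \<le> hdist p q \<longleftrightarrow> cosh (hdist u v) \<le> cosh (hdist p q)"
    using hdist_nonneg assms by (simp add: cosh_real_nonneg_le_iff)
  then show ?thesis using assms by (simp add: cosh_hdist)
qed

text \<open>The bound is \<open>cosh (ln (\<alpha> / \<beta>))\<close>: the distance between the
  horospheres through \<open>v\<close> and \<open>q\<close> centred at the ideal point of
  \<open>x\<close> is \<open>\<bar>ln (\<alpha> / \<beta>)\<bar>\<close>.\<close>

lemma hyp3_lform_horospheres: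
  assumes "v \<in> hyp3" "q \<in> hyp3" "pos_lightlike x"
  defines "\<alpha> \<equiv> - (v \<circ>\<^sub>L x)" and "\<beta> \<equiv> - (q \<circ>\<^sub>L x)"
  shows "- (v \<circ>\<^sub>L q) \<ge> (\<alpha> / \<beta> + \<beta> / \<alpha>) / 2"
proof -
  have pos: "\<alpha> > 0" "\<beta> > 0" using assms hyp3_lform_lightlike by auto
  have x: "x \<circ>\<^sub>L x = 0" "x \<noteq> 0" using assms(3) by (auto simp: pos_lightlike_def)
  let ?w = "\<alpha> *\<^sub>R q - \<beta> *\<^sub>R v"
  have "?w \<circ>\<^sub>L x = 0" by (simp add: lform_simps \<alpha>_def \<beta>_def)
  \<comment> \<open>\<open>w\<close> is orthogonal to a light-like vector, hence not time-like.\<close>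
  have "\<not> timelike ?w"
  proof
    assume t: "timelike ?w"
    have "x \<circ>\<^sub>L ?w = 0" using \<open>?w \<circ>\<^sub>L x = 0\<close> lform_commute[of x ?w] by (simp only:)
    then have "x \<circ>\<^sub>L x > 0" using orthogonal_timelike_pos[OF t] x(2) by blast
    with x show False by simp
  qed
  then have "?w \<circ>\<^sub>L ?w \<ge> 0" by (simp add: timelike_def)
  then have "- (v \<circ>\<^sub>L q) * (2 * (\<alpha> * \<beta>)) \<ge> \<alpha>\<^sup>2 + \<beta>\<^sup>2"
    using assms(1,2) by (simp add: lform_simps hyp3_self lform_commute[of q v] power2_eq_square algebra_simps)
  then show ?thesis using pos by (simp add: field_simps power2_eq_square)
qed

lemma hset_dist_horosphere:
  assumes "v \<in> hyp3" "pos_lightlike x"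
  shows "hset_dist {v} (horosphere x) = \<bar>ln (- (v \<circ>\<^sub>L x))\<bar>"
proof -
  define \<alpha> where "\<alpha> = - (v \<circ>\<^sub>L x)"
  have pos: "\<alpha> > 0" using assms hyp3_lform_lightlike by (auto simp: \<alpha>_def)
  have x: "x \<circ>\<^sub>L x = 0" "x $ 1 > 0" using assms(2) by (auto simp: pos_lightlike_def)
  have cosh: "cosh \<bar>ln \<alpha>\<bar> = (\<alpha> + 1 / \<alpha>) / 2"
    using pos by (simp add: cosh_ln_real field_simps)
  have le: "\<bar>ln \<alpha>\<bar> \<le> hdist v q" if q: "q \<in> horosphere x" for q
  proof -
    have "q \<in> hyp3" "q \<circ>\<^sub>L x = -1" using q by (auto simp: horosphere_def)
    then have "cosh \<bar>ln \<alpha>\<bar> \<le> cosh (hdist v q)"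
      using hyp3_lform_horospheres[OF assms(1) _ assms(2), of q] assms cosh
      by (simp add: cosh_hdist \<alpha>_def)
    then show ?thesis
      using hdist_nonneg[OF assms(1) \<open>q \<in> hyp3\<close>] cosh_real_nonneg_le_iff[of "\<bar>ln \<alpha>\<bar>" "hdist v q"] by simp
  qed
  \<comment> \<open>The point where the geodesic through \<open>v\<close> with ideal endpoint
    \<open>x\<close> meets the horosphere: product -1 with \<open>x\<close> forces the coefficient
    \<open>1 / \<alpha>\<close> of \<open>v\<close>, and square -1 then fixes the coefficient of
    \<open>x\<close>.\<close>
  define q where "q = (1 / \<alpha>) *\<^sub>R v + ((1 - 1 / \<alpha>\<^sup>2) / 2) *\<^sub>R x"
  have vx: "v \<circ>\<^sub>L x = - \<alpha>" "x \<circ>\<^sub>L v = - \<alpha>" by (simp_all add: \<alpha>_def lform_commute)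
  have qq: "q \<circ>\<^sub>L q = -1" and qx: "q \<circ>\<^sub>L x = -1" and vq: "v \<circ>\<^sub>L q = - (\<alpha> + 1 / \<alpha>) / 2"
    using pos assms(1) by (simp_all add: q_def lform_simps hyp3_self x vx field_simps power2_eq_square)
  have q: "q \<in> hyp3" by (rule hyp3_futureI[of q x]) (use qq qx x in simp_all)
  then have qS: "q \<in> horosphere x" using qx by (simp add: horosphere_def)
  have "- (v \<circ>\<^sub>L q) = cosh \<bar>ln \<alpha>\<bar>" unfolding cosh using vq by simp
  then have eq: "\<bar>ln \<alpha>\<bar> = hdist v q" unfolding hdist_def by (simp only: arcosh_cosh_real abs_ge_zero)
  have "{hdist p q |p q. p \<in> {v} \<and> q \<in> horosphere x} = hdist v ` horosphere x" by auto
  moreover have "Inf (hdist v ` horosphere x) = \<bar>ln \<alpha>\<bar>"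
  proof (rule cInf_eq_minimum)
    show "\<bar>ln \<alpha>\<bar> \<in> hdist v ` horosphere x" using eq qS by (rule image_eqI)
  qed (use le in blast)
  ultimately show ?thesis by (simp add: hset_dist_def \<alpha>_def)
qed

text \<open>Inside the horoball the argument of the logarithm is at most 1, so the sign convention
  of the signed distance exactly removes the absolute value.\<close>

lemma sdist_point_horoball_eq:
  assumes "v \<in> hyp3" "pos_lightlike x"
  shows "sdist_point_horoball v x = ln (- (v \<circ>\<^sub>L x))"
proof -
  have "- (v \<circ>\<^sub>L x) > 0" using hyp3_lform_lightlike[OF assms] by simp
  then show ?thesis using hset_dist_horosphere[OF assms] assms
    by (auto simp: sdist_point_horoball_def horoball_def)
qed

lemma sdist_plane_horoball_eq:
  assumes "P = hplane n" "n \<circ>\<^sub>L n = 1" "pos_lightlike x" "n \<circ>\<^sub>L x < 0"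
  shows "sdist_plane_horoball P x = ln (- (n \<circ>\<^sub>L x))"
proof -
  let ?X = "- (n \<circ>\<^sub>L x)"
  have x: "x \<circ>\<^sub>L x = 0" "x $ 1 > 0" using assms(3) by (auto simp: pos_lightlike_def)
  \<comment> \<open>The foot of the perpendicular from the ideal point to the plane, where the
    minimum is attained.\<close>
  define p where "p = (1 / ?X) *\<^sub>R x + n"
  have xn: "x \<circ>\<^sub>L n = n \<circ>\<^sub>L x" by (rule lform_commute)
  have p: "p \<circ>\<^sub>L p = -1" "n \<circ>\<^sub>L p = 0" "p \<circ>\<^sub>L x = - ?X"
    using assms by (simp_all add: p_def lform_simps x xn)
  have "p \<in> hyp3" by (rule hyp3_futureI[of p x]) (use p x assms in simp_all)
  then have pP: "p \<in> P" using p assms by simp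
  have le: "ln ?X \<le> ln (- (v \<circ>\<^sub>L x))" if "v \<in> P" for v
  proof -
    have v: "v \<in> hyp3" "n \<circ>\<^sub>L v = 0" "v \<circ>\<^sub>L v = -1" using that assms by (auto simp: hyp3_self)
    \<comment> \<open>The component of \<open>x\<close> orthogonal to \<open>v\<close>. Its square
      is the square of the product of \<open>v\<close> and \<open>x\<close>, and its product with
      \<open>n\<close> is that of \<open>x\<close>, so Cauchy-Schwarz compares exactly the two
      quantities wanted.\<close>
    let ?w = "x + (v \<circ>\<^sub>L x) *\<^sub>R v"
    have "?w \<circ>\<^sub>L v = 0" using v by (simp add: lform_simps lform_commute)
    then have "(n \<circ>\<^sub>L ?w)\<^sup>2 \<le> (n \<circ>\<^sub>L n) * (?w \<circ>\<^sub>L ?w)"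
      using v hyp3_timelike by (intro lform_Cauchy_Schwarz[of v])
    then have "?X\<^sup>2 \<le> (- (v \<circ>\<^sub>L x))\<^sup>2"
      using assms v x by (simp add: lform_simps lform_commute[of x v] power2_eq_square algebra_simps)
    then have "?X \<le> - (v \<circ>\<^sub>L x)"
      by (rule power2_le_imp_le) (use hyp3_lform_lightlike[OF v(1) assms(3)] in simp)
    then show ?thesis using assms by simp
  qed
  have im: "(\<lambda>v. sdist_point_horoball v x) ` P = (\<lambda>v. ln (- (v \<circ>\<^sub>L x))) ` P"
    using assms(1,3) by (intro image_cong refl sdist_point_horoball_eq) auto
  show ?thesis unfolding sdist_plane_horoball_def im
  proof (rule cInf_eq_minimum)
    have "ln ?X = ln (- (p \<circ>\<^sub>L x))" using p by simp
    then show "ln ?X \<in> (\<lambda>v. ln (- (v \<circ>\<^sub>L x))) ` P" using pP by (rule image_eqI)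
  qed (use le in blast)
qed

lemma lightlike_lform_neg:
  assumes "pos_lightlike x" "pos_lightlike y" "proj_class x \<noteq> proj_class y"
  shows "x \<circ>\<^sub>L y < 0"
proof (rule ccontr)
  assume "\<not> x \<circ>\<^sub>L y < 0"
  let ?e = "axis 1 1 :: real^4"
  have x: "x \<circ>\<^sub>L x = 0" "x $ 1 > 0" "y \<circ>\<^sub>L y = 0" "y $ 1 > 0"
    using assms by (auto simp: pos_lightlike_def)
  \<comment> \<open>The first coordinates cancel, so \<open>?w\<close> is orthogonal to the time
    axis and is space-like or zero; zero means that \<open>x\<close> and \<open>y\<close> are
    proportional.\<close>
  let ?w = "y $ 1 *\<^sub>R x - x $ 1 *\<^sub>R y"
  have e: "timelike ?e" "?w \<circ>\<^sub>L ?e = 0" by (auto simp: timelike_def lform_def axis_def)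
  have "?w \<circ>\<^sub>L ?w = - (2 * (x $ 1 * y $ 1) * (x \<circ>\<^sub>L y))"
    using x by (simp add: lform_simps lform_commute[of y x])
  also have "\<dots> \<le> 0" using x \<open>\<not> x \<circ>\<^sub>L y < 0\<close> by simp
  finally have "?w = 0" using orthogonal_timelike_pos[OF e] by force
  then have y: "y = (y $ 1 / x $ 1) *\<^sub>R x" using x by (simp add: vec_eq_iff field_simps)
  have "proj_class (c *\<^sub>R x) = proj_class x" if "c \<noteq> 0" for c :: real
  proof -
    have "k *\<^sub>R c *\<^sub>R x \<in> proj_class x" if "k \<noteq> 0" for k
      using that \<open>c \<noteq> 0\<close> by (auto simp: proj_class_def)
    moreover have "k *\<^sub>R x = (k / c) *\<^sub>R (c *\<^sub>R x)" for k using \<open>c \<noteq> 0\<close> by simp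
    then have "k *\<^sub>R x \<in> proj_class (c *\<^sub>R x)" if "k \<noteq> 0" for k
      unfolding proj_class_def using that \<open>c \<noteq> 0\<close> by (metis (mono_tags, lifting) divide_eq_0_iff mem_Collect_eq)
    ultimately show ?thesis unfolding proj_class_def[of x] proj_class_def[of "c *\<^sub>R x"]
      by (auto simp: proj_class_def)
  qed
  then show False using assms(3) y x by (metis divide_eq_0_iff less_irrefl)
qed

lemma sdist_horoballs_eq:
  assumes "pos_lightlike x" "pos_lightlike y" "x \<circ>\<^sub>L y < 0"
  shows "sdist_horoballs x y = ln (- (x \<circ>\<^sub>L y) / 2)"
proof -
  let ?k = "- (x \<circ>\<^sub>L y)"
  have x: "x \<circ>\<^sub>L x = 0" "x $ 1 > 0" "y \<circ>\<^sub>L y = 0" "y $ 1 > 0"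
    using assms by (auto simp: pos_lightlike_def)
  \<comment> \<open>The point of the horosphere of \<open>x\<close> on the geodesic joining the two
    ideal points: product -1 with \<open>x\<close> gives the coefficient of \<open>y\<close>, and
    square -1 gives \<open>1/2\<close>.\<close>
  define p where "p = (1/2) *\<^sub>R x + (1 / ?k) *\<^sub>R y"
  have p: "p \<circ>\<^sub>L p = -1" "p \<circ>\<^sub>L x = -1" "p \<circ>\<^sub>L y = - ?k / 2"
    using assms(3) by (simp_all add: p_def lform_simps x lform_commute[of y x])
  have "p \<in> hyp3" by (rule hyp3_futureI[of p x]) (use p x in simp_all)
  then have pP: "p \<in> horosphere x" using p by (simp add: horosphere_def)
  have le: "ln (?k / 2) \<le> ln (- (v \<circ>\<^sub>L y))" if "v \<in> horosphere x" for v
  proof -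
    have v: "v \<in> hyp3" "v \<circ>\<^sub>L x = -1" "v \<circ>\<^sub>L v = -1" using that by (auto simp: hyp3_self horosphere_def)
    define \<beta> where "\<beta> = - (v \<circ>\<^sub>L y)"
    have \<beta>: "\<beta> > 0" "v \<circ>\<^sub>L y = - \<beta>" using hyp3_lform_lightlike[OF v(1) assms(2)] by (simp_all add: \<beta>_def)
    \<comment> \<open>Both \<open>x\<close> and \<open>(1 / \<beta>) y\<close> have product -1 with
      \<open>v\<close>, hence subtracting \<open>2 v\<close> leaves a vector orthogonal to
      \<open>v\<close>, with nonnegative square.\<close>
    let ?w = "x + (1 / \<beta>) *\<^sub>R y - 2 *\<^sub>R v"
    have "?w \<circ>\<^sub>L v = 0" using v \<beta> by (simp add: lform_simps lform_commute[of x v] lform_commute[of y v])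
    then have "?w \<circ>\<^sub>L ?w \<ge> 0" using v hyp3_timelike by (intro orthogonal_timelike_nonneg[of v])
    then have "2 * (x \<circ>\<^sub>L y) / \<beta> + 4 \<ge> 0"
      using v x \<beta> by (simp add: lform_simps lform_commute[of x v] lform_commute[of y v] lform_commute[of y x]
          add_divide_distrib)
    then have "?k / 2 \<le> \<beta>" using \<beta>(1) by (simp add: field_simps)
    then show ?thesis using assms(3) by (simp add: \<beta>_def)
  qed
  have im: "(\<lambda>v. sdist_point_horoball v y) ` horosphere x = (\<lambda>v. ln (- (v \<circ>\<^sub>L y))) ` horosphere x"
    using assms(2) by (intro image_cong refl sdist_point_horoball_eq) (auto simp: horosphere_def)
  show ?thesis unfolding sdist_horoballs_def im
  proof (rule cInf_eq_minimum)
    have "ln (?k / 2) = ln (- (p \<circ>\<^sub>L y))" unfolding p(3) by simp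
    then show "ln (?k / 2) \<in> (\<lambda>v. ln (- (v \<circ>\<^sub>L y))) ` horosphere x" using pP by (rule image_eqI)
  qed (use le in blast)
qed

text \<open>Unit normals of two planes at distance \<open>arcosh a\<close>. Negative product means
  that each normal points away from the other plane.\<close>

locale ultraparallel =
  fixes n m :: "real^4" and a :: real
  assumes nn: "n \<circ>\<^sub>L n = 1" and mm: "m \<circ>\<^sub>L m = 1" and nm: "n \<circ>\<^sub>L m = - a" and a: "a > 1"
begin

text \<open>The combination of \<open>n\<close> and \<open>m\<close> orthogonal to \<open>n\<close>,
  scaled to square -1: up to sign the point where the common perpendicular meets the plane of
  \<open>n\<close>. The other endpoint is the \<open>foot\<close> of the swapped locale.\<close>

definition "foot = (1 / sqrt (a\<^sup>2 - 1)) *\<^sub>R (a *\<^sub>R n + m)"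

lemma mn: "m \<circ>\<^sub>L n = - a" using nm by (simp add: lform_commute)

lemma swap: "ultraparallel m n a" by unfold_locales (use nn mm mn a in auto)

lemma r_pos: "sqrt (a\<^sup>2 - 1) > 0" "sqrt (a\<^sup>2 - 1) * sqrt (a\<^sup>2 - 1) = a * a - 1" "a * a > 1"
proof -
  show "a * a > 1" using a by (metis less_1_mult)
  then show "sqrt (a\<^sup>2 - 1) > 0" "sqrt (a\<^sup>2 - 1) * sqrt (a\<^sup>2 - 1) = a * a - 1"
    by (auto simp: power2_eq_square)
qed

text \<open>Writing one foot through the other and the normal \<open>m\<close> makes products with
  points of the plane of \<open>m\<close> immediate, since the last term vanishes there.\<close>

lemma foot_eq: "foot = a *\<^sub>R ultraparallel.foot m n a - sqrt (a\<^sup>2 - 1) *\<^sub>R m"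
proof -
  have "sqrt (a\<^sup>2 - 1) *\<^sub>R foot
    = sqrt (a\<^sup>2 - 1) *\<^sub>R (a *\<^sub>R ultraparallel.foot m n a - sqrt (a\<^sup>2 - 1) *\<^sub>R m)"
    using r_pos by (simp add: foot_def ultraparallel.foot_def[OF swap] algebra_simps)
  then show ?thesis using r_pos(1) by (simp only: scaleR_cancel_left) simp
qed

lemma foot_lform: "n \<circ>\<^sub>L foot = 0" "foot \<circ>\<^sub>L n = 0" "foot \<circ>\<^sub>L foot = -1"
  "m \<circ>\<^sub>L foot = - sqrt (a\<^sup>2 - 1)" "foot \<circ>\<^sub>L m = - sqrt (a\<^sup>2 - 1)"
  "foot \<circ>\<^sub>L ultraparallel.foot m n a = - a"
proof -
  define r where "r = sqrt (a\<^sup>2 - 1)"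
  have r: "r > 0" "a * a - 1 = r * r" using r_pos by (simp_all add: r_def)
  have f: "foot = (1 / r) *\<^sub>R (a *\<^sub>R n + m)" "ultraparallel.foot m n a = (1 / r) *\<^sub>R (a *\<^sub>R m + n)"
    by (simp_all only: foot_def ultraparallel.foot_def[OF swap] r_def)
  show "n \<circ>\<^sub>L foot = 0" "foot \<circ>\<^sub>L n = 0" by (simp_all add: f lform_simps nn nm mn)
  have "(a *\<^sub>R n + m) \<circ>\<^sub>L (a *\<^sub>R n + m) = - (a * a - 1)"
    by (simp add: lform_simps nn mm nm mn algebra_simps)
  then show "foot \<circ>\<^sub>L foot = -1"
    unfolding f lform_scale_left lform_scale_right using r by simp
  have "m \<circ>\<^sub>L (a *\<^sub>R n + m) = - (a * a - 1)"
    by (simp add: lform_simps nn mm nm mn algebra_simps)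
  then show 1: "m \<circ>\<^sub>L foot = - sqrt (a\<^sup>2 - 1)"
    unfolding f lform_scale_left lform_scale_right r_def[symmetric] using r by simp
  then show "foot \<circ>\<^sub>L m = - sqrt (a\<^sup>2 - 1)" by (simp add: lform_commute)
  have "(a *\<^sub>R n + m) \<circ>\<^sub>L (a *\<^sub>R m + n) = - a * (a * a - 1)"
    by (simp add: lform_simps nn mm nm mn algebra_simps)
  then show "foot \<circ>\<^sub>L ultraparallel.foot m n a = - a"
    unfolding f lform_scale_left lform_scale_right using r by simp
qed

lemma foot_hyp3I: assumes "v \<circ>\<^sub>L v \<le> 0" "v $ 1 > 0" "n \<circ>\<^sub>L v < 0" "m \<circ>\<^sub>L v \<le> 0" shows "foot \<in> hyp3"
proof -
  have "a * (n \<circ>\<^sub>L v) < 0" using a assms by (simp add: mult_pos_neg)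
  then have "foot \<circ>\<^sub>L v < 0"
    using r_pos(1) assms by (simp add: foot_def lform_simps divide_neg_pos)
  then show ?thesis using assms(1,2) by (intro hyp3_futureI[of foot v] foot_lform)
qed

text \<open>With \<open>C\<close> and \<open>D\<close> the hyperbolic cosines of the distances of
  \<open>p\<close> and \<open>q\<close> to the two feet, the product is at most
  \<open>- a - (a - 1) * (C * D - 1)\<close>. Equality with \<open>- a\<close> therefore forces
  \<open>C = D = 1\<close>, so the closest pair is unique.\<close>

lemma lform_plane_points:
  assumes p: "p \<in> hyp3" "n \<circ>\<^sub>L p = 0" and q: "q \<in> hyp3" "m \<circ>\<^sub>L q = 0"
    and foot: "foot \<in> hyp3" "ultraparallel.foot m n a \<in> hyp3"
  shows "p \<circ>\<^sub>L q \<le> - a" "p \<circ>\<^sub>L q = - a \<Longrightarrow> p = foot \<and> q = ultraparallel.foot m n a"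
proof -
  let ?p = foot and ?q = "ultraparallel.foot m n a"
  note L = foot_lform ultraparallel.foot_lform[OF swap]
  define C D where "C = - (p \<circ>\<^sub>L ?p)" and "D = - (q \<circ>\<^sub>L ?q)"
  have C: "C \<ge> 1" "D \<ge> 1" "p \<circ>\<^sub>L ?p = - C" "q \<circ>\<^sub>L ?q = - D" "?p \<circ>\<^sub>L p = - C" "?q \<circ>\<^sub>L q = - D"
    using hyp3_lform_le[OF p(1) foot(1)] hyp3_lform_le[OF q(1) foot(2)]
    by (simp_all add: C_def D_def lform_commute)
  have e: "p \<circ>\<^sub>L ?q = - a * C" "q \<circ>\<^sub>L ?p = - a * D" "?q \<circ>\<^sub>L p = - a * C" "?p \<circ>\<^sub>L q = - a * D"
  proof -
    have eq: "?q = a *\<^sub>R ?p - sqrt (a\<^sup>2 - 1) *\<^sub>R n" by (rule ultraparallel.foot_eq[OF swap])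
    show 1: "p \<circ>\<^sub>L ?q = - a * C" by (subst eq) (use p C in \<open>simp add: lform_simps lform_commute[of p n]\<close>)
    show 2: "q \<circ>\<^sub>L ?p = - a * D" by (subst foot_eq) (use q C in \<open>simp add: lform_simps lform_commute[of q m]\<close>)
    show "?q \<circ>\<^sub>L p = - a * C" "?p \<circ>\<^sub>L q = - a * D" using 1 2 by (simp_all add: lform_commute)
  qed
  \<comment> \<open>Both vectors are orthogonal to the same point \<open>foot\<close>, as
    Cauchy-Schwarz requires. For \<open>?w\<close>, taken along the other foot, this uses that
    \<open>q\<close> and \<open>?q\<close> have products \<open>- a * D\<close> and
    \<open>- a\<close> with \<open>foot\<close>.\<close>
  let ?u = "p - C *\<^sub>R ?p" and ?w = "q - D *\<^sub>R ?q"
  have uw: "?u \<circ>\<^sub>L ?p = 0" "?w \<circ>\<^sub>L ?p = 0" "?u \<circ>\<^sub>L ?u = C\<^sup>2 - 1" "?w \<circ>\<^sub>L ?w = D\<^sup>2 - 1"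
    "?u \<circ>\<^sub>L ?w = p \<circ>\<^sub>L q + a * (C * D)"
    using C e p q by (simp_all add: lform_simps L hyp3_self power2_eq_square algebra_simps)
  have "(?u \<circ>\<^sub>L ?w)\<^sup>2 \<le> (C\<^sup>2 - 1) * (D\<^sup>2 - 1)"
    using lform_Cauchy_Schwarz[OF hyp3_timelike[OF foot(1)] uw(1,2)] uw by simp
  also have "\<dots> = (C * D - 1)\<^sup>2 - (C - D)\<^sup>2" by (simp add: power2_eq_square algebra_simps)
  also have "\<dots> \<le> (C * D - 1)\<^sup>2" by simp
  finally have "?u \<circ>\<^sub>L ?w \<le> C * D - 1"
    by (rule power2_le_imp_le) (use C mult_mono[of 1 C 1 D] in simp)
  then have main: "p \<circ>\<^sub>L q + (a - 1) * (C * D - 1) \<le> - a" using uw by (simp add: algebra_simps)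
  have CD: "C * D \<ge> 1" using C mult_mono[of 1 C 1 D] by simp
  then have "(a - 1) * (C * D - 1) \<ge> 0" using a by simp
  then show "p \<circ>\<^sub>L q \<le> - a" using main by linarith
  assume "p \<circ>\<^sub>L q = - a"
  then have "(a - 1) * (C * D - 1) \<le> 0" using main by linarith
  then have "C * D \<le> 1" using a by (simp add: mult_le_0_iff)
  moreover have "C \<le> C * D" "D \<le> C * D" using C by (simp_all add: mult_le_cancel_left1 mult_le_cancel_right1)
  ultimately have "C = 1" "D = 1" using C by linarith+
  then show "p = ?p \<and> q = ?q" using hyp3_eqI p q foot C by auto
qed

end

section \<open>The frame of a tetrahedron\<close>

text \<open>A plane has two unit normals and \<open>half_of\<close> allows two sides; the sign of
  the normal is chosen so that \<open>H\<close> is its non-positive side.\<close>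

lemma outward_normal:
  assumes "is_plane P" "half_of hyp3 P H"
  shows "\<exists>n. n \<circ>\<^sub>L n = 1 \<and> P = hplane n \<and> span P = orth n
    \<and> H = {v \<in> hyp3. n \<circ>\<^sub>L v \<le> 0}
    \<and> half_ideal_boundary hyp3 P H = {x. pos_lightlike x \<and> n \<circ>\<^sub>L x \<le> 0} \<and> P \<noteq> {}"
proof -
  obtain n where n: "n \<circ>\<^sub>L n = 1" "P = hplane n" "span P = orth n"
    using plane_normal[OF assms(1)] .
  obtain V v where "subspace V" "v \<in> V" "timelike v" "P = V \<inter> hyp3"
    using assms(1) by (auto simp: is_plane_def)
  then obtain p where p: "p \<in> P" using timelike_exists_hyp3 by blast
  interpret cut UNIV n
    using n p by unfold_locales auto
  have Q: "Q = hyp3" and F: "F = P" and K: "K = hhalf n"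
    by (simp_all add: F_def Q_def K_def n(2))
  have "H = hhalf n \<or> H = {v \<in> hyp3. n \<circ>\<^sub>L v \<le> 0}"
    using assms(2) half_of_iff[of H] unfolding Q F K by simp
  then show ?thesis
  proof
    assume H: "H = {v \<in> hyp3. n \<circ>\<^sub>L v \<le> 0}"
    have "half_ideal_boundary hyp3 P H = {x. pos_lightlike x \<and> n \<circ>\<^sub>L x \<le> 0}"
      using half_ideal_boundary_minus unfolding Q F H by simp
    then show ?thesis using n H p by (intro exI[of _ n]) auto
  next
    assume H: "H = hhalf n"
    have "half_ideal_boundary hyp3 P H = {x. pos_lightlike x \<and> n \<circ>\<^sub>L x \<ge> 0}"
      using half_ideal_boundary_K unfolding Q F K H by simp
    then show ?thesis using n H p by (intro exI[of _ "- n"]) (auto simp: lform_simps)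
  qed
qed

lemma lightlike_nth_nonzero:
  assumes "w \<circ>\<^sub>L w = 0" "w \<noteq> 0" shows "w $ 1 \<noteq> 0"
proof
  assume "w $ 1 = 0"
  then have "(w$2)\<^sup>2 + (w$3)\<^sup>2 + (w$4)\<^sup>2 = 0"
    using assms(1) by (simp add: lform_def power2_eq_square)
  then show False using assms(2) \<open>w $ 1 = 0\<close> by (simp add: add_nonneg_eq_0_iff vec_eq_iff forall_4)
qed

text \<open>The product \<open>k\<close> of the normals decides the position:
  \<open>\<bar>k\<bar> < 1\<close> means intersecting planes, \<open>\<bar>k\<bar> = 1\<close> equal
  planes or a common ideal point, and \<open>k > 1\<close> normals pointing the same way, against
  the assumption on the sides.\<close>

lemma disjoint_planes_normals:
  assumes n: "n \<circ>\<^sub>L n = 1" "m \<circ>\<^sub>L m = 1"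
    and P: "P = hplane n" "P' = hplane m"
    and sp: "span P = orth n" "span P' = orth m"
    and ne: "P \<noteq> {}" "P' \<noteq> {}" and disj: "P \<inter> P' = {}" and np: "\<not> parallel_planes P P'"
    and side: "\<And>v. v \<in> P \<Longrightarrow> m \<circ>\<^sub>L v \<le> 0" "\<And>v. v \<in> P' \<Longrightarrow> n \<circ>\<^sub>L v \<le> 0"
  shows "n \<circ>\<^sub>L m < -1"
proof (rule ccontr)
  assume not: "\<not> n \<circ>\<^sub>L m < -1"
  define k where "k = n \<circ>\<^sub>L m"
  have k: "n \<circ>\<^sub>L m = k" "m \<circ>\<^sub>L n = k" "k \<ge> -1" using not by (auto simp: k_def lform_commute)
  obtain p where p: "p \<in> hyp3" "n \<circ>\<^sub>L p = 0" "p \<circ>\<^sub>L n = 0" "p \<circ>\<^sub>L p = -1"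
    using ne P by (auto simp: hyp3_self lform_commute)
  consider "\<bar>k\<bar> < 1" | "\<bar>k\<bar> = 1" | "k > 1" using k(3) by linarith
  then show False
  proof cases
    case 1
    \<comment> \<open>Up to the factor \<open>D\<close>, the projection of \<open>p\<close> to the
      common orthogonal complement of \<open>n\<close> and \<open>m\<close>; it is time-like and
      yields a common point.\<close>
    define D c v where "D = 1 - k * k" and "c = m \<circ>\<^sub>L p" and "v = D *\<^sub>R p + (k * c) *\<^sub>R n - c *\<^sub>R m"
    have D: "D > 0" using 1 abs_square_less_1[of k] by (simp add: D_def power2_eq_square)
    have c: "m \<circ>\<^sub>L p = c" "p \<circ>\<^sub>L m = c" by (simp_all add: c_def lform_commute)
    have nv: "n \<circ>\<^sub>L v = 0" "m \<circ>\<^sub>L v = 0" "p \<circ>\<^sub>L v = - D - c * c"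
      using n k p c by (simp_all add: v_def lform_simps D_def algebra_simps)
    have "v \<circ>\<^sub>L v = D * (p \<circ>\<^sub>L v) + (k * c) * (n \<circ>\<^sub>L v) - c * (m \<circ>\<^sub>L v)"
      by (subst v_def) (simp add: lform_simps)
    also have "\<dots> = - (D * (D + c * c))" unfolding nv by (simp add: algebra_simps)
    finally have "timelike v" using D by (simp add: timelike_def add_pos_nonneg)
    moreover have "subspace {v. n \<circ>\<^sub>L v = 0 \<and> m \<circ>\<^sub>L v = 0}" by (auto simp: subspace_def lform_simps)
    ultimately obtain q where "q \<in> {v. n \<circ>\<^sub>L v = 0 \<and> m \<circ>\<^sub>L v = 0} \<inter> hyp3"
      using timelike_exists_hyp3[of "{v. n \<circ>\<^sub>L v = 0 \<and> m \<circ>\<^sub>L v = 0}" v] nv by auto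
    then show False using disj P by auto
  next
    case 2
    then have kk: "k * k = 1" by (auto simp: abs_if split: if_splits)
    define w where "w = n - k *\<^sub>R m"
    have w: "n \<circ>\<^sub>L w = 0" "m \<circ>\<^sub>L w = 0" "w \<circ>\<^sub>L w = 0"
      using n k kk by (simp_all add: w_def lform_simps algebra_simps)
    have "w \<noteq> 0"
    proof
      assume "w = 0"
      then have "n = k *\<^sub>R m" by (simp add: w_def)
      then have "m \<circ>\<^sub>L p = 0" using p(2) 2 by (auto simp: lform_simps)
      then show False using disj P p by auto
    qed
    then have "w $ 1 \<noteq> 0" using w by (intro lightlike_nth_nonzero)
    then consider "w $ 1 > 0" | "(- w) $ 1 > 0" by (auto simp: neq_iff)
    then have "\<exists>w'. pos_lightlike w' \<and> n \<circ>\<^sub>L w' = 0 \<and> m \<circ>\<^sub>L w' = 0"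
    proof cases
      case 1 then show ?thesis using w \<open>w \<noteq> 0\<close> by (intro exI[of _ w]) (simp add: pos_lightlike_def)
    next
      case 2 then show ?thesis using w \<open>w \<noteq> 0\<close>
        by (intro exI[of _ "- w"]) (simp add: pos_lightlike_def lform_simps)
    qed
    then show False using np disj sp by (auto simp: parallel_planes_def ideal_boundary_def)
  next
    case 3
    then have kk: "k * k > 1" by (metis less_1_mult)
    obtain q where q: "q \<in> hyp3" "m \<circ>\<^sub>L q = 0" "q \<circ>\<^sub>L q = -1"
      using ne P by (auto simp: hyp3_self)
    have "m \<circ>\<^sub>L p \<noteq> 0" "n \<circ>\<^sub>L q \<noteq> 0" using disj P p(1,2) q(1,2) by auto
    then have less: "m \<circ>\<^sub>L p < 0" "n \<circ>\<^sub>L q < 0" using side P p(1,2) q(1,2) by (simp_all add: less_le)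
    \<comment> \<open>Multiples of the feet of the common perpendicular. The assumption on the sides
      puts both in the future cone, so their product should be negative, whereas it is
      \<open>k * (k * k - 1)\<close>.\<close>
    have s: "(m - k *\<^sub>R n) \<circ>\<^sub>L (m - k *\<^sub>R n) = 1 - k * k" "(n - k *\<^sub>R m) \<circ>\<^sub>L (n - k *\<^sub>R m) = 1 - k * k"
      "(m - k *\<^sub>R n) \<circ>\<^sub>L (n - k *\<^sub>R m) = k * (k * k - 1)"
      using n k by (simp_all add: lform_simps algebra_simps)
    have t: "timelike (m - k *\<^sub>R n)" "timelike (n - k *\<^sub>R m)" unfolding timelike_def s using kk by simp_all
    have "(m - k *\<^sub>R n) $ 1 > 0" "(n - k *\<^sub>R m) $ 1 > 0"
      using timelike_future[OF t(1), of p] timelike_future[OF t(2), of q] p q less hyp3_pos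
      by (simp_all add: lform_simps)
    then have "(m - k *\<^sub>R n) \<circ>\<^sub>L (n - k *\<^sub>R m) < 0"
      using t by (intro causal_lform_neg) (simp_all add: timelike_def)
    then show False using 3 kk unfolding s(3) by (simp add: mult_less_0_iff)
  qed
qed

text \<open>The four objects of a partially truncated tetrahedron are encoded by vectors \<open>e i\<close> with pairwise
  negative products: the outward unit normals of the two planes and the two light-like vectors. Every
  object then lies on the non-negative side of a cut exactly if its vector does.\<close>

locale tet_frame =
  fixes P H :: "nat \<Rightarrow> (real^4) set" and x e :: "nat \<Rightarrow> real^4"
  assumes lightlike: "pos_lightlike (e 3)" "pos_lightlike (e 4)" and ideal: "x 3 = e 3" "x 4 = e 4"
    and unit: "e 1 \<circ>\<^sub>L e 1 = 1" "e 2 \<circ>\<^sub>L e 2 = 1"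
    and planes: "P 1 = hplane (e 1)" "P 2 = hplane (e 2)"
    and halves: "H 1 = {v \<in> hyp3. e 1 \<circ>\<^sub>L v \<le> 0}" "H 2 = {v \<in> hyp3. e 2 \<circ>\<^sub>L v \<le> 0}"
    and neg: "\<And>i j. i \<in> {1..4} \<Longrightarrow> j \<in> {1..4} \<Longrightarrow> i \<noteq> j \<Longrightarrow> e i \<circ>\<^sub>L e j < 0"
    and ultra: "e 1 \<circ>\<^sub>L e 2 < -1"

text \<open>The half-spaces give non-strict signs for the products of normals and light-like
  vectors; strictness holds because no \<open>x j\<close> is in the ideal boundary of a
  plane.\<close>

lemma tet_data_frame:
  assumes "tet_data P H x" shows "\<exists>e. tet_frame P H x e"
proof -
  note t = assms[unfolded tet_data_def]
  have d: "is_plane (P 1)" "is_plane (P 2)" "half_of hyp3 (P 1) (H 1)" "half_of hyp3 (P 2) (H 2)"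
    using t by auto
  obtain n where n: "n \<circ>\<^sub>L n = 1" "P 1 = hplane n" "span (P 1) = orth n"
    "H 1 = {v \<in> hyp3. n \<circ>\<^sub>L v \<le> 0}"
    "half_ideal_boundary hyp3 (P 1) (H 1) = {x. pos_lightlike x \<and> n \<circ>\<^sub>L x \<le> 0}" "P 1 \<noteq> {}"
    using outward_normal[OF d(1,3)] by (elim exE conjE) (rule that)
  obtain m where m: "m \<circ>\<^sub>L m = 1" "P 2 = hplane m" "span (P 2) = orth m"
    "H 2 = {v \<in> hyp3. m \<circ>\<^sub>L v \<le> 0}"
    "half_ideal_boundary hyp3 (P 2) (H 2) = {x. pos_lightlike x \<and> m \<circ>\<^sub>L x \<le> 0}" "P 2 \<noteq> {}"
    using outward_normal[OF d(2,4)] by (elim exE conjE) (rule that)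
  have ll: "pos_lightlike (x 3)" "pos_lightlike (x 4)" using t by auto
  have "x j \<in> {x. pos_lightlike x \<and> n \<circ>\<^sub>L x \<le> 0}" "x j \<in> {x. pos_lightlike x \<and> m \<circ>\<^sub>L x \<le> 0}"
    "n \<circ>\<^sub>L x j \<noteq> 0" "m \<circ>\<^sub>L x j \<noteq> 0" if "j = 3 \<or> j = 4" for j
  proof -
    have "x j \<in> half_ideal_boundary hyp3 (P 1) (H 1)" "x j \<in> half_ideal_boundary hyp3 (P 2) (H 2)"
      "x j \<notin> ideal_boundary (P 1)" "x j \<notin> ideal_boundary (P 2)" using t that by auto
    then show "x j \<in> {x. pos_lightlike x \<and> n \<circ>\<^sub>L x \<le> 0}" "x j \<in> {x. pos_lightlike x \<and> m \<circ>\<^sub>L x \<le> 0}"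
      "n \<circ>\<^sub>L x j \<noteq> 0" "m \<circ>\<^sub>L x j \<noteq> 0"
      using n m by (auto simp: ideal_boundary_def)
  qed
  then have nx: "n \<circ>\<^sub>L x j < 0" "m \<circ>\<^sub>L x j < 0" if "j = 3 \<or> j = 4" for j
    using that by (force simp: less_le)+
  have "P 1 \<subseteq> H 2" "P 2 \<subseteq> H 1" using t by (auto simp: numeral_eq_Suc)
  then have nm: "n \<circ>\<^sub>L m < -1"
    using t n m by (intro disjoint_planes_normals[of n m "P 1" "P 2"]) auto
  have xx: "x 3 \<circ>\<^sub>L x 4 < 0" using t lightlike_lform_neg by blast
  define e where "e = (\<lambda>i::nat. if i = 1 then n else if i = 2 then m else x i)"
  have e: "e 1 = n" "e 2 = m" "e 3 = x 3" "e 4 = x 4" by (simp_all add: e_def)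
  have set: "{1..4} = {1, 2, 3, 4::nat}" by auto
  have "e i \<circ>\<^sub>L e j < 0" if "i \<in> {1..4}" "j \<in> {1..4}" "i \<noteq> j" for i j :: nat
  proof -
    have "e i \<circ>\<^sub>L e j < 0" if "i < j" "i \<in> {1,2,3,4}" "j \<in> {1,2,3,4}" for i j :: nat
      using that nx nm xx e(1) by (auto simp: e)
    then show ?thesis using that unfolding set by (metis lform_commute linorder_neqE_nat)
  qed
  then have "tet_frame P H x e" using n m nm ll by unfold_locales (simp_all only: e)
  then show ?thesis by blast
qed

section \<open>Perpendiculars to planes\<close>

lemma hsegment_left: "p \<in> hyp3 \<Longrightarrow> p \<in> hsegment p q"
proof -
  assume "p \<in> hyp3"
  moreover have "\<exists>a b. p = a *\<^sub>R p + b *\<^sub>R q \<and> a \<ge> 0 \<and> b \<ge> 0"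
    by (rule exI[of _ 1], rule exI[of _ 0]) simp
  ultimately show ?thesis by (simp add: hsegment_def)
qed

lemma ideal_geodesic_eq:
  assumes "pos_lightlike y" "pos_lightlike z" "y \<circ>\<^sub>L z < 0"
  shows "ideal_geodesic y z = span {y, z} \<inter> hyp3"
proof -
  have y: "y \<circ>\<^sub>L y = 0" "z \<circ>\<^sub>L z = 0" "y \<noteq> 0" using assms by (auto simp: pos_lightlike_def)
  have ne: "z \<noteq> k *\<^sub>R y" for k
    using assms(3) y by (auto simp: lform_simps)
  have mem: "y \<in> span {y, z}" "z \<in> span {y, z}" by (simp_all add: span_base)
  have "(y + z) \<circ>\<^sub>L (y + z) < 0" using assms(3) y by (simp add: lform_simps lform_commute[of z y])
  then have "timelike (y + z)" by (simp add: timelike_def)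
  moreover have "y + z \<in> span {y, z}" using mem by (rule span_add)
  ultimately have geo: "is_geodesic (span {y, z} \<inter> hyp3)" "span (span {y, z} \<inter> hyp3) = span {y, z}"
    using is_geodesicI[OF y(3) ne] by auto
  show ?thesis unfolding ideal_geodesic_def
  proof (rule the_equality)
    show "is_geodesic (span {y, z} \<inter> hyp3) \<and> y \<in> ideal_boundary (span {y, z} \<inter> hyp3)
        \<and> z \<in> ideal_boundary (span {y, z} \<inter> hyp3)"
      using geo mem assms by (simp add: ideal_boundary_def)
    fix L assume L: "is_geodesic L \<and> y \<in> ideal_boundary L \<and> z \<in> ideal_boundary L"
    then show "L = span {y, z} \<inter> hyp3"
      using y(3) ne by (intro geodesic_eq_span(2)) (auto simp: ideal_boundary_def)
  qed
qed

text \<open>With \<open>W = UNIV\<close> the set \<open>F\<close> is a plane; with \<open>W\<close>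
  the span of the degenerate plane it is a geodesic in that plane. Both kinds of perpendicular occur
  in the definition of the tetrahedron.\<close>

locale plane_ideal =
  fixes W F :: "(real^4) set" and n y :: "real^4"
  assumes W: "subspace W" "n \<in> W" "y \<in> W" and n: "n \<circ>\<^sub>L n = 1" and y: "pos_lightlike y"
    and ny: "n \<circ>\<^sub>L y < 0" and F: "F = {v \<in> W \<inter> hyp3. n \<circ>\<^sub>L v = 0}"
begin

text \<open>The normalized component of \<open>y\<close> orthogonal to \<open>n\<close>, that is,
  the foot on \<open>F\<close> of the perpendicular with ideal endpoint \<open>y\<close>.\<close>

definition "pfoot = (1 / - (n \<circ>\<^sub>L y)) *\<^sub>R y + n"

lemma y_facts: "y \<circ>\<^sub>L y = 0" "y \<noteq> 0" "y $ 1 > 0" "y \<circ>\<^sub>L n = n \<circ>\<^sub>L y"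
  using y by (auto simp: pos_lightlike_def lform_commute)

lemma n_nonzero: "n \<noteq> 0" using n by (auto simp: lform_simps)

lemma y_not_multiple: "y \<noteq> k *\<^sub>R n" using y_facts n by (auto simp: lform_simps)

lemma pfoot_lform: "pfoot \<circ>\<^sub>L pfoot = -1" "n \<circ>\<^sub>L pfoot = 0" "pfoot \<circ>\<^sub>L n = 0" "pfoot \<circ>\<^sub>L y = n \<circ>\<^sub>L y"
  using ny by (simp_all add: pfoot_def lform_simps y_facts n)

lemma pfoot_mem: "pfoot \<in> hyp3" "pfoot \<in> W" "pfoot \<in> F" "pfoot \<in> span {n, y}"
proof -
  show "pfoot \<in> hyp3" by (rule hyp3_futureI[of pfoot y]) (use pfoot_lform y_facts ny in simp_all)
  moreover show "pfoot \<in> W" unfolding pfoot_def by (intro subspace_add subspace_scale W)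
  ultimately show "pfoot \<in> F" using pfoot_lform by (simp add: F)
  show "pfoot \<in> span {n, y}" unfolding pfoot_def by (intro span_add span_scale span_base) auto
qed

lemma span_F: "span F = {v \<in> W. n \<circ>\<^sub>L v = 0}"
  unfolding F by (rule span_hyperplane_section[OF W(1) _ pfoot_lform(2)]) (simp add: pfoot_mem)

lemma geodesic: "is_geodesic (span {n, y} \<inter> hyp3)" "span (span {n, y} \<inter> hyp3) = span {n, y}"
  using is_geodesicI[OF n_nonzero y_not_multiple pfoot_mem(4) hyp3_timelike[OF pfoot_mem(1)]] by auto

lemma perp_geodesic_eq: "perp_geodesic F y = span {n, y} \<inter> hyp3"
  unfolding perp_geodesic_def
proof (rule the_equality)
  have "u \<circ>\<^sub>L w = 0" if u: "u \<in> span {n, y}" "u \<circ>\<^sub>L pfoot = 0" and w: "w \<in> span F" for u w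
  proof -
    obtain \<alpha> \<beta> where ab: "u = \<alpha> *\<^sub>R n + \<beta> *\<^sub>R y" using u(1) by (auto simp: span_pair)
    have "u \<circ>\<^sub>L pfoot = \<beta> * (n \<circ>\<^sub>L y)"
      using pfoot_lform by (simp add: ab lform_simps lform_commute[of y pfoot])
    then have "\<beta> = 0" using u(2) ny by simp
    then show ?thesis using w by (simp add: ab lform_simps span_F)
  qed
  then have "geodesic_perp (span {n, y} \<inter> hyp3) F"
    unfolding geodesic_perp_def geodesic(2) using pfoot_mem by blast
  then show "is_geodesic (span {n, y} \<inter> hyp3) \<and> geodesic_perp (span {n, y} \<inter> hyp3) F
      \<and> y \<in> ideal_boundary (span {n, y} \<inter> hyp3)"
    using geodesic y by (simp add: ideal_boundary_def span_base)
next
  fix L assume L: "is_geodesic L \<and> geodesic_perp L F \<and> y \<in> ideal_boundary L"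
  then obtain p where p: "p \<in> L" "p \<in> F"
    and perp: "\<And>u w. u \<in> span L \<Longrightarrow> w \<in> span F \<Longrightarrow> u \<circ>\<^sub>L p = 0 \<Longrightarrow> w \<circ>\<^sub>L p = 0 \<Longrightarrow> u \<circ>\<^sub>L w = 0"
    unfolding geodesic_perp_def by blast
  have yL: "y \<in> span L" using L by (simp add: ideal_boundary_def)
  have pp: "p \<in> hyp3" "p \<circ>\<^sub>L p = -1" "n \<circ>\<^sub>L p = 0" using p by (auto simp: F hyp3_self)
  \<comment> \<open>The component of \<open>pfoot\<close> orthogonal to \<open>p\<close>, a tangent
    vector of \<open>F\<close>. Its orthogonality to the tangent vector of \<open>L\<close> towards
    \<open>y\<close> will force \<open>p = pfoot\<close>.\<close>
  let ?w = "pfoot + (pfoot \<circ>\<^sub>L p) *\<^sub>R p"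
  have "(y + (y \<circ>\<^sub>L p) *\<^sub>R p) \<circ>\<^sub>L ?w = 0"
  proof (rule perp)
    show "y + (y \<circ>\<^sub>L p) *\<^sub>R p \<in> span L" using p yL by (intro span_add span_scale) (auto simp: span_base)
    show "?w \<in> span F" using p pfoot_mem by (intro span_add span_scale) (auto simp: span_base)
  qed (simp_all add: lform_simps pp)
  \<comment> \<open>Here \<open>y\<close> equals \<open>pfoot - n\<close> up to a factor, and \<open>n\<close> is orthogonal to both points.\<close>
  moreover have "y \<circ>\<^sub>L v = - (n \<circ>\<^sub>L y) * (pfoot \<circ>\<^sub>L v)" if "n \<circ>\<^sub>L v = 0" for v
    using ny that by (simp add: pfoot_def lform_simps)
  ultimately have "(n \<circ>\<^sub>L y) * ((pfoot \<circ>\<^sub>L p)\<^sup>2 - 1) = 0"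
    using pp pfoot_lform
    by (simp add: lform_simps lform_commute[of p pfoot] power2_eq_square algebra_simps)
  then have "(pfoot \<circ>\<^sub>L p)\<^sup>2 = 1" using ny by simp
  then have "pfoot = p" using hyp3_eqI pfoot_mem(1) pp(1) by blast
  then have "pfoot - (1 / - (n \<circ>\<^sub>L y)) *\<^sub>R y \<in> span L"
    using p yL by (intro span_diff span_scale) (auto simp: span_base)
  then have "n \<in> span L" by (simp add: pfoot_def)
  then show "L = span {n, y} \<inter> hyp3"
    using L yL n_nonzero y_not_multiple by (intro geodesic_eq_span(2)) auto
qed

lemma F_Int_span: assumes "p \<in> F" "p \<in> span {n, y}" shows "p = pfoot"
proof -
  obtain \<alpha> \<beta> where ab: "p = \<alpha> *\<^sub>R n + \<beta> *\<^sub>R y" using assms by (auto simp: span_pair)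
  have "n \<circ>\<^sub>L p = 0" "p \<in> hyp3" using assms(1) by (auto simp: F)
  then have al: "\<alpha> = - (n \<circ>\<^sub>L y) * \<beta>" using n by (simp add: ab lform_simps algebra_simps)
  then have "p = \<alpha> *\<^sub>R pfoot" using ny by (simp add: ab pfoot_def algebra_simps)
  then have "p \<circ>\<^sub>L p = - \<alpha>\<^sup>2" "pfoot \<circ>\<^sub>L p = - \<alpha>" using pfoot_lform by (simp_all add: lform_simps power2_eq_square)
  then have "(pfoot \<circ>\<^sub>L p)\<^sup>2 = 1" using \<open>p \<in> hyp3\<close> by (simp add: hyp3_self)
  then show ?thesis using hyp3_eqI[OF pfoot_mem(1) \<open>p \<in> hyp3\<close>] by simp
qed

lemma perp_ray_eq: "perp_ray F y = hsegment pfoot y"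
  unfolding perp_ray_def
proof (rule the_equality)
  have "hsegment pfoot y \<subseteq> span {n, y} \<inter> hyp3"
    using pfoot_mem by (auto simp: hsegment_def intro!: span_add span_scale intro: span_base)
  then show "\<exists>p\<in>F. hsegment pfoot y = hsegment p y \<and> hsegment pfoot y \<subseteq> perp_geodesic F y"
    using pfoot_mem by (auto simp: perp_geodesic_eq)
  fix R assume "\<exists>p\<in>F. R = hsegment p y \<and> R \<subseteq> perp_geodesic F y"
  then obtain p where p: "p \<in> F" "R = hsegment p y" "R \<subseteq> span {n, y} \<inter> hyp3"
    by (auto simp: perp_geodesic_eq)
  then have "p \<in> hyp3" by (simp add: F)
  then have "p \<in> span {n, y}" using p hsegment_left by blast
  then show "R = hsegment pfoot y" using p F_Int_span by simp
qed

end

text \<open>The role of \<open>W\<close> is as in \<open>plane_ideal\<close>. The products determine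
  the feet only up to the sheet of the hyperboloid, so membership in \<open>hyp3\<close> is assumed
  here and proved later from a light-like vector on the inner side of both planes.\<close>

locale plane_pair = ultraparallel n m a for n m a +
  fixes W F G :: "(real^4) set"
  assumes W: "subspace W" "n \<in> W" "m \<in> W"
    and F: "F = {v \<in> W \<inter> hyp3. n \<circ>\<^sub>L v = 0}" and G: "G = {v \<in> W \<inter> hyp3. m \<circ>\<^sub>L v = 0}"
    and foot_hyp3: "foot \<in> hyp3" "ultraparallel.foot m n a \<in> hyp3"
begin

abbreviation "foot' \<equiv> ultraparallel.foot m n a"

lemmas foot'_eq = ultraparallel.foot_eq[OF swap]
lemmas foot'_lform = ultraparallel.foot_lform[OF swap]

lemma pair_swap: "plane_pair m n a W G F"
proof -
  interpret s: ultraparallel m n a by (rule swap)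
  show ?thesis using W F G foot_hyp3 by unfold_locales auto
qed

lemma foot_mem: "foot \<in> W" "foot' \<in> W" "foot \<in> F" "foot' \<in> G"
  "foot \<in> span {n, m}" "foot' \<in> span {n, m}"
proof -
  show "foot \<in> W" "foot' \<in> W"
    unfolding foot_def ultraparallel.foot_def[OF swap] using W by (simp_all add: subspace_add subspace_scale)
  then show "foot \<in> F" "foot' \<in> G" using foot_hyp3 foot_lform foot'_lform by (simp_all add: F G)
  show "foot \<in> span {n, m}" "foot' \<in> span {n, m}"
    unfolding foot_def ultraparallel.foot_def[OF swap]
    by (intro span_add span_scale; simp add: span_base)+
qed

lemma span_F: "span F = {v \<in> W. n \<circ>\<^sub>L v = 0}"
  unfolding F by (rule span_hyperplane_section[OF W(1) _ foot_lform(1)]) (simp add: foot_mem foot_hyp3)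

lemma n_nonzero: "n \<noteq> 0" using nn by (auto simp: lform_simps)

lemma m_not_multiple: "m \<noteq> k *\<^sub>R n"
proof
  assume m: "m = k *\<^sub>R n"
  then have "k = - a" using mn nn by (simp add: lform_simps)
  moreover have "k * k = 1" using mm nn m by (simp add: lform_simps)
  ultimately show False using r_pos by simp
qed

lemma geodesic: "is_geodesic (span {n, m} \<inter> hyp3)" "span (span {n, m} \<inter> hyp3) = span {n, m}"
  using is_geodesicI[OF n_nonzero m_not_multiple foot_mem(5) hyp3_timelike[OF foot_hyp3(1)]] by auto

lemma geodesic_perp_foot: "geodesic_perp (span {n, m} \<inter> hyp3) F"
proof -
  have "u \<circ>\<^sub>L w = 0" if u: "u \<in> span {n, m}" "u \<circ>\<^sub>L foot = 0" and w: "w \<in> span F" for u w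
  proof -
    obtain \<alpha> \<beta> where ab: "u = \<alpha> *\<^sub>R n + \<beta> *\<^sub>R m" using u(1) by (auto simp: span_pair)
    have "u \<circ>\<^sub>L foot = - \<beta> * sqrt (a\<^sup>2 - 1)" using foot_lform by (simp add: ab lform_simps)
    then have "\<beta> = 0" using u(2) r_pos(1) by simp
    then show ?thesis using w by (simp add: ab lform_simps span_F)
  qed
  then show ?thesis
    unfolding geodesic_perp_def geodesic(2) using foot_mem foot_hyp3 by blast
qed

text \<open>Testing perpendicularity at \<open>p\<close> against the tangent vector pointing to \<open>foot\<close>.\<close>

lemma geodesic_perp_lform:
  assumes "is_geodesic L" "p \<in> L" "p \<in> F" "q \<in> span L"
    and perp: "\<And>u w. u \<in> span L \<Longrightarrow> w \<in> span F \<Longrightarrow> u \<circ>\<^sub>L p = 0 \<Longrightarrow> w \<circ>\<^sub>L p = 0 \<Longrightarrow> u \<circ>\<^sub>L w = 0"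
  shows "q \<circ>\<^sub>L foot + (q \<circ>\<^sub>L p) * (p \<circ>\<^sub>L foot) = 0"
proof -
  have pp: "p \<circ>\<^sub>L p = -1" using assms(3) by (auto simp: F hyp3_self)
  have "(q + (q \<circ>\<^sub>L p) *\<^sub>R p) \<circ>\<^sub>L (foot + (foot \<circ>\<^sub>L p) *\<^sub>R p) = 0"
  proof (rule perp)
    show "q + (q \<circ>\<^sub>L p) *\<^sub>R p \<in> span L" using assms by (intro span_add span_scale) (auto simp: span_base)
    show "foot + (foot \<circ>\<^sub>L p) *\<^sub>R p \<in> span F"
      using assms foot_mem by (intro span_add span_scale) (auto simp: span_base)
  qed (simp_all add: lform_simps pp)
  then show ?thesis by (simp add: lform_simps pp)
qed

lemma common_perp_eq: "common_perp F G = span {n, m} \<inter> hyp3"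
  unfolding common_perp_def
proof (rule the_equality)
  have "span {m, n} = span {n, m}" by (simp add: insert_commute)
  then show "is_geodesic (span {n, m} \<inter> hyp3) \<and> geodesic_perp (span {n, m} \<inter> hyp3) F
      \<and> geodesic_perp (span {n, m} \<inter> hyp3) G"
    using geodesic geodesic_perp_foot plane_pair.geodesic_perp_foot[OF pair_swap] by simp
next
  fix L assume L: "is_geodesic L \<and> geodesic_perp L F \<and> geodesic_perp L G"
  then obtain p q where p: "p \<in> L" "p \<in> F" and q: "q \<in> L" "q \<in> G"
    and perp: "\<And>u w. u \<in> span L \<Longrightarrow> w \<in> span F \<Longrightarrow> u \<circ>\<^sub>L p = 0 \<Longrightarrow> w \<circ>\<^sub>L p = 0 \<Longrightarrow> u \<circ>\<^sub>L w = 0"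
      "\<And>u w. u \<in> span L \<Longrightarrow> w \<in> span G \<Longrightarrow> u \<circ>\<^sub>L q = 0 \<Longrightarrow> w \<circ>\<^sub>L q = 0 \<Longrightarrow> u \<circ>\<^sub>L w = 0"
    unfolding geodesic_perp_def by blast
  have pq: "p \<in> hyp3" "q \<in> hyp3" "n \<circ>\<^sub>L p = 0" "m \<circ>\<^sub>L q = 0" using p q by (auto simp: F G)
  define r where "r = sqrt (a\<^sup>2 - 1)"
  have r: "r > 0" using r_pos by (simp add: r_def)
  define A B k where "A = q \<circ>\<^sub>L foot'" and "B = p \<circ>\<^sub>L foot" and "k = p \<circ>\<^sub>L q"
  have AB: "A < 0" "B < 0" using pq foot_hyp3 hyp3_lform_neg by (auto simp: A_def B_def)
  have k: "k \<le> -1" "q \<circ>\<^sub>L p = k" using pq hyp3_lform_le by (auto simp: k_def lform_commute)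
  have qA: "q \<circ>\<^sub>L foot = a * A"
    using pq by (subst foot_eq) (simp add: lform_simps A_def lform_commute[of q m])
  have pB: "p \<circ>\<^sub>L foot' = a * B"
    using pq by (subst foot'_eq) (simp add: lform_simps B_def lform_commute[of p n])
  have sp: "p \<in> span L" "q \<in> span L" "is_geodesic L" using p q L by (auto simp: span_base)
  have "q \<circ>\<^sub>L foot + (q \<circ>\<^sub>L p) * (p \<circ>\<^sub>L foot) = 0"
    by (rule geodesic_perp_lform[OF sp(3) p sp(2) perp(1)])
  then have 1: "a * A + k * B = 0" unfolding qA k(2) B_def .
  have "p \<circ>\<^sub>L foot' + (p \<circ>\<^sub>L q) * (q \<circ>\<^sub>L foot') = 0"
    by (rule plane_pair.geodesic_perp_lform[OF pair_swap sp(3) q sp(1) perp(2)])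
  then have 2: "a * B + k * A = 0" unfolding pB A_def k_def .
  \<comment> \<open>Eliminating \<open>B\<close> from the two perpendicularity relations leaves
    \<open>a * a = k * k\<close>. As \<open>k\<close> is negative this is \<open>k = - a\<close>,
    the equality case of \<open>lform_plane_points\<close>.\<close>
  have "a * (a * A + k * B) - k * (a * B + k * A) = 0" unfolding 1 2 by simp
  then have "(a * a - k * k) * A = 0" by (simp add: algebra_simps)
  then have "a * a = k * k" using AB by simp
  then have "(a + k) * (a - k) = 0" by (simp add: algebra_simps)
  moreover have "a - k > 0" using a k by simp
  ultimately have "p \<circ>\<^sub>L q = - a" by (simp add: k_def)
  then have eq: "p = foot" "q = foot'" using lform_plane_points(2) pq foot_hyp3 by blast+
  have "foot \<in> span L" "foot' \<in> span L" using p q eq by (auto simp: span_base)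
  then have "(1 / r) *\<^sub>R (a *\<^sub>R foot - foot') \<in> span L" "(1 / r) *\<^sub>R (a *\<^sub>R foot' - foot) \<in> span L"
    by (auto intro!: span_scale span_diff)
  moreover have "(1 / r) *\<^sub>R (a *\<^sub>R foot - foot') = n" by (subst foot'_eq) (use r in \<open>simp add: r_def\<close>)
  moreover have "(1 / r) *\<^sub>R (a *\<^sub>R foot' - foot) = m" by (subst foot_eq) (use r in \<open>simp add: r_def\<close>)
  ultimately have "n \<in> span L" "m \<in> span L" by simp_all
  then show "L = span {n, m} \<inter> hyp3"
    using L n_nonzero m_not_multiple by (intro geodesic_eq_span(2)) auto
qed

lemma minimal_pair:
  assumes "p \<in> F" "q \<in> G"
  shows "hdist foot foot' \<le> hdist p q" "hdist p q \<le> hdist foot foot' \<Longrightarrow> p = foot \<and> q = foot'"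
proof -
  have pq: "p \<in> hyp3" "q \<in> hyp3" "n \<circ>\<^sub>L p = 0" "m \<circ>\<^sub>L q = 0" using assms by (auto simp: F G)
  have le: "p \<circ>\<^sub>L q \<le> - a" using lform_plane_points(1) pq foot_hyp3 by blast
  then show "hdist foot foot' \<le> hdist p q"
    using pq foot_hyp3 foot_lform by (simp add: hdist_le_iff)
  assume "hdist p q \<le> hdist foot foot'"
  then have "p \<circ>\<^sub>L q = - a" using le pq foot_hyp3 foot_lform by (simp add: hdist_le_iff)
  then show "p = foot \<and> q = foot'" using lform_plane_points(2) pq foot_hyp3 by blast
qed

lemma shortest_arc_eq: "shortest_arc F G = hsegment foot foot'"
  unfolding shortest_arc_def
proof (rule the_equality)
  show "\<exists>p\<in>F. \<exists>q\<in>G. hsegment foot foot' = hsegment p q \<and> (\<forall>p'\<in>F. \<forall>q'\<in>G. hdist p q \<le> hdist p' q')"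
    using foot_mem minimal_pair(1) by blast
  fix S assume "\<exists>p\<in>F. \<exists>q\<in>G. S = hsegment p q \<and> (\<forall>p'\<in>F. \<forall>q'\<in>G. hdist p q \<le> hdist p' q')"
  then obtain p q where pq: "p \<in> F" "q \<in> G" "S = hsegment p q" "hdist p q \<le> hdist foot foot'"
    using foot_mem by blast
  then show "S = hsegment foot foot'" using minimal_pair(2)[OF pq(1,2)] by simp
qed

lemma hset_dist_eq: "hset_dist F G = arcosh a"
proof -
  have "hdist foot foot' = arcosh a" using foot_lform by (simp add: hdist_def)
  then show ?thesis unfolding hset_dist_def using foot_mem minimal_pair(1)
    by (intro cInf_eq_minimum) force+
qed

end

section \<open>Independence of the frame vectors\<close>

lemma half_of_plane:
  assumes "g \<circ>\<^sub>L g > 0" "p \<in> hyp3" "g \<circ>\<^sub>L p = 0"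
  shows "half_of hyp3 (hplane g) K \<longleftrightarrow>
    K = hhalf g \<or> K = {v \<in> hyp3. g \<circ>\<^sub>L v \<le> 0}"
proof -
  interpret cut UNIV g using assms by unfold_locales auto
  show ?thesis using half_of_iff[of K] unfolding F_def Q_def K_def by simp
qed

lemma lform_nondegenerate: assumes "\<And>v. u \<circ>\<^sub>L v = 0" shows "u = 0"
proof (rule ccontr)
  assume "u \<noteq> 0"
  then obtain a where a: "\<forall>v. u \<circ>\<^sub>L v = a \<bullet> v" "a \<noteq> 0" using lform_eq_inner by blast
  then have "a \<bullet> a = 0" using assms by metis
  with a show False by simp
qed

text \<open>\<open>planes_perp\<close> quantifies over all normal vectors; these are multiples of
  one another because a plane spans the whole complement of its normal.\<close>

lemma normal_unique:
  assumes "n \<circ>\<^sub>L n > 0" "p \<in> hyp3" "n \<circ>\<^sub>L p = 0"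
    and orth: "\<And>v. v \<in> hyp3 \<Longrightarrow> n \<circ>\<^sub>L v = 0 \<Longrightarrow> m \<circ>\<^sub>L v = 0"
  shows "\<exists>c. m = c *\<^sub>R n"
proof -
  have sp: "span (hplane n) = orth n"
    using span_hyperplane_section[of UNIV p n] assms by simp
  have m: "m \<circ>\<^sub>L w = 0" if "n \<circ>\<^sub>L w = 0" for w
    by (rule lform_orthogonal_span[of "hplane n"]) (use orth that sp in auto)
  let ?u = "m - ((m \<circ>\<^sub>L n) / (n \<circ>\<^sub>L n)) *\<^sub>R n"
  have "?u \<circ>\<^sub>L v = 0" for v
  proof -
    have "m \<circ>\<^sub>L (v - ((n \<circ>\<^sub>L v) / (n \<circ>\<^sub>L n)) *\<^sub>R n) = 0"
      by (rule m) (use assms(1) in \<open>simp add: lform_simps\<close>)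
    then show ?thesis by (simp add: lform_simps mult.commute)
  qed
  then have "?u = 0" by (rule lform_nondegenerate)
  then show ?thesis by (intro exI[of _ "(m \<circ>\<^sub>L n) / (n \<circ>\<^sub>L n)"]) simp
qed

lemma planes_perp_iff:
  assumes "m \<circ>\<^sub>L m > 0" "n \<circ>\<^sub>L n > 0"
    and Q: "Q = hplane m" "R = hplane n"
  shows "planes_perp Q R \<longleftrightarrow> Q \<inter> R \<noteq> {} \<and> m \<circ>\<^sub>L n = 0"
proof
  assume "planes_perp Q R"
  then have "Q \<inter> R \<noteq> {}" and
    orth: "(\<forall>v\<in>Q. m \<circ>\<^sub>L v = 0) \<and> (\<forall>v\<in>R. n \<circ>\<^sub>L v = 0) \<longrightarrow> m \<circ>\<^sub>L n = 0"
    unfolding planes_perp_def by blast+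
  then show "Q \<inter> R \<noteq> {} \<and> m \<circ>\<^sub>L n = 0" using Q by simp
next
  assume r: "Q \<inter> R \<noteq> {} \<and> m \<circ>\<^sub>L n = 0"
  then obtain p where p: "p \<in> hyp3" "m \<circ>\<^sub>L p = 0" "n \<circ>\<^sub>L p = 0" using Q by auto
  have "m' \<circ>\<^sub>L n' = 0" if "\<forall>v\<in>Q. m' \<circ>\<^sub>L v = 0" "\<forall>v\<in>R. n' \<circ>\<^sub>L v = 0" for m' n'
  proof -
    have "\<exists>c. m' = c *\<^sub>R m" by (rule normal_unique[OF assms(1) p(1,2)]) (use that Q in simp)
    moreover have "\<exists>d. n' = d *\<^sub>R n" by (rule normal_unique[OF assms(2) p(1,3)]) (use that Q in simp)
    ultimately obtain c d where "m' = c *\<^sub>R m" "n' = d *\<^sub>R n" by blast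
    then show ?thesis using r by (simp add: lform_simps)
  qed
  then show "planes_perp Q R" using r by (simp add: planes_perp_def)
qed

lemma light_pair_point:
  assumes "u \<circ>\<^sub>L u \<ge> 0" "pos_lightlike y" "u \<circ>\<^sub>L y < 0"
  shows "\<exists>t>0. u + t *\<^sub>R y \<in> hyp3"
proof -
  let ?k = "- (u \<circ>\<^sub>L y)"
  \<comment> \<open>As \<open>y\<close> is light-like, the square of \<open>u + t y\<close> is
    affine in \<open>t\<close>; this value makes it -1.\<close>
  define t where "t = (u \<circ>\<^sub>L u + 1) / (2 * ?k)"
  have y: "y \<circ>\<^sub>L y = 0" "y $ 1 > 0" using assms by (auto simp: pos_lightlike_def)
  have "u \<circ>\<^sub>L u + 1 > 0" "2 * ?k > 0" using assms by simp_all
  then have t: "t > 0" "t * (2 * ?k) = u \<circ>\<^sub>L u + 1"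
    unfolding t_def by (rule divide_pos_pos) (use assms in simp)
  have "(u + t *\<^sub>R y) \<circ>\<^sub>L (u + t *\<^sub>R y) = u \<circ>\<^sub>L u - t * (2 * ?k)"
    by (simp add: lform_simps y lform_commute[of y u])
  then have w: "(u + t *\<^sub>R y) \<circ>\<^sub>L (u + t *\<^sub>R y) = -1" using t by simp
  have "(u + t *\<^sub>R y) \<circ>\<^sub>L y < 0" using assms y by (simp add: lform_simps)
  then have "u + t *\<^sub>R y \<in> hyp3" using y by (intro hyp3_futureI[OF w, of y]) simp_all
  then show ?thesis using t by blast
qed

text \<open>The product with \<open>y\<close> gives the sign of \<open>\<alpha>\<close>, and then
  square -1 gives that of \<open>\<beta>\<close>. Thus the complete geodesic towards an ideal point,
  not just a ray, lies in the open cone of the two vectors.\<close>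

lemma light_pair_coeffs:
  assumes "\<alpha> *\<^sub>R u + \<beta> *\<^sub>R y \<in> hyp3" "u \<circ>\<^sub>L u \<ge> 0" "pos_lightlike y" "u \<circ>\<^sub>L y < 0"
  shows "\<alpha> > 0 \<and> \<beta> > 0"
proof -
  let ?v = "\<alpha> *\<^sub>R u + \<beta> *\<^sub>R y"
  have y: "y \<circ>\<^sub>L y = 0" using assms by (auto simp: pos_lightlike_def)
  have "?v \<circ>\<^sub>L y < 0" using assms(1,3) by (rule hyp3_lform_lightlike)
  then have a: "\<alpha> > 0" using assms(4) y by (simp add: lform_simps mult_less_0_iff)
  have "?v \<circ>\<^sub>L ?v = -1" using assms(1) by (rule hyp3_self)
  then have "\<alpha> * \<alpha> * (u \<circ>\<^sub>L u) + 2 * \<alpha> * (u \<circ>\<^sub>L y) * \<beta> = -1"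
    by (simp add: lform_simps y lform_commute[of y u] algebra_simps)
  moreover have "\<alpha> * \<alpha> * (u \<circ>\<^sub>L u) \<ge> 0" using assms(2) by simp
  ultimately have "2 * \<alpha> * (u \<circ>\<^sub>L y) * \<beta> < 0" by linarith
  moreover have "2 * \<alpha> * (u \<circ>\<^sub>L y) < 0" using a assms(4) by (simp add: mult_pos_neg)
  ultimately have "\<beta> > 0" by (simp add: mult_less_0_iff)
  with a show ?thesis by simp
qed

text \<open>The product with the light-like \<open>u\<close> removes \<open>\<alpha>\<close> and
  shows that \<open>\<beta>\<close> and \<open>\<gamma>\<close> vanish or have opposite signs.
  Opposite signs are impossible: the products with \<open>v\<close> and \<open>w\<close> would
  require contradictory signs of \<open>\<alpha>\<close>.\<close>

lemma light_triple_independent: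
  assumes uu: "u \<circ>\<^sub>L u = 0" and vv: "v \<circ>\<^sub>L v \<ge> 0" and ww: "w \<circ>\<^sub>L w \<ge> 0"
    and uv: "u \<circ>\<^sub>L v < 0" and uw: "u \<circ>\<^sub>L w < 0" and vw: "v \<circ>\<^sub>L w < 0"
    and 0: "\<alpha> *\<^sub>R u + \<beta> *\<^sub>R v + \<gamma> *\<^sub>R w = 0"
  shows "\<alpha> = 0 \<and> \<beta> = 0 \<and> \<gamma> = 0"
proof -
  have *: "\<not> (\<beta> > 0 \<and> \<gamma> < 0)"
    if "v \<circ>\<^sub>L v \<ge> 0" "w \<circ>\<^sub>L w \<ge> 0" "u \<circ>\<^sub>L v < 0" "u \<circ>\<^sub>L w < 0" "v \<circ>\<^sub>L w < 0"
      "\<alpha> *\<^sub>R u + \<beta> *\<^sub>R v + \<gamma> *\<^sub>R w = 0" for v w and \<alpha> \<beta> \<gamma> :: real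
  proof
    assume s: "\<beta> > 0 \<and> \<gamma> < 0"
    have "(\<alpha> *\<^sub>R u + \<beta> *\<^sub>R v + \<gamma> *\<^sub>R w) \<circ>\<^sub>L v = 0" "(\<alpha> *\<^sub>R u + \<beta> *\<^sub>R v + \<gamma> *\<^sub>R w) \<circ>\<^sub>L w = 0"
      unfolding that(6) by (simp_all add: lform_simps)
    then have e: "\<alpha> * (u \<circ>\<^sub>L v) + \<beta> * (v \<circ>\<^sub>L v) + \<gamma> * (v \<circ>\<^sub>L w) = 0"
      "\<alpha> * (u \<circ>\<^sub>L w) + \<beta> * (v \<circ>\<^sub>L w) + \<gamma> * (w \<circ>\<^sub>L w) = 0"
      by (simp_all add: lform_simps lform_commute[of w v])
    have "\<beta> * (v \<circ>\<^sub>L v) \<ge> 0" "\<gamma> * (v \<circ>\<^sub>L w) > 0" "\<beta> * (v \<circ>\<^sub>L w) < 0" "\<gamma> * (w \<circ>\<^sub>L w) \<le> 0"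
      using s that by (simp_all add: mult_neg_neg mult_pos_neg mult_nonpos_nonneg)
    then have "\<alpha> * (u \<circ>\<^sub>L v) < 0" "\<alpha> * (u \<circ>\<^sub>L w) > 0" using e by linarith+
    then show False using that by (simp add: mult_less_0_iff zero_less_mult_iff)
  qed
  have "u \<circ>\<^sub>L (\<alpha> *\<^sub>R u + \<beta> *\<^sub>R v + \<gamma> *\<^sub>R w) = 0" unfolding 0 by (simp add: lform_simps)
  then have e: "\<beta> * (u \<circ>\<^sub>L v) + \<gamma> * (u \<circ>\<^sub>L w) = 0" by (simp add: lform_simps uu)
  have "\<not> (\<beta> > 0 \<and> \<gamma> < 0)" by (rule *[OF vv ww uv uw vw 0])
  moreover have "\<not> (\<gamma> > 0 \<and> \<beta> < 0)"
    by (rule *[OF ww vv uw uv, of \<alpha> \<gamma> \<beta>]) (use vw 0 in \<open>auto simp: lform_commute algebra_simps\<close>)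
  moreover have "\<beta> * (u \<circ>\<^sub>L v) = - (\<gamma> * (u \<circ>\<^sub>L w))" using e by simp
  ultimately have "\<beta> = 0 \<and> \<gamma> = 0"
    using uv uw by (smt (verit) mult_neg_neg mult_pos_neg mult_eq_0_iff)
  moreover from this have "\<alpha> *\<^sub>R u = 0" using 0 by simp
  ultimately show ?thesis using uv by (auto simp: lform_simps)
qed

lemma dim_span_three:
  assumes "\<And>\<alpha> \<beta> \<gamma>. \<alpha> *\<^sub>R u + \<beta> *\<^sub>R v + \<gamma> *\<^sub>R w = 0 \<Longrightarrow> \<alpha> = 0 \<and> \<beta> = 0 \<and> \<gamma> = 0"
  shows "dim (span {u, v, w}) = 3"
proof -
  have w: "w \<noteq> 0" using assms[of 0 0 1] by auto
  have v: "v \<notin> span {w}"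
  proof
    assume "v \<in> span {w}"
    then obtain k where "v = k *\<^sub>R w" by (auto simp: span_singleton)
    then show False using assms[of 0 1 "- k"] by simp
  qed
  have u: "u \<notin> span {v, w}"
  proof
    assume "u \<in> span {v, w}"
    then obtain k l where "u = k *\<^sub>R v + l *\<^sub>R w" by (auto simp: span_pair)
    then show False using assms[of 1 "- k" "- l"] by simp
  qed
  have "independent {u, v, w}" using u v w by (simp add: independent_insert)
  moreover have "card {u, v, w} = 3"
    using u v by (metis card_3_iff insertCI span_base)
  ultimately show ?thesis using dim_span_eq_card_independent[of "{u, v, w}"] by simp
qed

section \<open>Geodesics joining the objects of a frame\<close>

context tet_frame begin

abbreviation "I \<equiv> {1..4::nat}"

lemma I_eq: "I = {1, 2, 3, 4}" by auto

lemma I_cases: assumes "i \<in> I" obtains "i = 1" | "i = 2" | "i = 3" | "i = 4"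
  using assms unfolding I_eq by blast

lemma e_light: "e 3 \<circ>\<^sub>L e 3 = 0" "e 4 \<circ>\<^sub>L e 4 = 0" "e 3 $ 1 > 0" "e 4 $ 1 > 0"
  using lightlike by (auto simp: pos_lightlike_def)

lemma e_self: assumes "i \<in> I" shows "e i \<circ>\<^sub>L e i \<ge> 0"
  using assms by (cases rule: I_cases) (simp_all only: unit e_light zero_le_one order_refl)

lemma plane_index: "i \<in> {1, 2} \<Longrightarrow> e i \<circ>\<^sub>L e i = 1 \<and> P i = hplane (e i) \<and> i \<in> I"
  using unit planes by auto

lemma ideal_index: "j \<in> {3, 4} \<Longrightarrow> x j = e j \<and> pos_lightlike (e j) \<and> j \<in> I"
  using lightlike ideal by auto

lemma ultraparallel: "ultraparallel (e 1) (e 2) (- (e 1 \<circ>\<^sub>L e 2))"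
  using unit ultra by unfold_locales auto

lemma plane_pair:
  assumes "subspace W" "e 1 \<in> W" "e 2 \<in> W"
    "F = {v \<in> W \<inter> hyp3. e 1 \<circ>\<^sub>L v = 0}" "G = {v \<in> W \<inter> hyp3. e 2 \<circ>\<^sub>L v = 0}"
  shows "plane_pair (e 1) (e 2) (- (e 1 \<circ>\<^sub>L e 2)) W F G"
proof -
  interpret u: ultraparallel "e 1" "e 2" "- (e 1 \<circ>\<^sub>L e 2)" by (rule ultraparallel)
  interpret s: ultraparallel "e 2" "e 1" "- (e 1 \<circ>\<^sub>L e 2)" by (rule u.swap)
  have "e 1 \<circ>\<^sub>L e 3 < 0" "e 2 \<circ>\<^sub>L e 3 < 0" by (rule neg; simp)+
  then have "u.foot \<in> hyp3" "s.foot \<in> hyp3"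
    using e_light by (intro u.foot_hyp3I[of "e 3"] s.foot_hyp3I[of "e 3"]; simp)+
  then show ?thesis using assms by unfold_locales
qed

lemma plane_pair_UNIV: "plane_pair (e 1) (e 2) (- (e 1 \<circ>\<^sub>L e 2)) UNIV (P 1) (P 2)"
  using planes by (intro plane_pair) auto

lemma plane_ideal:
  assumes "i \<in> {1, 2}" "j \<in> {3, 4}" "subspace W" "e i \<in> W" "e j \<in> W"
    "F = {v \<in> W \<inter> hyp3. e i \<circ>\<^sub>L v = 0}"
  shows "plane_ideal W F (e i) (e j)"
proof -
  have "e i \<circ>\<^sub>L e j < 0" using assms by (intro neg) auto
  then show ?thesis using assms plane_index[OF assms(1)] ideal_index[OF assms(2)]
    by unfold_locales auto
qed

lemma plane_ideal_UNIV: "i \<in> {1, 2} \<Longrightarrow> j \<in> {3, 4} \<Longrightarrow> plane_ideal UNIV (P i) (e i) (e j)"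
  using plane_index by (intro plane_ideal) auto

text \<open>Two light-like or mixed objects are handled by \<open>light_pair_point\<close>; for the
  two planes the point is the foot of their common perpendicular. The point makes every vector
  orthogonal to two of the \<open>e i\<close> space-like.\<close>

lemma pair_point:
  assumes "i \<in> I" "j \<in> I" "i \<noteq> j"
  shows "\<exists>\<alpha> \<beta>. \<alpha> > 0 \<and> \<beta> > 0 \<and> \<alpha> *\<^sub>R e i + \<beta> *\<^sub>R e j \<in> hyp3"
proof -
  have light: "\<exists>\<alpha> \<beta>. \<alpha> > 0 \<and> \<beta> > 0 \<and> \<alpha> *\<^sub>R e i + \<beta> *\<^sub>R e j \<in> hyp3"
    if "i \<in> I" "j \<in> {3, 4}" "i \<noteq> j" for i j
  proof -
    have "e i \<circ>\<^sub>L e j < 0" using that by (intro neg) auto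
    then obtain t where "t > 0" "e i + t *\<^sub>R e j \<in> hyp3"
      using light_pair_point[OF e_self[OF \<open>i \<in> I\<close>], of "e j"] ideal_index[OF \<open>j \<in> {3, 4}\<close>] by blast
    then show ?thesis by (intro exI[of _ 1] exI[of _ t]) simp
  qed
  interpret u: plane_pair "e 1" "e 2" "- (e 1 \<circ>\<^sub>L e 2)" UNIV "P 1" "P 2" by (rule plane_pair_UNIV)
  define r where "r = 1 / sqrt ((- (e 1 \<circ>\<^sub>L e 2))\<^sup>2 - 1)"
  have r: "r > 0" using u.r_pos(1) by (simp add: r_def)
  have foot: "(r * - (e 1 \<circ>\<^sub>L e 2)) *\<^sub>R e 1 + r *\<^sub>R e 2 \<in> hyp3"
    using u.foot_hyp3(1) by (simp only: u.foot_def r_def scaleR_add_right scaleR_scaleR)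
  have pos: "r * - (e 1 \<circ>\<^sub>L e 2) > 0" using r ultra by (intro mult_pos_pos) auto
  consider "j \<in> {3, 4}" | "i \<in> {3, 4}" | "i = 1" "j = 2" | "i = 2" "j = 1"
    using assms unfolding I_eq by blast
  then show ?thesis
  proof cases
    case 1 then show ?thesis using light assms by blast
  next
    case 2
    then obtain \<alpha> \<beta> where "\<alpha> > 0" "\<beta> > 0" "\<alpha> *\<^sub>R e j + \<beta> *\<^sub>R e i \<in> hyp3" using light[of j i] assms by blast
    then show ?thesis by (metis add.commute)
  next
    case 3 then show ?thesis using foot pos r by blast
  next
    case 4 then show ?thesis using foot pos r by (metis add.commute)
  qed
qed

text \<open>Three distinct indices always include 3 or 4, so a light-like vector is available for
  \<open>light_triple_independent\<close>.\<close>

lemma triple_independent: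
  assumes "i \<in> I" "j \<in> I" "k \<in> I" "i \<noteq> j" "i \<noteq> k" "j \<noteq> k"
    and 0: "\<alpha> *\<^sub>R e i + \<beta> *\<^sub>R e j + \<gamma> *\<^sub>R e k = 0"
  shows "\<alpha> = 0 \<and> \<beta> = 0 \<and> \<gamma> = 0"
proof -
  have n: "e i \<circ>\<^sub>L e j < 0" "e i \<circ>\<^sub>L e k < 0" "e j \<circ>\<^sub>L e k < 0"
    "e j \<circ>\<^sub>L e i < 0" "e k \<circ>\<^sub>L e i < 0" "e k \<circ>\<^sub>L e j < 0"
    using assms by (auto intro!: neg)
  have s: "e i \<circ>\<^sub>L e i \<ge> 0" "e j \<circ>\<^sub>L e j \<ge> 0" "e k \<circ>\<^sub>L e k \<ge> 0" using e_self assms by auto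
  have "i \<in> {3,4} \<or> j \<in> {3,4} \<or> k \<in> {3,4}" using assms(1-6) unfolding I_eq by blast
  then consider "e i \<circ>\<^sub>L e i = 0" | "e j \<circ>\<^sub>L e j = 0" | "e k \<circ>\<^sub>L e k = 0" using e_light by auto
  then show ?thesis
  proof cases
    case 1 then show ?thesis using light_triple_independent[OF _ s(2,3) n(1,2,3) 0] by blast
  next
    case 2
    have "\<beta> *\<^sub>R e j + \<alpha> *\<^sub>R e i + \<gamma> *\<^sub>R e k = 0" using 0 by (simp add: algebra_simps)
    then show ?thesis using light_triple_independent[OF 2 s(1,3) n(4,3,2)] by blast
  next
    case 3
    have "\<gamma> *\<^sub>R e k + \<alpha> *\<^sub>R e i + \<beta> *\<^sub>R e j = 0" using 0 by (simp add: algebra_simps)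
    then show ?thesis using light_triple_independent[OF 3 s(1,2) n(5,6,1)] by blast
  qed
qed

lemma orthogonal_triple:
  assumes "i \<in> I" "j \<in> I" "k \<in> I" "i \<noteq> j" "i \<noteq> k" "j \<noteq> k"
    and "m \<noteq> 0" "m \<circ>\<^sub>L e i = 0" "m \<circ>\<^sub>L e j = 0" "m \<circ>\<^sub>L e k = 0"
  shows "orth m = span {e i, e j, e k}"
proof -
  have "dim (span {e i, e j, e k}) = 3"
    by (rule dim_span_three) (rule triple_independent[OF assms(1-6)])
  moreover have "span {e i, e j, e k} \<subseteq> orth m"
    using assms by (intro span_minimal subspace_lform_orthogonal) auto
  ultimately show ?thesis using dim_lform_orthogonal[OF assms(7)]
    by (intro subspace_dim_equal[symmetric] subspace_span subspace_lform_orthogonal) auto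
qed

lemma orthogonal_pair_pos:
  assumes "i \<in> I" "j \<in> I" "i \<noteq> j" "m \<noteq> 0" "m \<circ>\<^sub>L e i = 0" "m \<circ>\<^sub>L e j = 0"
  shows "m \<circ>\<^sub>L m > 0" "\<exists>p\<in>hyp3. p \<in> span {e i, e j} \<and> m \<circ>\<^sub>L p = 0"
proof -
  obtain \<alpha> \<beta> where p: "\<alpha> *\<^sub>R e i + \<beta> *\<^sub>R e j \<in> hyp3" using pair_point[OF assms(1-3)] by blast
  have 0: "m \<circ>\<^sub>L (\<alpha> *\<^sub>R e i + \<beta> *\<^sub>R e j) = 0" using assms by (simp add: lform_simps)
  show "m \<circ>\<^sub>L m > 0" by (rule orthogonal_timelike_pos[OF hyp3_timelike[OF p] 0 assms(4)])
  have "\<alpha> *\<^sub>R e i + \<beta> *\<^sub>R e j \<in> span {e i, e j}" by (intro span_add span_scale span_base) auto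
  with p 0 show "\<exists>p\<in>hyp3. p \<in> span {e i, e j} \<and> m \<circ>\<^sub>L p = 0" by blast
qed

text \<open>Stated for a general \<open>W\<close> to cover both \<open>edge_line P\<close> in space
  and the lines inside the plane of a degenerate tetrahedron.\<close>

lemma edge_line_eq:
  assumes W: "subspace W" "\<And>i. i \<in> I \<Longrightarrow> e i \<in> W"
    and F: "\<And>i. i \<in> {1, 2} \<Longrightarrow> F i = {v \<in> W \<inter> hyp3. e i \<circ>\<^sub>L v = 0}"
    and ij: "i \<in> I" "j \<in> I" "i \<noteq> j"
  shows "edge_line F x i j = span {e i, e j} \<inter> hyp3"
proof -
  have W': "e 1 \<in> W" "e 2 \<in> W" using W(2) by auto
  have pp: "plane_pair (e 1) (e 2) (- (e 1 \<circ>\<^sub>L e 2)) W (F 1) (F 2)"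
    using W(1) W' F by (intro plane_pair) auto
  have pi: "perp_geodesic (F i) (x j) = span {e i, e j} \<inter> hyp3" if "i \<in> {1,2}" "j \<in> {3,4}" for i j
  proof -
    have "i \<in> I" "j \<in> I" using that by auto
    then have "plane_ideal W (F i) (e i) (e j)" using that W F by (intro plane_ideal) auto
    then show ?thesis using ideal_index[OF that(2)] by (simp add: plane_ideal.perp_geodesic_eq)
  qed
  have comm: "span {e j, e i} = span {e i, e j}" by (simp add: insert_commute)
  consider "i \<in> {1,2}" "j \<in> {3,4}" | "i \<in> {3,4}" "j \<in> {1,2}" | "i = 1" "j = 2" | "i = 2" "j = 1"
    | "i \<in> {3,4}" "j \<in> {3,4}"
    using ij unfolding I_eq by blast
  then show ?thesis
  proof cases
    case 1
    then have "edge_line F x i j = perp_geodesic (F i) (x j)" by (auto simp: edge_line_def)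
    then show ?thesis using pi[OF 1] by simp
  next
    case 2
    then have "edge_line F x i j = perp_geodesic (F j) (x i)" by (auto simp: edge_line_def)
    then show ?thesis using pi[OF 2(2,1)] comm by simp
  next
    case 3
    then show ?thesis using plane_pair.common_perp_eq[OF pp] by (simp add: edge_line_def)
  next
    case 4
    then show ?thesis using plane_pair.common_perp_eq[OF plane_pair.pair_swap[OF pp]]
      by (simp add: edge_line_def)
  next
    case 5
    then have "edge_line F x i j = ideal_geodesic (x i) (x j)" by (auto simp: edge_line_def)
    moreover have "e i \<circ>\<^sub>L e j < 0" using ij by (intro neg)
    ultimately show ?thesis using ideal_index[OF 5(1)] ideal_index[OF 5(2)] by (simp add: ideal_geodesic_eq)
  qed
qed

lemma edge_line_P: "i \<in> I \<Longrightarrow> j \<in> I \<Longrightarrow> i \<noteq> j \<Longrightarrow> edge_line P x i j = span {e i, e j} \<inter> hyp3"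
  using plane_index by (intro edge_line_eq[of UNIV]) auto

lemma edge_ideal:
  assumes "i \<in> {1, 2}" "j \<in> {3, 4}"
  shows "edge P x i j = hsegment ((1 / - (e i \<circ>\<^sub>L e j)) *\<^sub>R e j + e i) (e j)"
proof -
  interpret plane_ideal UNIV "P i" "e i" "e j" by (rule plane_ideal_UNIV[OF assms])
  have "edge P x i j = perp_ray (P i) (x j)" using assms by (auto simp: edge_def)
  then show ?thesis using perp_ray_eq ideal_index[OF assms(2)] by (simp add: pfoot_def)
qed

lemma ex_orthogonal: fixes A :: "(real^4) set"
  assumes "finite A" "card A < 4" shows "\<exists>m. m \<noteq> 0 \<and> (\<forall>v\<in>A. m \<circ>\<^sub>L v = 0)"
proof -
  have "dim A < DIM(real^4)" using dim_le_card'[OF assms(1)] assms(2) by simp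
  then obtain a where a: "a \<noteq> 0" "\<And>y. y \<in> span A \<Longrightarrow> orthogonal a y"
    using orthogonal_to_subspace_exists by blast
  obtain m where "\<forall>v. a \<bullet> v = m \<circ>\<^sub>L v" "m \<noteq> 0" using inner_eq_lform a(1) by blast
  then show ?thesis using a(2) by (metis orthogonal_def span_base)
qed

end

section \<open>Faces of the tetrahedron\<close>

context tet_frame begin

lemma others:
  assumes "i \<in> I"
  obtains j k l where "I - {i} = {j, k, l}" "j \<in> I" "k \<in> I" "l \<in> I" "j \<noteq> k" "j \<noteq> l" "k \<noteq> l"
    "i \<noteq> j" "i \<noteq> k" "i \<noteq> l"
proof -
  have eq: "I - {1} = {2, 3, 4}" "I - {2} = {1, 3, 4}" "I - {3} = {1, 2, 4}" "I - {4} = {1, 2, 3}"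
    unfolding I_eq by auto
  show ?thesis using assms
  proof (cases rule: I_cases)
    case 1 then show ?thesis by (intro that[of 2 3 4]) (simp_all only: eq, simp_all)
  next
    case 2 then show ?thesis by (intro that[of 1 3 4]) (simp_all only: eq, simp_all)
  next
    case 3 then show ?thesis by (intro that[of 1 2 4]) (simp_all only: eq, simp_all)
  next
    case 4 then show ?thesis by (intro that[of 1 2 3]) (simp_all only: eq, simp_all)
  qed
qed

lemma hat_normal:
  assumes "i \<in> I" shows "\<exists>m. m \<noteq> 0 \<and> (\<forall>j\<in>I - {i}. m \<circ>\<^sub>L e j = 0)"
proof -
  have "card (e ` (I - {i})) \<le> card (I - {i})" by (intro card_image_le) simp
  also have "\<dots> < 4" using assms by simp
  finally have "\<exists>m. m \<noteq> 0 \<and> (\<forall>v\<in>e ` (I - {i}). m \<circ>\<^sub>L v = 0)" by (intro ex_orthogonal) simp_all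
  then show ?thesis by auto
qed

lemma foot_in_span:
  assumes "j \<in> {1, 2}" "k \<in> {3, 4}"
  shows "\<exists>p\<in>P j. p \<in> span {e j, e k}"
proof -
  interpret plane_ideal UNIV "P j" "e j" "e k" by (rule plane_ideal_UNIV[OF assms])
  show ?thesis using pfoot_mem by blast
qed

lemma orthogonal_planes_perp:
  assumes "m \<noteq> 0" "m \<circ>\<^sub>L m > 0" "j \<in> {1, 2}" "k \<in> {3, 4}" "m \<circ>\<^sub>L e j = 0" "m \<circ>\<^sub>L e k = 0"
  shows "planes_perp (hplane m) (P j)"
proof -
  obtain p where p: "p \<in> P j" "p \<in> span {e j, e k}" using foot_in_span[OF assms(3,4)] by blast
  have j: "e j \<circ>\<^sub>L e j > 0" "P j = hplane (e j)" using plane_index[OF assms(3)] by auto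
  have "m \<circ>\<^sub>L p = 0" by (rule lform_orthogonal_span[OF _ p(2)]) (use assms in auto)
  then have "hplane m \<inter> P j \<noteq> {}" using p j(2) by auto
  then show ?thesis using planes_perp_iff[OF assms(2) j(1) refl j(2)] assms(5) by blast
qed

text \<open>Being perpendicular to \<open>P j\<close> and containing the ideal point
  \<open>x j\<close> are the same linear condition, orthogonality of the normal to
  \<open>e j\<close>. Three such conditions fix the plane, since any three of the \<open>e i\<close>
  are independent.\<close>

lemma hat_plane_eq:
  assumes i: "i \<in> I" and m: "m \<noteq> 0" "\<And>j. j \<in> I - {i} \<Longrightarrow> m \<circ>\<^sub>L e j = 0"
  shows "hat_plane P x i = hplane m"
proof -
  obtain j k l where jkl: "I - {i} = {j, k, l}" "j \<in> I" "k \<in> I" "l \<in> I" "j \<noteq> k" "j \<noteq> l" "k \<noteq> l"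
    using others[OF i] by metis
  have mj: "m \<circ>\<^sub>L e j = 0" "m \<circ>\<^sub>L e k = 0" "m \<circ>\<^sub>L e l = 0" using m(2) unfolding jkl(1) by auto
  obtain p where p: "p \<in> hyp3" "m \<circ>\<^sub>L p = 0"
    using orthogonal_pair_pos(2)[OF jkl(2,3,5) m(1) mj(1,2)] by blast
  have mm: "m \<circ>\<^sub>L m > 0" by (rule orthogonal_pair_pos(1)[OF jkl(2,3,5) m(1) mj(1,2)])
  let ?Q = "hplane m"
  have sub: "{1, 2} - {i} \<subseteq> I - {i}" "{3, 4} - {i} \<subseteq> I - {i}" by auto
  have spQ: "span ?Q = orth m" using span_hyperplane_section[of UNIV p m] p by simp
  show ?thesis unfolding hat_plane_def
  proof (rule the_equality, intro conjI ballI)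
    show "is_plane ?Q" by (rule is_planeI[OF m(1) p])
    show "planes_perp ?Q (P j)" if "j \<in> {1, 2} - {i}" for j
    proof -
      \<comment> \<open>Perpendicular planes must also meet. An ideal index other than
        \<open>i\<close> provides a common point, the foot on \<open>P j\<close> of the
        perpendicular from that ideal point.\<close>
      have "\<exists>k. k \<in> {3, 4} - {i}" by (cases "i = 3") auto
      then obtain k where "k \<in> {3, 4} - {i}" by blast
      then show ?thesis using that sub m mm by (intro orthogonal_planes_perp[of m j k]) auto
    qed
    show "x j \<in> ideal_boundary ?Q" if "j \<in> {3, 4} - {i}" for j
      using that ideal_index[of j] m(2)[of j] by (auto simp: ideal_boundary_def spQ)
  next
    fix Q assume Q: "is_plane Q \<and> (\<forall>j\<in>{1, 2} - {i}. planes_perp Q (P j)) \<and>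
      (\<forall>j\<in>{3, 4} - {i}. x j \<in> ideal_boundary Q)"
    then obtain n where n: "n \<circ>\<^sub>L n = 1" "Q = hplane n" "span Q = orth n"
      using plane_normal by blast
    have "n \<circ>\<^sub>L e j = 0" if "j \<in> I - {i}" for j
    proof (cases "j \<in> {1, 2}")
      case True
      then have "planes_perp Q (P j)" using Q that by blast
      moreover have "n \<circ>\<^sub>L n > 0" "e j \<circ>\<^sub>L e j > 0" "P j = hplane (e j)"
        using n(1) plane_index[OF True] by auto
      ultimately show ?thesis using planes_perp_iff n(2) by blast
    next
      case False
      then have j: "j \<in> {3, 4} - {i}" using that unfolding I_eq by blast
      then have "x j \<in> ideal_boundary Q" using Q by blast
      then show ?thesis using j ideal_index[of j] n(3) by (auto simp: ideal_boundary_def)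
    qed
    then have nj: "n \<circ>\<^sub>L e j = 0" "n \<circ>\<^sub>L e k = 0" "n \<circ>\<^sub>L e l = 0" unfolding jkl(1) by auto
    have "n \<noteq> 0" using n(1) by (auto simp: lform_simps)
    then have "orth n = orth m"
      using orthogonal_triple[OF jkl(2-7) _ nj] orthogonal_triple[OF jkl(2-7) m(1) mj] by simp
    then show "Q = ?Q" using n(2) by blast
  qed
qed

text \<open>Both endpoints are in the cone of \<open>e i\<close> and \<open>e j\<close>; this is
  stated through functionals, the only form in which it is used.\<close>

lemma edge_eq_hsegment:
  assumes "i \<in> {1, 2}" "j \<in> I" "i \<noteq> j"
  shows "\<exists>p q. edge P x i j = hsegment p q \<and>
    (\<forall>m. m \<circ>\<^sub>L e i \<ge> 0 \<longrightarrow> m \<circ>\<^sub>L e j \<ge> 0 \<longrightarrow> m \<circ>\<^sub>L p \<ge> 0 \<and> m \<circ>\<^sub>L q \<ge> 0)"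
proof -
  consider "j \<in> {3, 4}" | "(i = 1 \<and> j = 2) \<or> (i = 2 \<and> j = 1)" using assms unfolding I_eq by auto
  then show ?thesis
  proof cases
    case 1
    have "e i \<circ>\<^sub>L e j < 0" using assms by (intro neg) auto
    then have "1 / - (e i \<circ>\<^sub>L e j) \<ge> 0" by simp
    then have "m \<circ>\<^sub>L ((1 / - (e i \<circ>\<^sub>L e j)) *\<^sub>R e j + e i) \<ge> 0"
      if "m \<circ>\<^sub>L e i \<ge> 0" "m \<circ>\<^sub>L e j \<ge> 0" for m
      using that unfolding lform_add_right lform_scale_right
      by (intro add_nonneg_nonneg mult_nonneg_nonneg)
    then show ?thesis unfolding edge_ideal[OF assms(1) 1] by blast
  next
    case 2
    interpret u: plane_pair "e 1" "e 2" "- (e 1 \<circ>\<^sub>L e 2)" UNIV "P 1" "P 2" by (rule plane_pair_UNIV)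
    have c: "1 / sqrt ((- (e 1 \<circ>\<^sub>L e 2))\<^sup>2 - 1) \<ge> 0" "- (e 1 \<circ>\<^sub>L e 2) \<ge> 0"
      using u.r_pos(1) ultra by simp_all
    have "m \<circ>\<^sub>L u.foot \<ge> 0 \<and> m \<circ>\<^sub>L u.foot' \<ge> 0" if "m \<circ>\<^sub>L e 1 \<ge> 0" "m \<circ>\<^sub>L e 2 \<ge> 0" for m
      unfolding u.foot_def ultraparallel.foot_def[OF u.swap] lform_add_right lform_scale_right
      using that c by (intro conjI mult_nonneg_nonneg[OF c(1) add_nonneg_nonneg[OF mult_nonneg_nonneg[OF c(2)]]])
    moreover have "edge P x 1 2 = hsegment u.foot u.foot'" "edge P x 2 1 = hsegment u.foot' u.foot"
      using u.shortest_arc_eq plane_pair.shortest_arc_eq[OF u.pair_swap] by (simp_all add: edge_def)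
    ultimately have "\<exists>p q. edge P x 1 2 = hsegment p q \<and>
        (\<forall>m. m \<circ>\<^sub>L e 1 \<ge> 0 \<longrightarrow> m \<circ>\<^sub>L e 2 \<ge> 0 \<longrightarrow> m \<circ>\<^sub>L p \<ge> 0 \<and> m \<circ>\<^sub>L q \<ge> 0)"
      "\<exists>p q. edge P x 2 1 = hsegment p q \<and>
        (\<forall>m. m \<circ>\<^sub>L e 2 \<ge> 0 \<longrightarrow> m \<circ>\<^sub>L e 1 \<ge> 0 \<longrightarrow> m \<circ>\<^sub>L p \<ge> 0 \<and> m \<circ>\<^sub>L q \<ge> 0)"
      by blast+
    then show ?thesis using 2 by (elim disjE conjE) (simp_all only:)
  qed
qed

lemma edge_nonneg:
  assumes "i \<in> {1, 2}" "j \<in> I" "i \<noteq> j" "v \<in> edge P x i j"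
  shows "v \<in> hyp3" "m \<circ>\<^sub>L e i \<ge> 0 \<Longrightarrow> m \<circ>\<^sub>L e j \<ge> 0 \<Longrightarrow> m \<circ>\<^sub>L v \<ge> 0"
proof -
  obtain p q where pq: "edge P x i j = hsegment p q"
    "\<forall>m. m \<circ>\<^sub>L e i \<ge> 0 \<longrightarrow> m \<circ>\<^sub>L e j \<ge> 0 \<longrightarrow> m \<circ>\<^sub>L p \<ge> 0 \<and> m \<circ>\<^sub>L q \<ge> 0"
    using edge_eq_hsegment[OF assms(1-3)] by blast
  then show "v \<in> hyp3" using assms(4) by (simp add: hsegment_def)
  show "m \<circ>\<^sub>L v \<ge> 0" if "m \<circ>\<^sub>L e i \<ge> 0" "m \<circ>\<^sub>L e j \<ge> 0"
    using assms(4) pq that by (auto simp: hsegment_def lform_simps)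
qed

lemma edge_line_nonneg:
  assumes "i \<in> I" "j \<in> {3, 4}" "i \<noteq> j" "v \<in> edge_line P x i j" "m \<circ>\<^sub>L e i \<ge> 0" "m \<circ>\<^sub>L e j \<ge> 0"
  shows "m \<circ>\<^sub>L v \<ge> 0"
proof -
  have j: "j \<in> I" "pos_lightlike (e j)" using ideal_index[OF assms(2)] by auto
  have "v \<in> span {e i, e j}" "v \<in> hyp3" using assms(4) edge_line_P[OF assms(1) j(1) assms(3)] by auto
  then obtain \<alpha> \<beta> where v: "v = \<alpha> *\<^sub>R e i + \<beta> *\<^sub>R e j" by (auto simp: span_pair)
  then have "\<alpha> > 0 \<and> \<beta> > 0"
    using light_pair_coeffs[of \<alpha> "e i" \<beta> "e j"] \<open>v \<in> hyp3\<close> e_self[OF assms(1)] j(2) neg[OF assms(1) j(1) assms(3)]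
    by simp
  then show ?thesis using assms(5,6) by (simp add: v lform_simps)
qed

text \<open>The faces are oriented by the sign at the opposite vector \<open>e i\<close>: the
  prescribed edges are combinations of the \<open>e j\<close> with nonnegative coefficients, hence
  on the nonnegative side of \<open>m\<close>.\<close>

lemma hat_half_eq:
  assumes i: "i \<in> I" and m: "\<And>j. j \<in> I - {i} \<Longrightarrow> m \<circ>\<^sub>L e j = 0" and pos: "m \<circ>\<^sub>L e i > 0"
  shows "hat_half P x i = hhalf m"
proof -
  have m0: "m \<noteq> 0" using pos by (auto simp: lform_simps)
  obtain j k l where jkl: "I - {i} = {j, k, l}" "j \<in> I" "k \<in> I" "j \<noteq> k"
    using others[OF i] by metis
  have mj: "m \<circ>\<^sub>L e j = 0" "m \<circ>\<^sub>L e k = 0" using m unfolding jkl(1) by auto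
  have mm: "m \<circ>\<^sub>L m > 0" by (rule orthogonal_pair_pos(1)[OF jkl(2,3,4) m0 mj])
  obtain p where p: "p \<in> hyp3" "m \<circ>\<^sub>L p = 0"
    using orthogonal_pair_pos(2)[OF jkl(2,3,4) m0 mj] by blast
  have hp: "hat_plane P x i = hplane m" using m0 m by (rule hat_plane_eq[OF i])
  have ge: "m \<circ>\<^sub>L e j \<ge> 0" if "j \<in> I" for j using m[of j] pos that by (cases "j = i") auto
  let ?K = "hhalf m"
  \<comment> \<open>Uniqueness needs one edge point strictly on the positive side, to rule out the
    opposite half-space; a foot \<open>pfoot\<close> involving \<open>e i\<close> will
    serve.\<close>
  have the: "(THE K. half_of hyp3 (hplane m) K \<and> (R \<subseteq> K \<and> S \<subseteq> K \<and> T \<subseteq> K)) = ?K"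
    if "R \<subseteq> ?K" "S \<subseteq> ?K" "T \<subseteq> ?K" "v \<in> R \<union> S" "m \<circ>\<^sub>L v > 0" for R S T v
    unfolding half_of_plane[OF mm p] using that by (intro the_equality) fastforce+
  show ?thesis
  proof (cases "i \<in> {1, 2}")
    case True
    have sub: "edge P x i' j \<subseteq> ?K" if "i' \<in> {1,2}" "j \<in> I" "i' \<noteq> j" for i' j
    proof -
      have "i' \<in> I" using that(1) by auto
      then show ?thesis using edge_nonneg[OF that] ge[OF \<open>i' \<in> I\<close>] ge[OF that(2)] by blast
    qed
    interpret f: plane_ideal UNIV "P i" "e i" "e 3" by (rule plane_ideal_UNIV[OF True]) simp
    have "edge P x i 3 = hsegment f.pfoot (e 3)" unfolding f.pfoot_def by (rule edge_ideal[OF True]) simp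
    then have foot: "f.pfoot \<in> edge P x (3 - i) i \<union> edge P x i 3"
      using hsegment_left f.pfoot_mem(1) by simp
    have fpos: "m \<circ>\<^sub>L f.pfoot > 0"
      unfolding f.pfoot_def lform_add_right lform_scale_right using m[of 3] pos True by auto
    have le: "i \<le> 2" using True by auto
    have "edge P x (3 - i) i \<subseteq> ?K" "edge P x i 3 \<subseteq> ?K" "edge P x i 4 \<subseteq> ?K"
      by (rule sub; use True i in auto; fail)+
    then show ?thesis unfolding hat_half_def hp using le the[OF _ _ _ foot fpos] by (simp only: if_True)
  next
    case False
    then have i34: "i \<in> {3, 4}" using i unfolding I_eq by blast
    have sub: "edge_line P x i' j \<subseteq> ?K" if "i' \<in> I" "j \<in> {3,4}" "i' \<noteq> j" for i' j
    proof -
      have "j \<in> I" using that(2) by auto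
      then show ?thesis
        using edge_line_nonneg[OF that] edge_line_P[OF that(1) \<open>j \<in> I\<close> that(3)] ge[OF that(1)] ge[OF \<open>j \<in> I\<close>]
        by blast
    qed
    interpret f: plane_ideal UNIV "P 1" "e 1" "e i" by (rule plane_ideal_UNIV[OF _ i34]) simp
    have i1: "1 \<in> I" "1 \<noteq> i" using i34 by auto
    have foot: "f.pfoot \<in> edge_line P x 1 i \<union> edge_line P x 2 i"
      using f.pfoot_mem edge_line_P[OF i1(1) i i1(2)] by simp
    have "1 / - (e 1 \<circ>\<^sub>L e i) > 0" using f.ny by simp
    then have "1 / - (e 1 \<circ>\<^sub>L e i) * (m \<circ>\<^sub>L e i) > 0" using pos by (rule mult_pos_pos)
    moreover have "m \<circ>\<^sub>L e 1 = 0" by (rule m) (use i1 in auto)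
    ultimately have fpos: "m \<circ>\<^sub>L f.pfoot > 0"
      unfolding f.pfoot_def lform_add_right lform_scale_right by simp
    have le: "\<not> i \<le> 2" using i34 by auto
    have "edge_line P x 1 i \<subseteq> ?K" "edge_line P x 2 i \<subseteq> ?K" "edge_line P x 3 4 \<subseteq> ?K"
      by (rule sub; use i34 in auto; fail)+
    then show ?thesis unfolding hat_half_def hp using le the[OF _ _ _ foot fpos] by (simp only: if_False)
  qed
qed

text \<open>For a light-like \<open>e j\<close> this is causality. For the other normal, a foot is a
  positive combination of both normals, has negative product with \<open>v\<close>, and the term of
  \<open>e r\<close> vanishes at \<open>v\<close>.\<close>

lemma plane_point_neg:
  assumes "r \<in> {1, 2}" "v \<in> P r" "j \<in> I" "j \<noteq> r"
  shows "e j \<circ>\<^sub>L v < 0"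
proof (cases "j \<in> {3, 4}")
  case True
  then show ?thesis using assms plane_index[OF assms(1)] ideal_index[OF True]
    hyp3_lform_lightlike[of v "e j"] by (auto simp: lform_commute)
next
  case False
  interpret u: plane_pair "e 1" "e 2" "- (e 1 \<circ>\<^sub>L e 2)" UNIV "P 1" "P 2" by (rule plane_pair_UNIV)
  interpret s: plane_pair "e 2" "e 1" "- (e 1 \<circ>\<^sub>L e 2)" UNIV "P 2" "P 1" by (rule u.pair_swap)
  have v: "v \<in> hyp3" "e r \<circ>\<^sub>L v = 0" using assms plane_index[OF assms(1)] by auto
  have "u.foot \<circ>\<^sub>L v < 0" "s.foot \<circ>\<^sub>L v < 0" using v hyp3_lform_neg u.foot_hyp3 by blast+
  then have f: "- (e 1 \<circ>\<^sub>L e 2) * (e 1 \<circ>\<^sub>L v) + e 2 \<circ>\<^sub>L v < 0" "- (e 1 \<circ>\<^sub>L e 2) * (e 2 \<circ>\<^sub>L v) + e 1 \<circ>\<^sub>L v < 0"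
    unfolding u.foot_def s.foot_def lform_scale_left lform_add_left using u.r_pos(1)
    by (auto simp only: mult_less_0_iff zero_less_divide_iff divide_less_0_iff)
  have "(r = 1 \<and> j = 2) \<or> (r = 2 \<and> j = 1)" using assms False unfolding I_eq by auto
  then show ?thesis using v(2) f by auto
qed

text \<open>If \<open>\<kappa>\<close> were not positive, orthogonality to \<open>e r\<close>
  together with the negative products of \<open>v\<close> with \<open>e p\<close> and
  \<open>e q\<close> would make \<open>\<alpha>\<close> and \<open>\<beta>\<close> non-positive;
  then the square of \<open>v\<close> could not be negative. It follows that a whole line
  \<open>F r\<close> lies on the same side of a cut through \<open>e p\<close> and
  \<open>e q\<close> as the vector \<open>e r\<close>.\<close>

lemma plane_point_coeff_pos:
  assumes r: "r \<in> {1, 2}" "v \<in> P r" and pq: "p \<in> I" "q \<in> I" "p \<noteq> q" "p \<noteq> r" "q \<noteq> r"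
    and v: "v = \<alpha> *\<^sub>R e p + \<beta> *\<^sub>R e q + \<kappa> *\<^sub>R e r"
  shows "\<kappa> > 0"
proof (rule ccontr)
  assume "\<not> \<kappa> > 0"
  have rI: "r \<in> I" using r by auto
  have er: "e r \<circ>\<^sub>L e r = 1" "e r \<circ>\<^sub>L v = 0" "v \<in> hyp3" using r plane_index[OF r(1)] by auto
  have vn: "e p \<circ>\<^sub>L v < 0" "e q \<circ>\<^sub>L v < 0" using plane_point_neg r pq by auto
  have n: "e p \<circ>\<^sub>L e q < 0" "e p \<circ>\<^sub>L e r < 0" "e q \<circ>\<^sub>L e r < 0" using neg pq rI by auto
  have s: "e p \<circ>\<^sub>L e p \<ge> 0" "e q \<circ>\<^sub>L e q \<ge> 0" using e_self pq by auto
  have "v \<circ>\<^sub>L v = \<alpha> * (e p \<circ>\<^sub>L v) + \<beta> * (e q \<circ>\<^sub>L v) + \<kappa> * (e r \<circ>\<^sub>L v)"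
    by (subst v) (simp add: lform_simps)
  then have 1: "\<alpha> * (e p \<circ>\<^sub>L v) + \<beta> * (e q \<circ>\<^sub>L v) = -1" using er by (simp add: hyp3_self)
  have "e r \<circ>\<^sub>L v = \<alpha> * (e p \<circ>\<^sub>L e r) + \<beta> * (e q \<circ>\<^sub>L e r) + \<kappa>"
    by (subst v) (simp add: lform_simps er lform_commute[of "e r" "e p"] lform_commute[of "e r" "e q"])
  then have 2: "\<alpha> * (e p \<circ>\<^sub>L e r) + \<beta> * (e q \<circ>\<^sub>L e r) \<ge> 0" using er \<open>\<not> \<kappa> > 0\<close> by simp
  have ep: "e p \<circ>\<^sub>L v = \<alpha> * (e p \<circ>\<^sub>L e p) + \<beta> * (e p \<circ>\<^sub>L e q) + \<kappa> * (e p \<circ>\<^sub>L e r)"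
    by (subst v) (simp add: lform_simps)
  have eq: "e q \<circ>\<^sub>L v = \<alpha> * (e p \<circ>\<^sub>L e q) + \<beta> * (e q \<circ>\<^sub>L e q) + \<kappa> * (e q \<circ>\<^sub>L e r)"
    by (subst v) (simp add: lform_simps lform_commute[of "e q" "e p"])
  have k: "\<kappa> * (e p \<circ>\<^sub>L e r) \<ge> 0" "\<kappa> * (e q \<circ>\<^sub>L e r) \<ge> 0"
    using \<open>\<not> \<kappa> > 0\<close> n by (auto intro: mult_nonpos_nonpos)
  have nonpos: "s \<le> 0"
    if "s * pr + t * qr \<ge> 0" "s * pp + t * pq + \<kappa> * pr < 0" "\<kappa> * pr \<ge> 0"
      "pp \<ge> 0" "pq < 0" "pr < 0" "qr < 0" for s t pp pq pr qr :: real
  proof (rule ccontr)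
    assume "\<not> s \<le> 0"
    then have "s * pr < 0" "s * pp \<ge> 0" using that by (simp_all add: mult_pos_neg)
    then have "t * qr > 0" using that(1) by linarith
    then have "t * pq > 0" using that(5,7) by (simp add: zero_less_mult_iff)
    then show False using that(2,3) \<open>s * pp \<ge> 0\<close> by linarith
  qed
  have "\<alpha> \<le> 0" using nonpos[OF 2, of "e p \<circ>\<^sub>L e p" "e p \<circ>\<^sub>L e q"] ep vn(1) k(1) s(1) n by simp
  moreover have "\<beta> \<le> 0"
    using nonpos[of \<beta> "e q \<circ>\<^sub>L e r" \<alpha> "e p \<circ>\<^sub>L e r" "e q \<circ>\<^sub>L e q" "e p \<circ>\<^sub>L e q"] 2 eq vn(2) k(2) s(2) n
    by (simp add: add.commute)
  ultimately have "\<alpha> * (e p \<circ>\<^sub>L v) \<ge> 0" "\<beta> * (e q \<circ>\<^sub>L v) \<ge> 0"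
    using vn by (simp_all add: mult_nonpos_nonpos)
  then show False using 1 by linarith
qed

end

section \<open>The tetrahedron\<close>

context tet_frame begin

text \<open>The case distinction in \<open>trunc_tet\<close> is linear dependence of the four
  \<open>e i\<close>: a normal to three of them is normal to the fourth.\<close>

lemma perp_hat_plane_iff:
  assumes "m \<noteq> 0" "\<And>j. j \<in> I - {1} \<Longrightarrow> m \<circ>\<^sub>L e j = 0"
  shows "planes_perp (hat_plane P x 1) (P 1) \<longleftrightarrow> m \<circ>\<^sub>L e 1 = 0"
proof -
  have hp: "hat_plane P x 1 = hplane m" using assms by (intro hat_plane_eq) auto
  have m: "m \<circ>\<^sub>L e 2 = 0" "m \<circ>\<^sub>L e 3 = 0" using assms(2)[of 2] assms(2)[of 3] by auto
  have "m \<circ>\<^sub>L m > 0" by (rule orthogonal_pair_pos(1)[OF _ _ _ assms(1) m]) auto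
  moreover have "e 1 \<circ>\<^sub>L e 1 > 0" using unit by simp
  ultimately have iff: "planes_perp (hplane m) (P 1) \<longleftrightarrow>
      hplane m \<inter> P 1 \<noteq> {} \<and> m \<circ>\<^sub>L e 1 = 0"
    using planes(1) by (intro planes_perp_iff) auto
  have "planes_perp (hplane m) (P 1)" if "m \<circ>\<^sub>L e 1 = 0"
    by (rule orthogonal_planes_perp[of m 1 3]) (use assms(1) \<open>m \<circ>\<^sub>L m > 0\<close> that m in auto)
  then show ?thesis unfolding hp using iff by blast
qed

text \<open>The hypothesis \<open>comb\<close> says dually that \<open>v\<close> is in the cone of
  the \<open>e i\<close>. The normal of each face, oriented to be positive at the opposite vector,
  is one of the functionals it quantifies over.\<close>

lemma trunc_tet_solid:
  assumes "\<not> planes_perp (hat_plane P x 1) (P 1)"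
    and v: "v \<in> hyp3" "e 1 \<circ>\<^sub>L v \<le> 0" "e 2 \<circ>\<^sub>L v \<le> 0"
    and comb: "\<forall>m. (\<forall>i\<in>I. m \<circ>\<^sub>L e i \<ge> 0) \<longrightarrow> m \<circ>\<^sub>L v \<ge> 0"
  shows "v \<in> trunc_tet P H x"
proof -
  have "v \<in> hat_half P x i" if i: "i \<in> I" for i
  proof -
    obtain m where m: "m \<noteq> 0" "\<And>j. j \<in> I - {i} \<Longrightarrow> m \<circ>\<^sub>L e j = 0" using hat_normal[OF i] by blast
    have "m \<circ>\<^sub>L e i \<noteq> 0"
    proof
      assume "m \<circ>\<^sub>L e i = 0"
      then have all: "m \<circ>\<^sub>L e j = 0" if "j \<in> I" for j using m(2)[of j] that by (cases "j = i") auto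
      then have "m \<circ>\<^sub>L e 1 = 0" by simp
      then show False using perp_hat_plane_iff[OF m(1)] all assms(1) by blast
    qed
    then have "\<exists>m'. (\<forall>j\<in>I - {i}. m' \<circ>\<^sub>L e j = 0) \<and> m' \<circ>\<^sub>L e i > 0"
    proof (cases "m \<circ>\<^sub>L e i > 0")
      case True then show ?thesis using m(2) by blast
    next
      case False
      then have "(- m) \<circ>\<^sub>L e i > 0" using \<open>m \<circ>\<^sub>L e i \<noteq> 0\<close> by (simp add: lform_simps)
      then show ?thesis using m(2) by (intro exI[of _ "- m"]) (simp add: lform_simps)
    qed
    then obtain m' where m': "\<And>j. j \<in> I - {i} \<Longrightarrow> m' \<circ>\<^sub>L e j = 0" "m' \<circ>\<^sub>L e i > 0" by blast
    have "m' \<circ>\<^sub>L e j \<ge> 0" if "j \<in> I" for j using m'(1)[of j] m'(2) that by (cases "j = i") auto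
    then have "m' \<circ>\<^sub>L v \<ge> 0" using comb by blast
    moreover have "hat_half P x i = hhalf m'" by (rule hat_half_eq[OF i m'])
    ultimately show ?thesis using v(1) by blast
  qed
  moreover have "v \<in> H 1" "v \<in> H 2" using v halves by auto
  ultimately show ?thesis using assms(1) unfolding trunc_tet_def by simp
qed

end

text \<open>The degenerate case: the four vectors are linearly dependent and every \<open>hat_plane\<close> is the plane
  orthogonal to \<open>m\<close>.\<close>

locale flat_frame = tet_frame +
  fixes m :: "real^4"
  assumes m_nonzero: "m \<noteq> 0" and m_orth: "\<And>i. i \<in> I \<Longrightarrow> m \<circ>\<^sub>L e i = 0"
begin

definition "U = orth m"
definition "Q = hplane m"
definition "F = (\<lambda>i. P i \<inter> Q)"

lemma subspace_U: "subspace U" unfolding U_def by (rule subspace_lform_orthogonal)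

lemma e_in_U: "i \<in> I \<Longrightarrow> e i \<in> U" using m_orth by (simp add: U_def)

lemma Q_eq: "Q = U \<inter> hyp3" by (auto simp: Q_def U_def)

lemma F_eq: "i \<in> {1, 2} \<Longrightarrow> F i = {v \<in> U \<inter> hyp3. e i \<circ>\<^sub>L v = 0}"
  using plane_index[of i] by (auto simp: F_def Q_eq)

lemma U_span:
  assumes "i \<in> I" "j \<in> I" "k \<in> I" "i \<noteq> j" "i \<noteq> k" "j \<noteq> k"
  shows "U = span {e i, e j, e k}"
  unfolding U_def using assms m_orth m_nonzero by (intro orthogonal_triple) auto

lemma edge_line_F: "p \<in> I \<Longrightarrow> q \<in> I \<Longrightarrow> p \<noteq> q \<Longrightarrow> edge_line F x p q = span {e p, e q} \<inter> hyp3"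
  by (rule edge_line_eq[OF subspace_U e_in_U F_eq])

lemma edge_line_F_commute: "p \<in> I \<Longrightarrow> q \<in> I \<Longrightarrow> p \<noteq> q \<Longrightarrow> edge_line F x p q = edge_line F x q p"
  by (simp add: edge_line_F insert_commute)

lemma F_nonempty: assumes "r \<in> {1, 2}" shows "F r \<noteq> {}"
proof -
  have r: "r \<in> I" "3 \<in> I" using assms by auto
  interpret plane_ideal U "F r" "e r" "e 3"
    by (rule plane_ideal[OF assms _ subspace_U e_in_U[OF r(1)] e_in_U[OF r(2)] F_eq[OF assms]]) simp
  show ?thesis using pfoot_mem by blast
qed

definition pos_half where "pos_half g = {v \<in> Q. g \<circ>\<^sub>L v \<ge> 0}"

text \<open>The functional \<open>g\<close> vanishes at \<open>e p\<close> and \<open>e q\<close>,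
  so on a line \<open>F r\<close> its sign is that at \<open>e r\<close> times a positive
  coefficient. Lines and ideal points thus obey the same criterion.\<close>

lemma object_in_pos_half:
  assumes pqr: "p \<in> I" "q \<in> I" "r \<in> I" "p \<noteq> q" "p \<noteq> r" "q \<noteq> r"
    and cut: "cut U g" and F': "edge_line F x p q = {v \<in> Q. g \<circ>\<^sub>L v = 0}"
    and g: "g \<circ>\<^sub>L e p = 0" "g \<circ>\<^sub>L e q = 0"
  shows "object_in_half Q F x (edge_line F x p q) (pos_half g) r \<longleftrightarrow> g \<circ>\<^sub>L e r \<ge> 0"
proof (cases "r \<in> {1, 2}")
  case True
  have iff: "g \<circ>\<^sub>L v \<ge> 0 \<longleftrightarrow> g \<circ>\<^sub>L e r \<ge> 0" if "v \<in> F r" for v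
  proof -
    have "v \<in> U" using that F_eq[OF True] by auto
    then obtain \<alpha> \<beta> \<kappa> where v: "v = \<alpha> *\<^sub>R e p + \<beta> *\<^sub>R e q + \<kappa> *\<^sub>R e r"
      using U_span[OF pqr] by (auto simp: span_triple)
    have "v \<in> P r" using that by (simp add: F_def)
    then have "\<kappa> > 0" using plane_point_coeff_pos[OF True _ pqr(1,2,4,5,6) v] by blast
    moreover have "g \<circ>\<^sub>L v = \<kappa> * (g \<circ>\<^sub>L e r)" using g by (simp add: v lform_simps)
    ultimately show ?thesis by (simp add: zero_le_mult_iff)
  qed
  have "F r \<subseteq> Q" by (simp add: F_def)
  then have "F r \<subseteq> pos_half g \<longleftrightarrow> g \<circ>\<^sub>L e r \<ge> 0"
    using iff F_nonempty[OF True] unfolding pos_half_def by blast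
  moreover have "r \<le> 2" using True by auto
  ultimately show ?thesis by (simp add: object_in_half_def)
next
  case False
  then have r: "r \<in> {3, 4}" using pqr unfolding I_eq by blast
  have eqs: "cut.Q U = Q" "cut.F U g = edge_line F x p q" "cut.K U g = pos_half g"
    by (auto simp: cut.Q_def[OF cut] Q_eq cut.F_def[OF cut] cut.K_def[OF cut] F' pos_half_def)
  have "half_ideal_boundary Q (edge_line F x p q) (pos_half g) = {x. pos_lightlike x \<and> x \<in> U \<and> g \<circ>\<^sub>L x \<ge> 0}"
    using cut.half_ideal_boundary_K[OF cut] unfolding eqs .
  then show ?thesis using r ideal_index[OF r] e_in_U[OF pqr(3)] by (auto simp: object_in_half_def)
qed

text \<open>A normal, within the plane, of the line joining objects \<open>p\<close> and
  \<open>q\<close>, packaged with the translation of halves and of positions of objects into signs,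
  so that later arguments handle signs only.\<close>

definition "separator p q g \<longleftrightarrow> g \<circ>\<^sub>L e p = 0 \<and> g \<circ>\<^sub>L e q = 0
  \<and> (\<forall>h. half_of Q (edge_line F x p q) h \<longleftrightarrow> h = pos_half g \<or> h = pos_half (- g))
  \<and> (\<forall>r\<in>I - {p, q}. g \<circ>\<^sub>L e r \<noteq> 0
      \<and> (object_in_half Q F x (edge_line F x p q) (pos_half g) r \<longleftrightarrow> g \<circ>\<^sub>L e r > 0)
      \<and> (object_in_half Q F x (edge_line F x p q) (pos_half (- g)) r \<longleftrightarrow> g \<circ>\<^sub>L e r < 0))"

lemma separator_exists:
  assumes pq: "p \<in> I" "q \<in> I" "p \<noteq> q"
  shows "\<exists>g. separator p q g"
proof -
  \<comment> \<open>Orthogonality to \<open>m\<close> places the normal \<open>g\<close> in the span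
    \<open>U\<close> of the plane.\<close>
  have "card {m, e p, e q} < 4" by (simp add: card_insert_if)
  then obtain g where g: "g \<noteq> 0" "g \<circ>\<^sub>L m = 0" "g \<circ>\<^sub>L e p = 0" "g \<circ>\<^sub>L e q = 0"
    using ex_orthogonal[of "{m, e p, e q}"] by auto
  have gU: "g \<in> U" using g(2) by (simp add: U_def lform_commute)
  have gg: "g \<circ>\<^sub>L g > 0" by (rule orthogonal_pair_pos(1)[OF pq g(1,3,4)])
  obtain z where z: "z \<in> hyp3" "z \<in> span {e p, e q}" "g \<circ>\<^sub>L z = 0"
    using orthogonal_pair_pos(2)[OF pq g(1,3,4)] by blast
  have spU: "span {e p, e q} \<subseteq> U" using e_in_U pq by (intro span_minimal subspace_U) auto
  have cut: "cut U g" using subspace_U gU gg z spU by unfold_locales auto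
  have ne: "g \<circ>\<^sub>L e r \<noteq> 0" if "r \<in> I - {p, q}" for r
  proof
    assume "g \<circ>\<^sub>L e r = 0"
    have sp: "g \<in> span {e p, e q, e r}" using gU U_span[of p q r] that pq by auto
    have "g \<circ>\<^sub>L g = 0"
      by (rule lform_orthogonal_span[OF _ sp]) (use g(3,4) \<open>g \<circ>\<^sub>L e r = 0\<close> in auto)
    then show False using gg by simp
  qed
  have line: "edge_line F x p q = {v \<in> Q. g \<circ>\<^sub>L v = 0}"
  proof -
    have "v \<in> span {e p, e q}" if v: "v \<in> U" "g \<circ>\<^sub>L v = 0" for v
    proof -
      have "\<not> I \<subseteq> {p, q}"
      proof
        assume "I \<subseteq> {p, q}"
        then have "card I \<le> card {p, q}" by (intro card_mono) simp_all
        then show False using pq(3) by simp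
      qed
      then obtain r where r: "r \<in> I - {p, q}" by blast
      then obtain \<alpha> \<beta> \<kappa> where abk: "v = \<alpha> *\<^sub>R e p + \<beta> *\<^sub>R e q + \<kappa> *\<^sub>R e r"
        using v(1) U_span[of p q r] pq by (auto simp: span_triple)
      then have "\<kappa> * (g \<circ>\<^sub>L e r) = 0" using v(2) g by (simp add: lform_simps)
      then have "\<kappa> = 0" using ne[OF r] by simp
      then show ?thesis using abk by (auto simp: span_pair)
    qed
    moreover have "g \<circ>\<^sub>L v = 0" if "v \<in> span {e p, e q}" for v
      by (rule lform_orthogonal_span[OF _ that]) (use g(3,4) in auto)
    ultimately show ?thesis unfolding edge_line_F[OF pq] Q_eq using spU by blast
  qed
  have cut': "cut U (- g)" by (rule cut.cut_minus[OF cut])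
  have line': "edge_line F x p q = {v \<in> Q. (- g) \<circ>\<^sub>L v = 0}" unfolding line by (simp add: lform_simps)
  have K: "cut.Q U = Q" "cut.F U g = edge_line F x p q" "cut.K U g = pos_half g"
    by (auto simp: cut.Q_def[OF cut] Q_eq cut.F_def[OF cut] cut.K_def[OF cut] line pos_half_def)
  have "{v \<in> Q. g \<circ>\<^sub>L v \<le> 0} = pos_half (- g)" by (auto simp: pos_half_def lform_simps)
  then have half: "half_of Q (edge_line F x p q) h \<longleftrightarrow> h = pos_half g \<or> h = pos_half (- g)" for h
    using cut.half_of_iff[OF cut, of h] unfolding K by simp
  have obj: "object_in_half Q F x (edge_line F x p q) (pos_half g) r \<longleftrightarrow> g \<circ>\<^sub>L e r > 0"
    "object_in_half Q F x (edge_line F x p q) (pos_half (- g)) r \<longleftrightarrow> g \<circ>\<^sub>L e r < 0" if r: "r \<in> I - {p, q}" for r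
    using object_in_pos_half[OF pq(1,2) _ pq(3) _ _ cut line g(3,4), of r]
      object_in_pos_half[OF pq(1,2) _ pq(3) _ _ cut' line', of r] ne[OF r] r g(3,4)
    by (auto simp: lform_simps less_le)
  show ?thesis unfolding separator_def
    by (intro exI[of _ g] conjI ballI allI) (fact g(3) g(4) half | erule ne obj)+
qed

lemma separator_object:
  assumes "separator p q g" "r \<in> I - {p, q}"
  shows "object_in_half Q F x (edge_line F x p q) (pos_half g) r \<longleftrightarrow> g \<circ>\<^sub>L e r > 0"
    "object_in_half Q F x (edge_line F x p q) (pos_half (- g)) r \<longleftrightarrow> g \<circ>\<^sub>L e r < 0"
  using assms unfolding separator_def by blast+

lemma separator_half:
  "separator p q g \<Longrightarrow> half_of Q (edge_line F x p q) h \<longleftrightarrow> h = pos_half g \<or> h = pos_half (- g)"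
  unfolding separator_def by blast

lemma separator_minus: "separator p q g \<Longrightarrow> separator p q (- g)"
  unfolding separator_def by (auto simp: lform_simps)

lemma side_half_commute:
  assumes "p \<in> I" "q \<in> I" "p \<noteq> q" shows "side_half Q F x p q = side_half Q F x q p"
proof -
  have "{1..4} - {p, q} = {1..4} - {q, p}" by auto
  then show ?thesis unfolding side_half_def edge_line_F_commute[OF assms] by simp
qed

text \<open>With the coefficient of \<open>e 1\<close> set to -1, its square forces a negative
  coefficient among the other three, and products with the other vectors forbid two of them. The
  index \<open>k\<close> names the object opposite to object 1 in cyclic order.\<close>

lemma relation:
  "\<exists>c k. (\<Sum>i\<in>I. c i *\<^sub>R e i) = 0 \<and> k \<in> {2, 3, 4} \<and>
    (\<forall>i\<in>I. c i \<noteq> (0::real) \<and> (c i < 0 \<longleftrightarrow> i = 1 \<or> i = k))"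
proof -
  have "e 1 \<in> span {e 2, e 3, e 4}" using e_in_U[of 1] U_span[of 2 3 4] by simp
  then obtain \<alpha> \<beta> \<gamma> where abc: "e 1 = \<alpha> *\<^sub>R e 2 + \<beta> *\<^sub>R e 3 + \<gamma> *\<^sub>R e 4" by (auto simp: span_triple)
  have n: "e 1 \<circ>\<^sub>L e 2 < 0" "e 1 \<circ>\<^sub>L e 3 < 0" "e 1 \<circ>\<^sub>L e 4 < 0" "e 2 \<circ>\<^sub>L e 3 < 0" "e 2 \<circ>\<^sub>L e 4 < 0" "e 3 \<circ>\<^sub>L e 4 < 0"
    by (rule neg; simp)+
  have 1: "1 = \<alpha> * (e 1 \<circ>\<^sub>L e 2) + \<beta> * (e 1 \<circ>\<^sub>L e 3) + \<gamma> * (e 1 \<circ>\<^sub>L e 4)"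
    using unit(1) by (subst (asm) (2) abc) (simp only: lform_simps)
  have 2: "e 1 \<circ>\<^sub>L e 2 = \<alpha> + \<beta> * (e 2 \<circ>\<^sub>L e 3) + \<gamma> * (e 2 \<circ>\<^sub>L e 4)"
    by (subst abc) (simp add: lform_simps unit lform_commute[of "e 3" "e 2"] lform_commute[of "e 4" "e 2"])
  have 3: "e 1 \<circ>\<^sub>L e 3 = \<alpha> * (e 2 \<circ>\<^sub>L e 3) + \<gamma> * (e 3 \<circ>\<^sub>L e 4)"
    by (subst abc) (simp add: lform_simps e_light lform_commute[of "e 4" "e 3"])
  have 4: "e 1 \<circ>\<^sub>L e 4 = \<alpha> * (e 2 \<circ>\<^sub>L e 4) + \<beta> * (e 3 \<circ>\<^sub>L e 4)"
    by (subst abc) (simp add: lform_simps e_light)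
  have nz: "\<alpha> \<noteq> 0" "\<beta> \<noteq> 0" "\<gamma> \<noteq> 0"
  proof -
    have False if "e 1 = s *\<^sub>R e j + t *\<^sub>R e k" "j \<in> {2, 3, 4}" "k \<in> {2, 3, 4}" "j \<noteq> k" for s t j k
    proof -
      have "(-1) *\<^sub>R e 1 + s *\<^sub>R e j + t *\<^sub>R e k = 0" unfolding that(1) by simp
      then show False using triple_independent[of 1 j k "-1" s t] that(2-4) by auto
    qed
    note * = this[of _ 3 _ 4] this[of _ 2 _ 4] this[of _ 2 _ 3]
    show "\<alpha> \<noteq> 0" "\<beta> \<noteq> 0" "\<gamma> \<noteq> 0" using abc *(1)[of \<beta> \<gamma>] *(2)[of \<alpha> \<gamma>] *(3)[of \<alpha> \<beta>] by auto
  qed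
  have some: "\<alpha> < 0 \<or> \<beta> < 0 \<or> \<gamma> < 0"
  proof (rule ccontr)
    assume "\<not> ?thesis"
    then have "\<alpha> * (e 1 \<circ>\<^sub>L e 2) \<le> 0" "\<beta> * (e 1 \<circ>\<^sub>L e 3) \<le> 0" "\<gamma> * (e 1 \<circ>\<^sub>L e 4) \<le> 0"
      using n by (simp_all add: mult_nonneg_nonpos)
    then show False using 1 by linarith
  qed
  have ab: "\<not> (\<alpha> < 0 \<and> \<beta> < 0)"
  proof
    assume "\<alpha> < 0 \<and> \<beta> < 0"
    then have "\<alpha> * (e 2 \<circ>\<^sub>L e 4) > 0" "\<beta> * (e 3 \<circ>\<^sub>L e 4) > 0" using n by (simp_all add: mult_neg_neg)
    then show False using 4 n by linarith
  qed
  have ac: "\<not> (\<alpha> < 0 \<and> \<gamma> < 0)"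
  proof
    assume "\<alpha> < 0 \<and> \<gamma> < 0"
    then have "\<alpha> * (e 2 \<circ>\<^sub>L e 3) > 0" "\<gamma> * (e 3 \<circ>\<^sub>L e 4) > 0" using n by (simp_all add: mult_neg_neg)
    then show False using 3 n by linarith
  qed
  \<comment> \<open>Here \<open>e 2\<close> is not light-like: its square contributes
    \<open>\<alpha>\<close>, which would have to be negative too, and \<open>ab\<close> excludes
    that.\<close>
  have bc: "\<not> (\<beta> < 0 \<and> \<gamma> < 0)"
  proof
    assume s: "\<beta> < 0 \<and> \<gamma> < 0"
    then have "\<beta> * (e 2 \<circ>\<^sub>L e 3) > 0" "\<gamma> * (e 2 \<circ>\<^sub>L e 4) > 0" using n by (simp_all add: mult_neg_neg)
    then have "\<alpha> < 0" using 2 n by linarith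
    then show False using s ab by simp
  qed
  define c where "c = (\<lambda>i::nat. if i = 1 then -1 else if i = 2 then \<alpha> else if i = 3 then \<beta> else \<gamma>)"
  have c: "c 1 = -1" "c 2 = \<alpha>" "c 3 = \<beta>" "c 4 = \<gamma>" by (simp_all add: c_def)
  have "(\<Sum>i\<in>I. c i *\<^sub>R e i) = c 1 *\<^sub>R e 1 + (c 2 *\<^sub>R e 2 + (c 3 *\<^sub>R e 3 + c 4 *\<^sub>R e 4))"
    unfolding I_eq by simp
  also have "\<dots> = 0" unfolding c by (subst abc) simp
  finally have sum: "(\<Sum>i\<in>I. c i *\<^sub>R e i) = 0" .
  define k :: nat where "k = (if \<alpha> < 0 then 2 else if \<beta> < 0 then 3 else 4)"
  show ?thesis
  proof (intro exI[of _ c] exI[of _ k] conjI ballI sum)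
    show "c i \<noteq> 0" if "i \<in> I" for i
      using that by (cases rule: I_cases) (simp_all only: c nz, simp_all)
    show "k \<in> {2, 3, 4}" by (simp add: k_def)
    show "c i < 0 \<longleftrightarrow> i = 1 \<or> i = k" if "i \<in> I" for i
      using that nz some ab ac bc by (cases rule: I_cases) (auto simp: c c_def k_def)
  qed
qed

lemma relation_cut:
  assumes sum: "(\<Sum>i\<in>I. c i *\<^sub>R e i) = 0" and set: "I = {p, q, r, s}" and d: "distinct [p, q, r, s]"
    and g: "g \<circ>\<^sub>L e p = 0" "g \<circ>\<^sub>L e q = 0"
  shows "c r * (g \<circ>\<^sub>L e r) = - (c s * (g \<circ>\<^sub>L e s))"
proof -
  have "c p *\<^sub>R e p + (c q *\<^sub>R e q + (c r *\<^sub>R e r + c s *\<^sub>R e s)) = 0"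
    using sum d unfolding set by simp
  then have "g \<circ>\<^sub>L (c p *\<^sub>R e p + (c q *\<^sub>R e q + (c r *\<^sub>R e r + c s *\<^sub>R e s))) = 0"
    by (simp add: lform_simps)
  then show ?thesis using g by (simp add: lform_simps)
qed

section \<open>Cyclic order of the four objects in the degenerate plane\<close>

context
  fixes c :: "nat \<Rightarrow> real" and k :: nat
  assumes sum: "(\<Sum>i\<in>I. c i *\<^sub>R e i) = 0" and k: "k \<in> {2, 3, 4}"
    and c: "\<forall>i\<in>I. c i \<noteq> 0 \<and> (c i < 0 \<longleftrightarrow> i = 1 \<or> i = k)"
begin

lemma c_nonzero: "i \<in> I \<Longrightarrow> c i \<noteq> 0" and c_sign: "i \<in> I \<Longrightarrow> c i < 0 \<longleftrightarrow> i = 1 \<or> i = k"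
  using c by blast+

text \<open>Applying \<open>g\<close> to the linear relation leaves only the terms of
  \<open>r\<close> and \<open>s\<close>, so the sign at \<open>e s\<close> follows from the sign at
  \<open>e r\<close> and the two coefficients.\<close>

lemma oriented_separator:
  assumes set: "I = {p, q, r, s}" and d: "distinct [p, q, r, s]"
  shows "\<exists>g. separator p q g \<and> g \<circ>\<^sub>L e r > 0 \<and> g \<circ>\<^sub>L e s \<noteq> 0 \<and>
    (g \<circ>\<^sub>L e s > 0 \<longleftrightarrow> (c r < 0) \<noteq> (c s < 0))"
proof -
  have pq: "p \<in> I" "q \<in> I" "p \<noteq> q" and rs: "r \<in> I - {p, q}" "s \<in> I - {p, q}"
    using set d by auto
  obtain g where "separator p q g" "g \<circ>\<^sub>L e r > 0"
  proof -
    obtain g where g: "separator p q g" using separator_exists[OF pq] by blast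
    then have "g \<circ>\<^sub>L e r \<noteq> 0" using rs(1) unfolding separator_def by blast
    then show ?thesis using that[of g] that[of "- g"] g separator_minus[OF g] by (auto simp: lform_simps neq_iff)
  qed
  then have g: "separator p q g" "g \<circ>\<^sub>L e r > 0" "g \<circ>\<^sub>L e s \<noteq> 0" "g \<circ>\<^sub>L e p = 0" "g \<circ>\<^sub>L e q = 0"
    using rs(2) unfolding separator_def by blast+
  have rel: "c r * (g \<circ>\<^sub>L e r) = - (c s * (g \<circ>\<^sub>L e s))" by (rule relation_cut[OF sum set d g(4,5)])
  have nz: "c r \<noteq> 0" "c s \<noteq> 0" using rs c_nonzero by blast+
  have "c r * (g \<circ>\<^sub>L e r) > 0 \<longleftrightarrow> c s * (g \<circ>\<^sub>L e s) < 0" using rel by simp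
  then have "g \<circ>\<^sub>L e s > 0 \<longleftrightarrow> (c r < 0) \<noteq> (c s < 0)"
    using nz g(2,3) by (auto simp: zero_less_mult_iff mult_less_0_iff neq_iff)
  then show ?thesis using g by blast
qed

lemma separates_iff:
  assumes set: "I = {p, q, r, s}" and d: "distinct [p, q, r, s]"
  shows "separates Q F x (edge_line F x p q) r s \<longleftrightarrow> (c r < 0 \<longleftrightarrow> c s < 0)"
proof -
  obtain g where g: "separator p q g" "g \<circ>\<^sub>L e r > 0" "g \<circ>\<^sub>L e s \<noteq> 0"
    "g \<circ>\<^sub>L e s > 0 \<longleftrightarrow> (c r < 0) \<noteq> (c s < 0)" using oriented_separator[OF set d] by blast
  have rs: "r \<in> I - {p, q}" "s \<in> I - {p, q}" using set d by auto
  note o = separator_object[OF g(1) rs(1)] separator_object[OF g(1) rs(2)]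
  have ne: "pos_half g \<noteq> pos_half (- g)" using o(1,2) g(2) by (metis less_asym)
  have "separates Q F x (edge_line F x p q) r s \<longleftrightarrow> g \<circ>\<^sub>L e s < 0"
    unfolding separates_def separator_half[OF g(1)] using o ne g(2) by (metis less_asym)
  then show ?thesis using g(3,4) by linarith
qed

lemma side_half_eq:
  assumes set: "I = {p, q, r, s}" and d: "distinct [p, q, r, s]" and opp: "(c r < 0) \<noteq> (c s < 0)"
  shows "\<exists>g. (\<forall>i\<in>I. g \<circ>\<^sub>L e i \<ge> 0) \<and> side_half Q F x p q = pos_half g"
proof -
  obtain g where g: "separator p q g" "g \<circ>\<^sub>L e r > 0" "g \<circ>\<^sub>L e s > 0"
    using oriented_separator[OF set d] opp by blast
  then have "g \<circ>\<^sub>L e p = 0" "g \<circ>\<^sub>L e q = 0" unfolding separator_def by blast+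
  then have nonneg: "\<forall>i\<in>I. g \<circ>\<^sub>L e i \<ge> 0" unfolding set using g by simp
  have rs: "r \<in> I - {p, q}" "s \<in> I - {p, q}" "I - {p, q} = {r, s}" using set d by auto
  note o = separator_object[OF g(1) rs(1)] separator_object[OF g(1) rs(2)]
  have "side_half Q F x p q = pos_half g"
    unfolding side_half_def rs(3) separator_half[OF g(1)] using g(2,3) o by (intro the_equality) auto
  then show ?thesis using nonneg by blast
qed

text \<open>A description without \<open>\<sigma>\<close>: the sides of the quadrilateral join
  objects whose coefficients have opposite signs, and its diagonals join the others.\<close>

definition "flat_tet = {v \<in> Q \<inter> H 1 \<inter> H 2. \<forall>p\<in>I. \<forall>q\<in>I. (c p < 0) \<noteq> (c q < 0) \<longrightarrow> v \<in> side_half Q F x p q}"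

text \<open>Exactly the two indices 1 and \<open>k\<close> are negative, so a pair of equal sign
  leaves a pair of the other sign.\<close>

lemma signs_balanced:
  assumes "I = {p, q, r, s}" "distinct [p, q, r, s]" "c q < 0 \<longleftrightarrow> c s < 0"
  shows "(c p < 0) \<noteq> (c q < 0)" "(c r < 0) \<noteq> (c s < 0)"
proof -
  have I: "p \<in> I" "q \<in> I" "r \<in> I" "s \<in> I" unfolding assms(1) by simp_all
  have "1 \<in> I" "k \<in> I" "k \<noteq> 1" using k by auto
  then have "1 \<in> {p, q, r, s}" "k \<in> {p, q, r, s}" "k \<noteq> 1" using assms(1) by (blast, blast, simp)
  then have "(p = 1 \<or> p = k) \<noteq> (q = 1 \<or> q = k) \<and> (r = 1 \<or> r = k) \<noteq> (s = 1 \<or> s = k)"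
    using assms(2) assms(3)[unfolded c_sign[OF I(2)] c_sign[OF I(4)]]
    by (elim insertE) simp_all
  then show "(c p < 0) \<noteq> (c q < 0)" "(c r < 0) \<noteq> (c s < 0)"
    unfolding c_sign[OF I(1)] c_sign[OF I(2)] c_sign[OF I(3)] c_sign[OF I(4)] by blast+
qed

lemma permutation_indices:
  assumes "\<sigma> permutes I"
  shows "I = {\<sigma> 1, \<sigma> 3, \<sigma> 2, \<sigma> 4}" "distinct [\<sigma> 1, \<sigma> 3, \<sigma> 2, \<sigma> 4]"
proof -
  have "\<sigma> ` I = I" using assms by (rule permutes_image)
  moreover have "\<sigma> ` I = {\<sigma> 1, \<sigma> 3, \<sigma> 2, \<sigma> 4}" unfolding I_eq by auto
  ultimately show "I = {\<sigma> 1, \<sigma> 3, \<sigma> 2, \<sigma> 4}" by simp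
  have "inj \<sigma>" using assms by (rule permutes_inj)
  then show "distinct [\<sigma> 1, \<sigma> 3, \<sigma> 2, \<sigma> 4]" by (simp add: inj_eq)
qed

text \<open>A separating diagonal puts equal signs at positions 2 and 4 of the renumbering, hence
  the other sign at 1 and 3. The four sides it lists are then all pairs of opposite sign, up to the
  order within a pair.\<close>

lemma is_flat_tet_unique:
  assumes "is_flat_tet Q F H x \<Delta>" shows "\<Delta> = flat_tet"
proof -
  obtain \<sigma> where \<sigma>: "\<sigma> permutes I" "separates Q F x (edge_line F x (\<sigma> 1) (\<sigma> 3)) (\<sigma> 2) (\<sigma> 4)"
    and D: "\<Delta> = Q \<inter> H 1 \<inter> H 2 \<inter> side_half Q F x (\<sigma> 1) (\<sigma> 2) \<inter> side_half Q F x (\<sigma> 2) (\<sigma> 3)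
          \<inter> side_half Q F x (\<sigma> 3) (\<sigma> 4) \<inter> side_half Q F x (\<sigma> 1) (\<sigma> 4)"
    using assms unfolding is_flat_tet_def by blast
  define p1 p2 p3 p4 where p: "p1 = \<sigma> 1" "p2 = \<sigma> 2" "p3 = \<sigma> 3" "p4 = \<sigma> 4"
  have set: "I = {p1, p3, p2, p4}" and d: "distinct [p1, p3, p2, p4]"
    using permutation_indices[OF \<sigma>(1)] unfolding p by blast+
  have same: "c p2 < 0 \<longleftrightarrow> c p4 < 0" using \<sigma>(2) separates_iff[OF set d] unfolding p by blast
  have set': "I = {p1, p2, p3, p4}" "distinct [p1, p2, p3, p4]" using set d by auto
  have opp: "(c p1 < 0) \<noteq> (c p2 < 0)" "(c p3 < 0) \<noteq> (c p4 < 0)" using signs_balanced[OF set' same] by auto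
  have mem: "p1 \<in> I" "p2 \<in> I" "p3 \<in> I" "p4 \<in> I" unfolding set by auto
  let ?S = "side_half Q F x"
  have comm: "?S p2 p1 = ?S p1 p2" "?S p3 p2 = ?S p2 p3" "?S p4 p3 = ?S p3 p4" "?S p4 p1 = ?S p1 p4"
    by (rule side_half_commute; use mem d in simp; fail)+
  have "v \<in> ?S p1 p2 \<and> v \<in> ?S p2 p3 \<and> v \<in> ?S p3 p4 \<and> v \<in> ?S p1 p4 \<longleftrightarrow>
      (\<forall>p\<in>I. \<forall>q\<in>I. (c p < 0) \<noteq> (c q < 0) \<longrightarrow> v \<in> ?S p q)" for v
  proof (cases "c p2 < 0")
    case True
    then have "c p2 < 0" "c p4 < 0" "\<not> c p1 < 0" "\<not> c p3 < 0" using opp same by blast+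
    then show ?thesis unfolding set by (simp add: comm) blast
  next
    case False
    then have "\<not> c p2 < 0" "\<not> c p4 < 0" "c p1 < 0" "c p3 < 0" using opp same by blast+
    then show ?thesis unfolding set by (simp add: comm) blast
  qed
  then show ?thesis unfolding D p[symmetric] flat_tet_def by blast
qed

lemma is_flat_tet_exists: "\<exists>\<Delta>. is_flat_tet Q F H x \<Delta>"
proof -
  \<comment> \<open>It suffices to keep 1 in place and move \<open>k\<close> to position 3, by the
    identity or one transposition; the positive coefficients then occupy positions 2 and 4.\<close>
  have ex: "\<exists>\<Delta>. is_flat_tet Q F H x \<Delta>" if "\<sigma> permutes I" "\<not> c (\<sigma> 2) < 0" "\<not> c (\<sigma> 4) < 0" for \<sigma>
  proof -
    have "separates Q F x (edge_line F x (\<sigma> 1) (\<sigma> 3)) (\<sigma> 2) (\<sigma> 4)"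
      using separates_iff[OF permutation_indices[OF that(1)]] that(2,3) by blast
    then show ?thesis unfolding is_flat_tet_def using that(1) by blast
  qed
  have k_cases: "k = 2 \<or> k = 3 \<or> k = 4" using k by blast
  have s: "\<not> c i < 0" if "i \<in> {2, 3, 4}" "i \<noteq> k" for i using c_sign[of i] that by auto
  show ?thesis
  proof (cases "k = 3")
    case True
    have "\<not> c (id 2) < 0" "\<not> c (id 4) < 0" using s[of 2] s[of 4] True by simp_all
    then show ?thesis using ex permutes_id by blast
  next
    case False
    show ?thesis
    proof (cases "k = 2")
      case True
      have "Transposition.transpose 2 3 permutes I" by (rule permutes_swap_id) auto
      moreover have "\<not> c (Transposition.transpose 2 3 2) < 0" "\<not> c (Transposition.transpose 2 3 4) < 0"
        using s[of 3] s[of 4] True by (simp_all add: Transposition.transpose_def)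
      ultimately show ?thesis by (rule ex)
    next
      case F2: False
      then have "k = 4" using False k_cases by blast
      have "Transposition.transpose 3 4 permutes I" by (rule permutes_swap_id) auto
      moreover have "\<not> c (Transposition.transpose 3 4 2) < 0" "\<not> c (Transposition.transpose 3 4 4) < 0"
        using s[of 3] s[of 2] \<open>k = 4\<close> by (simp_all add: Transposition.transpose_def)
      ultimately show ?thesis by (rule ex)
    qed
  qed
qed

lemma flat_tet_mem:
  assumes v: "v \<in> hyp3" "e 1 \<circ>\<^sub>L v \<le> 0" "e 2 \<circ>\<^sub>L v \<le> 0"
    and comb: "\<forall>m. (\<forall>i\<in>I. m \<circ>\<^sub>L e i \<ge> 0) \<longrightarrow> m \<circ>\<^sub>L v \<ge> 0"
  shows "v \<in> flat_tet"
proof -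
  \<comment> \<open>Both \<open>m\<close> and \<open>- m\<close> vanish on all \<open>e i\<close>,
    so the dual hypothesis places \<open>v\<close> in the plane itself.\<close>
  have "m \<circ>\<^sub>L v \<ge> 0" using comb m_orth by simp
  moreover have "(- m) \<circ>\<^sub>L v \<ge> 0" using comb[rule_format, of "- m"] m_orth by (simp add: lform_simps)
  ultimately have vQ: "v \<in> Q" using v(1) by (simp add: Q_def lform_simps)
  have "v \<in> side_half Q F x p q" if pq: "p \<in> I" "q \<in> I" "(c p < 0) \<noteq> (c q < 0)" for p q
  proof -
    have "p \<noteq> q" using pq by blast
    obtain j k l where jkl: "I - {p} = {j, k, l}" "distinct [j, k, l]" using others[OF pq(1)]
      by (metis distinct_length_2_or_more distinct_singleton)
    then have "q = j \<or> q = k \<or> q = l" using pq \<open>p \<noteq> q\<close> by blast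
    then obtain r s where "I - {p} = {q, r, s}" "distinct [q, r, s]" using jkl
      by (elim disjE) (metis distinct_length_2_or_more distinct_singleton insert_commute)+
    then have set: "I = {p, q, r, s}" "distinct [p, q, r, s]"
      using pq(1) insert_Diff[OF pq(1)] by auto
    have "(c r < 0) \<noteq> (c s < 0)"
    proof
      assume same: "c r < 0 \<longleftrightarrow> c s < 0"
      \<comment> \<open>In this order \<open>r\<close> and \<open>s\<close> are second and fourth,
        so equal signs there would give \<open>p\<close> and \<open>q\<close> equal signs as
        well.\<close>
      have "I = {p, r, q, s}" "distinct [p, r, q, s]" using set by (simp_all only: insert_commute) auto
      then show False using signs_balanced[of p r q s] same pq(3) by blast
    qed
    then obtain g where "\<forall>i\<in>I. g \<circ>\<^sub>L e i \<ge> 0" "side_half Q F x p q = pos_half g"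
      using side_half_eq[OF set] by blast
    moreover from this have "g \<circ>\<^sub>L v \<ge> 0" using comb by blast
    ultimately show ?thesis using vQ by (simp add: pos_half_def)
  qed
  then show ?thesis using vQ v halves by (simp add: flat_tet_def)
qed

end

lemma trunc_tet_flat:
  assumes v: "v \<in> hyp3" "e 1 \<circ>\<^sub>L v \<le> 0" "e 2 \<circ>\<^sub>L v \<le> 0"
    and comb: "\<forall>m. (\<forall>i\<in>I. m \<circ>\<^sub>L e i \<ge> 0) \<longrightarrow> m \<circ>\<^sub>L v \<ge> 0"
  shows "v \<in> trunc_tet P H x"
proof -
  have hp: "hat_plane P x 1 = Q" unfolding Q_def
    by (rule hat_plane_eq[OF _ m_nonzero m_orth]) auto
  have F: "(\<lambda>i. P i \<inter> hat_plane P x 1) = F" unfolding hp F_def ..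
  have perp: "planes_perp (hat_plane P x 1) (P 1)"
    by (subst perp_hat_plane_iff[OF m_nonzero m_orth]) (auto simp: m_orth)
  obtain c k where "(\<Sum>i\<in>I. c i *\<^sub>R e i) = 0 \<and> k \<in> {2, 3, 4} \<and>
    (\<forall>i\<in>I. c i \<noteq> 0 \<and> (c i < 0 \<longleftrightarrow> i = 1 \<or> i = k))" using relation by blast
  then have ck: "(\<Sum>i\<in>I. c i *\<^sub>R e i) = 0" "k \<in> {2, 3, 4}"
    "\<forall>i\<in>I. c i \<noteq> 0 \<and> (c i < 0 \<longleftrightarrow> i = 1 \<or> i = k)" by blast+
  obtain \<Delta> where D: "is_flat_tet Q F H x \<Delta>" using is_flat_tet_exists[OF ck] ..
  note uniq = is_flat_tet_unique[OF ck]
  have "(THE \<Delta>. is_flat_tet Q F H x \<Delta>) = flat_tet c"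
    by (rule the_equality) (use D uniq[OF D] in simp, erule uniq)
  then have "trunc_tet P H x = flat_tet c" unfolding trunc_tet_def F using perp hp by simp
  then show ?thesis using flat_tet_mem[OF ck v comb] by simp
qed

end

lemma (in tet_frame) trunc_tet_mem:
  assumes v: "v \<in> hyp3" "e 1 \<circ>\<^sub>L v \<le> 0" "e 2 \<circ>\<^sub>L v \<le> 0"
    and comb: "\<forall>m. (\<forall>i\<in>I. m \<circ>\<^sub>L e i \<ge> 0) \<longrightarrow> m \<circ>\<^sub>L v \<ge> 0"
  shows "v \<in> trunc_tet P H x"
proof (cases "planes_perp (hat_plane P x 1) (P 1)")
  case True
  have "1 \<in> I" by simp
  then obtain m where m: "m \<noteq> 0" "\<And>j. j \<in> I - {1} \<Longrightarrow> m \<circ>\<^sub>L e j = 0" using hat_normal by blast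
  then have "m \<circ>\<^sub>L e 1 = 0" using perp_hat_plane_iff True by blast
  then have orth: "m \<circ>\<^sub>L e j = 0" if "j \<in> I" for j using m(2)[of j] that by (cases "j = 1") auto
  interpret flat_frame P H x e m using m(1) orth by unfold_locales
  show ?thesis by (rule trunc_tet_flat[OF v comb])
next
  case False
  then show ?thesis by (rule trunc_tet_solid[OF _ v comb])
qed

section \<open>The transversal\<close>

text \<open>The images of 0 and 1 determine the map. This makes an arclength parametrization unique
  up to direction and shift.\<close>

lemma real_isometry:
  fixes \<phi> :: "real \<Rightarrow> real"
  assumes "\<And>s t. \<bar>\<phi> s - \<phi> t\<bar> = \<bar>s - t\<bar>"
  shows "\<exists>\<epsilon>. (\<epsilon> = 1 \<or> \<epsilon> = -1) \<and> (\<forall>s. \<phi> s = \<epsilon> * s + \<phi> 0)"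
proof -
  define \<epsilon> where "\<epsilon> = \<phi> 1 - \<phi> 0"
  have e: "\<epsilon> = 1 \<or> \<epsilon> = -1" using assms[of 1 0] by (auto simp: \<epsilon>_def abs_if split: if_splits)
  have "\<phi> s = \<epsilon> * s + \<phi> 0" for s
    using e
  proof
    assume "\<epsilon> = 1"
    moreover from this have "\<phi> s = s + \<phi> 0" using assms[of s 0] assms[of s 1] unfolding \<epsilon>_def by linarith
    ultimately show ?thesis by simp
  next
    assume "\<epsilon> = -1"
    moreover from this have "\<phi> s = - s + \<phi> 0" using assms[of s 0] assms[of s 1] unfolding \<epsilon>_def by linarith
    ultimately show ?thesis by simp
  qed
  then show ?thesis using e by blast
qed

section \<open>Unit-speed parametrization of the perpendicular\<close>

context plane_ideal begin

text \<open>This is \<open>cosh s\<close> times \<open>pfoot\<close> minus \<open>sinh s\<close>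
  times \<open>n\<close>, rewritten in \<open>y\<close> and \<open>n\<close>: it starts at
  \<open>pfoot\<close> for \<open>s = 0\<close>, moves away from the outward normal, and tends to
  the ideal point of \<open>y\<close>.\<close>

definition "line s = (cosh s / - (n \<circ>\<^sub>L y)) *\<^sub>R y + exp (- s) *\<^sub>R n"

lemma line_lform: "line s \<circ>\<^sub>L line t = - cosh (s - t)"
proof -
  have "line s \<circ>\<^sub>L line t = - (cosh s * exp (- t) + cosh t * exp (- s) - exp (- s) * exp (- t))"
    using ny by (simp add: line_def lform_simps y_facts n algebra_simps)
  also have "cosh s * exp (- t) + cosh t * exp (- s) - exp (- s) * exp (- t) = cosh (s - t)"
    unfolding cosh_def by (simp add: algebra_simps flip: exp_add)
  finally show ?thesis .
qed

lemma line_lform_n: "n \<circ>\<^sub>L line s = - sinh s"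
  using ny n by (simp add: line_def lform_simps cosh_def sinh_def field_simps)

lemma line_hyp3: "line s \<in> hyp3"
proof -
  have ll: "line s \<circ>\<^sub>L line s = -1" by (simp add: line_lform)
  have "line s \<circ>\<^sub>L y < 0" using ny by (simp add: line_def lform_simps y_facts mult_pos_neg)
  then show ?thesis using y_facts by (intro hyp3_futureI[OF ll, of y]) simp_all
qed

lemma range_line: "range line = span {n, y} \<inter> hyp3"
proof
  have "line s \<in> span {n, y}" for s
    unfolding line_def by (intro span_add span_scale span_base) auto
  then show "range line \<subseteq> span {n, y} \<inter> hyp3" using line_hyp3 by auto
  show "span {n, y} \<inter> hyp3 \<subseteq> range line"
  proof
    fix v assume v: "v \<in> span {n, y} \<inter> hyp3"
    then obtain \<alpha> \<beta> where ab: "v = \<alpha> *\<^sub>R n + \<beta> *\<^sub>R y" by (auto simp: span_pair)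
    have pos: "\<alpha> > 0 \<and> \<beta> > 0"
      by (rule light_pair_coeffs[of \<alpha> n \<beta> y]) (use v ab n y ny in auto)
    have "v \<circ>\<^sub>L v = -1" using v by (simp add: hyp3_self)
    then have "\<alpha> * \<alpha> + 2 * \<alpha> * \<beta> * (n \<circ>\<^sub>L y) = -1"
      by (simp add: ab lform_simps n y_facts algebra_simps)
    then have "\<beta> = (\<alpha> + inverse \<alpha>) / 2 / - (n \<circ>\<^sub>L y)" using pos ny by (simp add: field_simps)
    moreover have "cosh (- ln \<alpha>) = (\<alpha> + inverse \<alpha>) / 2" using pos by (simp add: cosh_ln_real)
    ultimately have b: "cosh (- ln \<alpha>) / - (n \<circ>\<^sub>L y) = \<beta>" by (simp only:)
    \<comment> \<open>The coefficient of \<open>n\<close> in \<open>line s\<close> is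
      \<open>exp (- s)\<close>, whence the parameter \<open>- ln \<alpha>\<close>.\<close>
    have "v = line (- ln \<alpha>)" unfolding line_def b ab using pos by simp
    then show "v \<in> range line" by blast
  qed
qed

lemma line_in_ray: assumes "s \<ge> 0" shows "line s \<in> hsegment pfoot y"
proof -
  have "cosh s = exp (- s) + sinh s" by (simp add: cosh_def sinh_def field_simps)
  then have "line s = exp (- s) *\<^sub>R pfoot + (sinh s / - (n \<circ>\<^sub>L y)) *\<^sub>R y"
    by (simp add: line_def pfoot_def add_divide_distrib algebra_simps flip: scaleR_add_left)
  moreover have "sinh s / - (n \<circ>\<^sub>L y) \<ge> 0" using assms ny by (intro divide_nonneg_pos) auto
  ultimately show ?thesis unfolding hsegment_def using line_hyp3[of s] by fastforce
qed

lemma ray_subset_line: "hsegment pfoot y \<subseteq> range line"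
proof -
  have "a *\<^sub>R pfoot + b *\<^sub>R y \<in> span {n, y}" for a b
    by (intro span_add span_scale pfoot_mem) (simp add: span_base)
  then show ?thesis unfolding range_line hsegment_def by auto
qed

lemma hdist_line: "hdist (line s) (line t) = \<bar>s - t\<bar>"
proof -
  have "- (line s \<circ>\<^sub>L line t) = cosh \<bar>s - t\<bar>" by (simp add: line_lform)
  then show ?thesis unfolding hdist_def by (simp only: arcosh_cosh_real abs_ge_zero)
qed

lemma arclength_param_line:
  assumes "arclength_param \<gamma> (span {n, y} \<inter> hyp3)"
  shows "\<exists>\<epsilon> s1. (\<epsilon> = 1 \<or> \<epsilon> = -1) \<and> (\<forall>s. \<gamma> s = line (\<epsilon> * s + s1))"
proof -
  have r: "range \<gamma> = range line" and d: "\<And>s t. hdist (\<gamma> s) (\<gamma> t) = \<bar>s - t\<bar>"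
    using assms unfolding arclength_param_def range_line by blast+
  have "\<forall>s. \<exists>u. \<gamma> s = line u" using r by (metis rangeE rangeI)
  then obtain \<phi> where \<phi>: "\<And>s. \<gamma> s = line (\<phi> s)" by metis
  have "\<bar>\<phi> s - \<phi> t\<bar> = \<bar>s - t\<bar>" for s t using d[of s t] by (simp add: \<phi> hdist_line)
  then show ?thesis using real_isometry[of \<phi>] \<phi> by metis
qed

end

section \<open>Minimizing a sum of four exponentials\<close>

definition dist_fun :: "real \<Rightarrow> real \<Rightarrow> real \<Rightarrow> real \<Rightarrow> real \<Rightarrow> real \<Rightarrow> real" where
  "dist_fun A B C E s t = A * exp (s + t) + B * exp (s - t) + C * exp (t - s) + E * exp (- s - t)"

text \<open>Balance of the two terms is the equality case of the AM-GM inequality and also the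
  vanishing of the derivative in \<open>\<sigma>\<close>, which links minimum and critical
  point.\<close>

lemma exp_balance:
  fixes A E \<sigma> :: real assumes "A > 0" "E > 0"
  shows "A * exp \<sigma> = E * exp (- \<sigma>) \<longleftrightarrow> \<sigma> = ln (E / A) / 2"
proof -
  have "A * exp \<sigma> = E * exp (- \<sigma>) \<longleftrightarrow> A * (exp \<sigma> * exp \<sigma>) = E"
    by (simp add: exp_minus field_simps)
  also have "\<dots> \<longleftrightarrow> exp (2 * \<sigma>) = E / A"
    using assms by (simp add: field_simps flip: exp_add)
  also have "\<dots> \<longleftrightarrow> exp (2 * \<sigma>) = exp (ln (E / A))" using assms by simp
  also have "\<dots> \<longleftrightarrow> \<sigma> = ln (E / A) / 2" unfolding exp_inj_iff by auto
  finally show ?thesis .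
qed

lemma exp_sum_ge:
  fixes A E \<sigma> :: real assumes "A > 0" "E > 0"
  shows "A * exp \<sigma> + E * exp (- \<sigma>) \<ge> 2 * sqrt (A * E)"
    and "A * exp \<sigma> = E * exp (- \<sigma>) \<Longrightarrow> A * exp \<sigma> + E * exp (- \<sigma>) = 2 * sqrt (A * E)"
proof -
  have prod: "(A * exp \<sigma>) * (E * exp (- \<sigma>)) = A * E" by (simp add: exp_minus field_simps)
  show "A * exp \<sigma> + E * exp (- \<sigma>) \<ge> 2 * sqrt (A * E)"
    using arith_geo_mean_sqrt[of "A * exp \<sigma>" "E * exp (- \<sigma>)"] assms unfolding prod by simp
  assume eq: "A * exp \<sigma> = E * exp (- \<sigma>)"
  have "(A * exp \<sigma>)\<^sup>2 = A * E" using prod unfolding eq[symmetric] power2_eq_square .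
  then have "sqrt (A * E) = A * exp \<sigma>" using assms by (intro real_sqrt_unique) simp_all
  then show "A * exp \<sigma> + E * exp (- \<sigma>) = 2 * sqrt (A * E)" using eq by simp
qed

locale dist_coeffs =
  fixes A B C E :: real
  assumes pos: "A > 0" "B > 0" "C > 0" "E > 0"
begin

text \<open>Together with \<open>tmin\<close> the solution of \<open>s + t = ln (E / A) / 2\<close>
  and \<open>s - t = ln (C / B) / 2\<close>.\<close>

definition "smin = (ln (E / A) + ln (C / B)) / 4"
definition "tmin = (ln (E / A) - ln (C / B)) / 4"

lemma balanced_iff:
  "A * exp (s + t) = E * exp (- (s + t)) \<and> B * exp (s - t) = C * exp (- (s - t)) \<longleftrightarrow> s = smin \<and> t = tmin"
  unfolding exp_balance[OF pos(1,4)] exp_balance[OF pos(2,3)] smin_def tmin_def by auto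

lemma dist_fun_ge: "dist_fun A B C E s t \<ge> 2 * sqrt (A * E) + 2 * sqrt (B * C)"
  using exp_sum_ge(1)[OF pos(1,4), of "s + t"] exp_sum_ge(1)[OF pos(2,3), of "s - t"]
  by (simp add: dist_fun_def)

lemma dist_fun_min: "dist_fun A B C E smin tmin = 2 * sqrt (A * E) + 2 * sqrt (B * C)"
  using exp_sum_ge(2)[OF pos(1,4), of "smin + tmin"] exp_sum_ge(2)[OF pos(2,3), of "smin - tmin"]
    balanced_iff[of smin tmin] by (simp add: dist_fun_def)

text \<open>The signs and shifts cover all arclength parametrizations of the two geodesics.\<close>

lemma critical_point_iff:
  assumes e: "\<epsilon> = 1 \<or> \<epsilon> = -1" "\<epsilon>' = 1 \<or> \<epsilon>' = (-1::real)"
    and f: "\<And>s t. f (s, t) = dist_fun A B C E (\<epsilon> * s + s1) (\<epsilon>' * t + t1)"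
  shows "critical_point f (s, t) \<longleftrightarrow> \<epsilon> * s + s1 = smin \<and> \<epsilon>' * t + t1 = tmin"
proof -
  define S T where "S = \<epsilon> * s + s1" and "T = \<epsilon>' * t + t1"
  define p q p' q' where "p = A * exp (S + T)" and "q = B * exp (S - T)"
    and "p' = E * exp (- (S + T))" and "q' = C * exp (- (S - T))"
  note pq = p_def q_def p'_def q'_def
  have f': "f = (\<lambda>z. dist_fun A B C E (\<epsilon> * fst z + s1) (\<epsilon>' * snd z + t1))"
    using f by (auto simp: fun_eq_iff)
  define D where "D = (\<lambda>h::real \<times> real. (p + q - q' - p') * (\<epsilon> * fst h) + (p - q + q' - p') * (\<epsilon>' * snd h))"
  have der: "(f has_derivative D) (at (s, t))"
  proof -
    have lin: "((\<lambda>z. \<mu> * (\<epsilon> * fst z + s1) + \<nu> * (\<epsilon>' * snd z + t1)) has_derivative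
        (\<lambda>h. \<mu> * (\<epsilon> * fst h) + \<nu> * (\<epsilon>' * snd h))) (at (s, t))" for \<mu> \<nu> :: real
      by (auto intro!: derivative_eq_intros)
    have ex: "((\<lambda>z. K * exp (\<mu> * (\<epsilon> * fst z + s1) + \<nu> * (\<epsilon>' * snd z + t1))) has_derivative
        (\<lambda>h. K * ((\<mu> * (\<epsilon> * fst h) + \<nu> * (\<epsilon>' * snd h)) * exp (\<mu> * S + \<nu> * T)))) (at (s, t))" for K \<mu> \<nu> :: real
      using has_derivative_mult_right[OF has_derivative_exp[OF lin[of \<mu> \<nu>]], of K]
      by (simp add: S_def T_def mult.commute)
    note sum = has_derivative_add[OF has_derivative_add[OF has_derivative_add[OF
      ex[of A 1 1] ex[of B 1 "-1"]] ex[of C "-1" 1]] ex[of E "-1" "-1"]]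
    show ?thesis unfolding f' dist_fun_def
      by (rule has_derivative_eq_rhs, rule has_derivative_transform[OF _ _ sum])
        (simp_all add: D_def pq fun_eq_iff algebra_simps)
  qed
  have "critical_point f (s, t) \<longleftrightarrow> D = (\<lambda>_. 0)"
    unfolding critical_point_def using der has_derivative_unique by blast
  also have "\<dots> \<longleftrightarrow> p + q - q' - p' = 0 \<and> p - q + q' - p' = 0"
  proof
    assume "D = (\<lambda>_. 0)"
    then have "D (1, 0) = 0" "D (0, 1) = 0" by simp_all
    then show "p + q - q' - p' = 0 \<and> p - q + q' - p' = 0" using e by (auto simp: D_def)
  qed (auto simp: D_def)
  \<comment> \<open>Sum and difference of the two partial derivatives decouple \<open>S + T\<close>
    from \<open>S - T\<close>.\<close>
  also have "\<dots> \<longleftrightarrow> p = p' \<and> q = q'" by auto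
  also have "\<dots> \<longleftrightarrow> S = smin \<and> T = tmin" unfolding pq by (rule balanced_iff)
  finally show ?thesis unfolding S_def T_def .
qed

end

section \<open>The explicit formula and its monotonicity\<close>

abbreviation diag_length where
  "diag_length P x \<equiv> transversal_length (edge P x 1 3) (edge P x 2 4)"

definition transversal_cosh :: "real \<Rightarrow> real \<Rightarrow> real \<Rightarrow> real \<Rightarrow> real \<Rightarrow> real \<Rightarrow> real" where
  "transversal_cosh X Y a b c d =
    sqrt (1 / (X * Y) * (d / Y + c) * (d / X + b)) +
    sqrt (d / (X * Y) * (d / (X * Y) + c / X + b / Y + 2 * a))"

text \<open>The first root increases weakly and the second strictly: \<open>a\<close>,
  \<open>b\<close>, \<open>c\<close> and \<open>d\<close> all occur in its sum, whose factor
  \<open>d / (X * Y)\<close> is positive. One lemma covers all four parameters.\<close>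

lemma transversal_cosh_mono:
  assumes pos: "X > 0" "Y > 0" "a > 0" "b > 0" "c > 0" "d > 0"
    and le: "a \<le> a'" "b \<le> b'" "c \<le> c'" "d \<le> d'" and ne: "a < a' \<or> b < b' \<or> c < c' \<or> d < d'"
  shows "transversal_cosh X Y a b c d < transversal_cosh X Y a' b' c' d'"
proof -
  have XY: "X * Y > 0" using pos by simp
  have l: "d / X \<le> d' / X" "d / Y \<le> d' / Y" "d / (X * Y) \<le> d' / (X * Y)" "c / X \<le> c' / X" "b / Y \<le> b' / Y"
    using le pos XY by (simp_all add: divide_right_mono)
  have p: "d / (X * Y) > 0" "d / X > 0" "d / Y > 0" "c / X > 0" "b / Y > 0" using pos XY by simp_all
  have "(d / Y + c) * (d / X + b) \<le> (d' / Y + c') * (d' / X + b')"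
    using l le p pos by (intro mult_mono) auto
  then have "1 / (X * Y) * ((d / Y + c) * (d / X + b)) \<le> 1 / (X * Y) * ((d' / Y + c') * (d' / X + b'))"
    using XY by (intro mult_left_mono) auto
  then have 1: "1 / (X * Y) * (d / Y + c) * (d / X + b) \<le> 1 / (X * Y) * (d' / Y + c') * (d' / X + b')"
    by (simp only: mult.assoc)
  have "d / (X * Y) < d' / (X * Y) \<or> c / X < c' / X \<or> b / Y < b' / Y \<or> a < a'"
    using ne pos XY by (auto simp: divide_strict_right_mono)
  then have "d / (X * Y) + c / X + b / Y + 2 * a < d' / (X * Y) + c' / X + b' / Y + 2 * a'"
    using l le by linarith
  then have 2: "d / (X * Y) * (d / (X * Y) + c / X + b / Y + 2 * a)
      < d' / (X * Y) * (d' / (X * Y) + c' / X + b' / Y + 2 * a')"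
    using l(3) p pos(3) by (intro mult_le_less_imp_less) auto
  show ?thesis unfolding transversal_cosh_def
    using 1 2 by (intro add_le_less_mono real_sqrt_less_mono real_sqrt_le_mono)
qed

section \<open>Distance between the two edge lines in terms of the frame\<close>

context tet_frame begin

definition "X = - (e 1 \<circ>\<^sub>L e 3)"
definition "Y = - (e 2 \<circ>\<^sub>L e 4)"
definition "a = - (e 1 \<circ>\<^sub>L e 2)"
definition "b = - (e 1 \<circ>\<^sub>L e 4)"
definition "c = - (e 2 \<circ>\<^sub>L e 3)"
text \<open>The factor 1/2 is that of \<open>sdist_horoballs_eq\<close>.\<close>

definition "d = - (e 3 \<circ>\<^sub>L e 4) / 2"

lemma params_pos: "X > 0" "Y > 0" "a > 1" "b > 0" "c > 0" "d > 0"
proof -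
  have "e 1 \<circ>\<^sub>L e 3 < 0" "e 2 \<circ>\<^sub>L e 4 < 0" "e 1 \<circ>\<^sub>L e 4 < 0" "e 2 \<circ>\<^sub>L e 3 < 0" "e 3 \<circ>\<^sub>L e 4 < 0"
    by (rule neg; simp)+
  then show "X > 0" "Y > 0" "a > 1" "b > 0" "c > 0" "d > 0"
    using ultra unfolding X_def Y_def a_def b_def c_def d_def by linarith+
qed

lemma params: "tet_params P x = (X, Y, a, b, c, d)"
proof -
  have pl: "exp (sdist_plane_horoball (P i) (x j)) = - (e i \<circ>\<^sub>L e j)" if "i \<in> {1, 2}" "j \<in> {3, 4}" for i j
  proof -
    have n: "e i \<circ>\<^sub>L e j < 0" using that by (intro neg) auto
    have "sdist_plane_horoball (P i) (e j) = ln (- (e i \<circ>\<^sub>L e j))"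
      using plane_index[OF that(1)] ideal_index[OF that(2)] n by (intro sdist_plane_horoball_eq) auto
    then show ?thesis using ideal_index[OF that(2)] n by simp
  qed
  have "e 3 \<circ>\<^sub>L e 4 < 0" by (rule neg) simp_all
  then have "sdist_horoballs (x 3) (x 4) = ln d"
    unfolding ideal d_def using lightlike by (intro sdist_horoballs_eq)
  then have h: "exp (sdist_horoballs (x 3) (x 4)) = d" using params_pos by simp
  have "hset_dist (P 1) (P 2) = arcosh a"
    unfolding a_def by (rule plane_pair.hset_dist_eq[OF plane_pair_UNIV])
  then have "cosh (hset_dist (P 1) (P 2)) = a" using params_pos by simp
  then show ?thesis unfolding tet_params_def h X_def Y_def b_def c_def by (simp add: pl)
qed

sublocale l13: plane_ideal UNIV "P 1" "e 1" "e 3" by (rule plane_ideal_UNIV) simp_all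
sublocale l24: plane_ideal UNIV "P 2" "e 2" "e 4" by (rule plane_ideal_UNIV) simp_all

text \<open>Expanding the product of the two lines, with each \<open>cosh\<close> split into
  exponentials, gives \<open>A\<close> to \<open>E\<close>. The product of the light-like vectors
  contributes \<open>A\<close> to all four exponentials, a mixed product to two of them, and the
  product of the normals only to \<open>exp (- s - t)\<close>. This explains why \<open>A\<close> is
  the smallest and \<open>E\<close> the largest coefficient.\<close>

definition "A = d / (2 * X * Y)"
definition "B = A + c / (2 * X)"
definition "C = A + b / (2 * Y)"
definition "E = A + c / (2 * X) + b / (2 * Y) + a"

lemma coeffs_pos: "A > 0" "c / (2 * X) > 0" "b / (2 * Y) > 0"
  unfolding A_def using params_pos by simp_all

sublocale dc: dist_coeffs A B C E
  using coeffs_pos params_pos unfolding B_def C_def E_def by unfold_locales linarith+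

lemma line_lform_line: "- (l13.line s \<circ>\<^sub>L l24.line t) = dist_fun A B C E s t"
proof -
  have e: "e 1 \<circ>\<^sub>L e 3 = - X" "e 2 \<circ>\<^sub>L e 4 = - Y" "e 1 \<circ>\<^sub>L e 2 = - a" "e 1 \<circ>\<^sub>L e 4 = - b"
    "e 3 \<circ>\<^sub>L e 2 = - c" "e 3 \<circ>\<^sub>L e 4 = - (2 * d)"
    by (simp_all add: X_def Y_def a_def b_def c_def d_def lform_commute)
  have "- (l13.line s \<circ>\<^sub>L l24.line t) = (cosh s / X) * (cosh t / Y) * (2 * d) + (cosh s / X) * exp (- t) * c
     + exp (- s) * (cosh t / Y) * b + exp (- s) * exp (- t) * a"
    unfolding l13.line_def l24.line_def lform_add_left lform_add_right lform_scale_left lform_scale_right e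
    by (simp add: algebra_simps)
  also have "\<dots> = dist_fun A B C E s t"
    using params_pos unfolding dist_fun_def B_def C_def E_def A_def cosh_def exp_diff exp_add exp_minus
    by (simp add: field_simps)
  finally show ?thesis .
qed

lemma min_value: "2 * sqrt (A * E) + 2 * sqrt (B * C) = transversal_cosh X Y a b c d"
proof -
  have s: "2 * sqrt u = sqrt (4 * u)" for u by (simp add: real_sqrt_mult)
  have "4 * (A * E) = d / (X * Y) * (d / (X * Y) + c / X + b / Y + 2 * a)"
    using params_pos by (simp add: A_def E_def field_simps)
  moreover have "4 * (B * C) = 1 / (X * Y) * (d / Y + c) * (d / X + b)"
    using params_pos by (simp add: A_def B_def C_def field_simps)
  ultimately show ?thesis unfolding s transversal_cosh_def by simp
qed

lemma min_params_nonneg: "dc.smin \<ge> 0" "dc.tmin \<ge> 0"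
proof -
  \<comment> \<open>Four times \<open>smin\<close> is \<open>(ln E - ln B) + (ln C - ln A)\<close>,
    and four times \<open>tmin\<close> is \<open>(ln E - ln C) + (ln B - ln A)\<close>.\<close>
  have "E > B" "C > A" "E > C" "B > A" using coeffs_pos params_pos unfolding B_def C_def E_def by linarith+
  then have "ln E > ln B" "ln C > ln A" "ln E > ln C" "ln B > ln A" using dc.pos by simp_all
  moreover have "(w - x + (y - z)) / 4 \<ge> 0 \<and> (w - x - (y - z)) / 4 \<ge> 0"
    if "z < w" "x < y" "y < w" "x < z" for w x y z :: real
    using that by simp
  ultimately have "(ln E - ln A + (ln C - ln B)) / 4 \<ge> 0 \<and> (ln E - ln A - (ln C - ln B)) / 4 \<ge> 0"
    by blast
  moreover have "ln (E / A) = ln E - ln A" "ln (C / B) = ln C - ln B"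
    using dc.pos by (simp_all add: ln_div)
  ultimately show "dc.smin \<ge> 0" "dc.tmin \<ge> 0" unfolding dc.smin_def dc.tmin_def by (simp_all only:)
qed

text \<open>The coefficients of \<open>line s\<close> are positive, which settles the faces and the
  other plane. The condition \<open>s \<ge> 0\<close> enters at the plane \<open>P i\<close>, where
  the product with \<open>e i\<close> is \<open>- sinh s\<close>.\<close>

lemma edge_point_in_trunc_tet:
  assumes "i \<in> {1, 2}" "j \<in> {3, 4}" "s \<ge> 0"
  shows "plane_ideal.line (e i) (e j) s \<in> trunc_tet P H x"
proof -
  interpret l: plane_ideal UNIV "P i" "e i" "e j" by (rule plane_ideal_UNIV[OF assms(1,2)])
  have ij: "i \<in> I" "j \<in> I" using assms by auto
  have k: "cosh s / - (e i \<circ>\<^sub>L e j) > 0" using l.ny by (intro divide_pos_pos) simp_all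
  have "e r \<circ>\<^sub>L l.line s \<le> 0" if r: "r \<in> {1, 2}" for r
  proof (cases "r = i")
    case True
    then show ?thesis using l.line_lform_n assms(3) by simp
  next
    case False
    then have "e r \<circ>\<^sub>L e j < 0" "e r \<circ>\<^sub>L e i < 0" using r ij assms(2) by (auto intro!: neg)
    then show ?thesis unfolding l.line_def lform_add_right lform_scale_right
      using k by (intro add_nonpos_nonpos mult_nonneg_nonpos) simp_all
  qed
  moreover have "\<forall>m. (\<forall>i\<in>I. m \<circ>\<^sub>L e i \<ge> 0) \<longrightarrow> m \<circ>\<^sub>L l.line s \<ge> 0"
    unfolding l.line_def lform_add_right lform_scale_right
    using ij k by (intro allI impI add_nonneg_nonneg mult_nonneg_nonneg) simp_all
  ultimately show ?thesis using l.line_hyp3 by (intro trunc_tet_mem) simp_all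
qed

text \<open>The minimum over the complete geodesics is attained at points of the edges, so it is
  also the minimum over the edges.\<close>

lemma transversal_length_eq:
  "diag_length P x = hdist (l13.line dc.smin) (l24.line dc.tmin)"
proof -
  let ?p = "l13.line dc.smin" and ?q = "l24.line dc.tmin"
  have e: "edge P x 1 3 = hsegment l13.pfoot (e 3)" "edge P x 2 4 = hsegment l24.pfoot (e 4)"
    unfolding l13.pfoot_def l24.pfoot_def by (rule edge_ideal; simp)+
  have mem: "?p \<in> edge P x 1 3" "?q \<in> edge P x 2 4"
    unfolding e using l13.line_in_ray l24.line_in_ray min_params_nonneg by blast+
  have min: "hdist ?p ?q \<le> hdist p' q'" if pq: "p' \<in> edge P x 1 3" "q' \<in> edge P x 2 4" for p' q'
  proof -
    obtain s t where st: "p' = l13.line s" "q' = l24.line t"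
      using pq l13.ray_subset_line l24.ray_subset_line unfolding e by blast
    have "- (?p \<circ>\<^sub>L ?q) \<le> - (p' \<circ>\<^sub>L q')"
      unfolding st line_lform_line using dc.dist_fun_ge[of s t] dc.dist_fun_min by simp
    then show ?thesis using hdist_le_iff l13.line_hyp3 l24.line_hyp3 unfolding st by blast
  qed
  show ?thesis unfolding transversal_length_def
  proof (rule the_equality)
    show "\<exists>p\<in>edge P x 1 3. \<exists>q\<in>edge P x 2 4. hdist ?p ?q = hdist p q \<and>
        (\<forall>p'\<in>edge P x 1 3. \<forall>q'\<in>edge P x 2 4. hdist p q \<le> hdist p' q')"
      using mem min by blast
    fix l assume "\<exists>p\<in>edge P x 1 3. \<exists>q\<in>edge P x 2 4. l = hdist p q \<and>
        (\<forall>p'\<in>edge P x 1 3. \<forall>q'\<in>edge P x 2 4. hdist p q \<le> hdist p' q')"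
    then obtain p q where pq: "p \<in> edge P x 1 3" "q \<in> edge P x 2 4" "l = hdist p q" "hdist p q \<le> hdist ?p ?q"
      using mem by blast
    then show "l = hdist ?p ?q" using min[OF pq(1,2)] by simp
  qed
qed

lemma transversal_length_nonneg: "diag_length P x \<ge> 0"
  unfolding transversal_length_eq using hdist_nonneg l13.line_hyp3 l24.line_hyp3 by blast

lemma cosh_transversal_length:
  "cosh (diag_length P x) = transversal_cosh X Y a b c d"
  unfolding transversal_length_eq cosh_hdist[OF l13.line_hyp3 l24.line_hyp3] line_lform_line
    dc.dist_fun_min min_value ..

lemma cosh_dist_critical:
  assumes "arclength_param \<gamma> (edge_line P x 1 3)" "arclength_param \<delta> (edge_line P x 2 4)"
  shows "\<exists>s0 t0. critical_point (cosh_dist \<gamma> \<delta>) (s0, t0) \<and>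
    (\<forall>q. critical_point (cosh_dist \<gamma> \<delta>) q \<longrightarrow> q = (s0, t0)) \<and>
    (\<forall>q. cosh_dist \<gamma> \<delta> (s0, t0) \<le> cosh_dist \<gamma> \<delta> q) \<and>
    cosh_dist \<gamma> \<delta> (s0, t0) = transversal_cosh X Y a b c d \<and>
    \<gamma> s0 \<in> trunc_tet P H x \<and> \<delta> t0 \<in> trunc_tet P H x"
proof -
  have l: "edge_line P x 1 3 = span {e 1, e 3} \<inter> hyp3" "edge_line P x 2 4 = span {e 2, e 4} \<inter> hyp3"
    by (rule edge_line_P; simp)+
  obtain \<epsilon> s1 where \<gamma>: "\<epsilon> = 1 \<or> \<epsilon> = -1" "\<And>s. \<gamma> s = l13.line (\<epsilon> * s + s1)"
    using l13.arclength_param_line assms(1) unfolding l by metis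
  obtain \<epsilon>' t1 where \<delta>: "\<epsilon>' = 1 \<or> \<epsilon>' = -1" "\<And>t. \<delta> t = l24.line (\<epsilon>' * t + t1)"
    using l24.arclength_param_line assms(2) unfolding l by metis
  have f: "cosh_dist \<gamma> \<delta> (s, t) = dist_fun A B C E (\<epsilon> * s + s1) (\<epsilon>' * t + t1)" for s t
    unfolding cosh_dist_def case_prod_conv \<gamma>(2) \<delta>(2) cosh_hdist[OF l13.line_hyp3 l24.line_hyp3]
      line_lform_line ..
  note crit = dc.critical_point_iff[OF \<gamma>(1) \<delta>(1) f]
  \<comment> \<open>Each of \<open>\<epsilon>\<close> and \<open>\<epsilon>'\<close> is its own
    inverse.\<close>
  define s0 t0 where "s0 = \<epsilon> * (dc.smin - s1)" and "t0 = \<epsilon>' * (dc.tmin - t1)"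
  have st: "\<epsilon> * s + s1 = dc.smin \<longleftrightarrow> s = s0" "\<epsilon>' * t + t1 = dc.tmin \<longleftrightarrow> t = t0" for s t
    using \<gamma>(1) \<delta>(1) by (auto simp: s0_def t0_def)
  have v0: "\<epsilon> * s0 + s1 = dc.smin" "\<epsilon>' * t0 + t1 = dc.tmin" using st by blast+
  have val: "cosh_dist \<gamma> \<delta> (s0, t0) = transversal_cosh X Y a b c d"
    unfolding f v0 dc.dist_fun_min min_value ..
  show ?thesis
  proof (rule exI[of _ s0], rule exI[of _ t0], intro conjI allI impI)
    show "cosh_dist \<gamma> \<delta> (s0, t0) = transversal_cosh X Y a b c d" by (rule val)
    show "critical_point (cosh_dist \<gamma> \<delta>) (s0, t0)" unfolding crit using v0 by blast
    show "q = (s0, t0)" if "critical_point (cosh_dist \<gamma> \<delta>) q" for q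
      using that st by (cases q) (simp add: crit)
    show "cosh_dist \<gamma> \<delta> (s0, t0) \<le> cosh_dist \<gamma> \<delta> q" for q
      unfolding val using dc.dist_fun_ge by (cases q) (simp only: f min_value)
    show "\<gamma> s0 \<in> trunc_tet P H x" "\<delta> t0 \<in> trunc_tet P H x"
      unfolding \<gamma>(2) \<delta>(2) v0 
      by (rule edge_point_in_trunc_tet; simp add: min_params_nonneg)+
  qed
qed

end

section \<open>From frames back to the given planes and horoballs\<close>

lemma tet_data_transversal:
  assumes "tet_data P H x" "tet_params P x = (X, Y, a, b, c, d)"
  shows "X > 0 \<and> Y > 0 \<and> a > 0 \<and> b > 0 \<and> c > 0 \<and> d > 0"
    and "diag_length P x \<ge> 0"
    and "cosh (diag_length P x) = transversal_cosh X Y a b c d"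
proof -
  obtain e where "tet_frame P H x e" using tet_data_frame[OF assms(1)] by blast
  then interpret f: tet_frame P H x e .
  have eq: "X = f.X" "Y = f.Y" "a = f.a" "b = f.b" "c = f.c" "d = f.d" using assms(2) f.params by simp_all
  show "X > 0 \<and> Y > 0 \<and> a > 0 \<and> b > 0 \<and> c > 0 \<and> d > 0" unfolding eq using f.params_pos by simp
  show "diag_length P x \<ge> 0" by (rule f.transversal_length_nonneg)
  show "cosh (diag_length P x) = transversal_cosh X Y a b c d"
    unfolding eq by (rule f.cosh_transversal_length)
qed

lemma tet_data_critical:
  assumes "tet_data P H x" "tet_params P x = (X, Y, a, b, c, d)"
    "arclength_param \<gamma> (edge_line P x 1 3)" "arclength_param \<delta> (edge_line P x 2 4)"
  shows "\<exists>s0 t0. critical_point (cosh_dist \<gamma> \<delta>) (s0, t0) \<and>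
    (\<forall>q. critical_point (cosh_dist \<gamma> \<delta>) q \<longrightarrow> q = (s0, t0)) \<and>
    (\<forall>q. cosh_dist \<gamma> \<delta> (s0, t0) \<le> cosh_dist \<gamma> \<delta> q) \<and>
    cosh_dist \<gamma> \<delta> (s0, t0) = transversal_cosh X Y a b c d \<and>
    \<gamma> s0 \<in> trunc_tet P H x \<and> \<delta> t0 \<in> trunc_tet P H x"
proof -
  obtain e where "tet_frame P H x e" using tet_data_frame[OF assms(1)] by blast
  then interpret f: tet_frame P H x e .
  have eq: "X = f.X" "Y = f.Y" "a = f.a" "b = f.b" "c = f.c" "d = f.d" using assms(2) f.params by simp_all
  show ?thesis unfolding eq by (rule f.cosh_dist_critical[OF assms(3,4)])
qed

text \<open>Two realizations of the same parameters have transversal lengths with equal hyperbolic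
  cosine, and \<open>cosh\<close> is injective on nonnegative reals; hence the \<open>THE\<close> in
  \<open>T2rr\<close> is well defined.\<close>

lemma T2rr_eq:
  assumes "tet_data P H x" "tet_params P x = (X, Y, a, b, c, d)"
  shows "T2rr X Y a b c d = diag_length P x"
  unfolding T2rr_def
proof (rule the_equality)
  show "\<exists>P' H' x'. tet_data P' H' x' \<and> tet_params P' x' = (X, Y, a, b, c, d) \<and>
      diag_length P x = diag_length P' x'"
    using assms by blast
next
  fix l assume "\<exists>P' H' x'. tet_data P' H' x' \<and> tet_params P' x' = (X, Y, a, b, c, d) \<and>
      l = diag_length P' x'"
  then obtain P' H' x' where p: "tet_data P' H' x'" "tet_params P' x' = (X, Y, a, b, c, d)"
    "l = diag_length P' x'" by blast
  show "l = diag_length P x"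
    unfolding p(3) using tet_data_transversal(2,3)[OF assms] tet_data_transversal(2,3)[OF p(1,2)]
    by (metis arcosh_cosh_real)
qed

lemma realizable_T2rr:
  assumes "realizable X Y a b c d"
  shows "T2rr X Y a b c d \<ge> 0" "cosh (T2rr X Y a b c d) = transversal_cosh X Y a b c d"
proof -
  obtain P H x where p: "tet_data P H x" "tet_params P x = (X, Y, a, b, c, d)"
    using assms by (auto simp: realizable_def)
  show "T2rr X Y a b c d \<ge> 0" "cosh (T2rr X Y a b c d) = transversal_cosh X Y a b c d"
    unfolding T2rr_eq[OF p] using tet_data_transversal[OF p] by simp_all
qed

lemma T2rr_less:
  assumes "realizable X Y a b c d" "realizable X Y a' b' c' d'"
    "transversal_cosh X Y a b c d < transversal_cosh X Y a' b' c' d'"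
  shows "T2rr X Y a b c d < T2rr X Y a' b' c' d'"
  using assms(3) cosh_real_nonneg_less_iff[OF realizable_T2rr(1)[OF assms(1)] realizable_T2rr(1)[OF assms(2)]]
  unfolding realizable_T2rr(2)[OF assms(1)] realizable_T2rr(2)[OF assms(2)] by blast

lemma tet_params_lengths:
  "tet_lengths P' x' = tet_lengths P x \<Longrightarrow> tet_params P' x' = tet_params P x"
  by (simp add: tet_lengths_def tet_params_def)

theorem proposition4p5:
  fixes P H :: "nat \<Rightarrow> (real^4) set" and x :: "nat \<Rightarrow> real^4"
    and \<gamma> \<delta> :: "real \<Rightarrow> real^4" and X Y a b c d :: real
  assumes data: "tet_data P H x"
    and params: "tet_params P x = (X, Y, a, b, c, d)"
    and gamma: "arclength_param \<gamma> (edge_line P x 1 3)"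
    and delta: "arclength_param \<delta> (edge_line P x 2 4)"
  shows "(\<exists>s0 t0.
      (critical_point (cosh_dist \<gamma> \<delta>) (s0, t0) \<and>
       (\<forall>q. critical_point (cosh_dist \<gamma> \<delta>) q \<longrightarrow> q = (s0, t0)) \<and>
       (\<forall>q. cosh_dist \<gamma> \<delta> (s0, t0) \<le> cosh_dist \<gamma> \<delta> q)) \<and>
      (\<forall>P' H' x' \<gamma>' \<delta>' q'. tet_data P' H' x' \<and> tet_lengths P' x' = tet_lengths P x \<and>
         arclength_param \<gamma>' (edge_line P' x' 1 3) \<and> arclength_param \<delta>' (edge_line P' x' 2 4) \<and>
         critical_point (cosh_dist \<gamma>' \<delta>') q' \<longrightarrow>
         cosh_dist \<gamma>' \<delta>' q' = cosh_dist \<gamma> \<delta> (s0, t0)) \<and>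
      (\<gamma> s0 \<in> trunc_tet P H x \<and> \<delta> t0 \<in> trunc_tet P H x \<and>
       cosh_dist \<gamma> \<delta> (s0, t0) = cosh (transversal_length (edge P x 1 3) (edge P x 2 4)))) \<and>
    (transversal_length (edge P x 1 3) (edge P x 2 4) = T2rr X Y a b c d \<and>
     (\<forall>a'. realizable X Y a' b c d \<and> a < a' \<longrightarrow> T2rr X Y a b c d < T2rr X Y a' b c d) \<and>
     (\<forall>b'. realizable X Y a b' c d \<and> b < b' \<longrightarrow> T2rr X Y a b c d < T2rr X Y a b' c d) \<and>
     (\<forall>c'. realizable X Y a b c' d \<and> c < c' \<longrightarrow> T2rr X Y a b c d < T2rr X Y a b c' d) \<and>
     (\<forall>d'. realizable X Y a b c d' \<and> d < d' \<longrightarrow> T2rr X Y a b c d < T2rr X Y a b c d')) \<and>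
    cosh (T2rr X Y a b c d) =
      sqrt (1 / (X * Y) * (d / Y + c) * (d / X + b)) +
      sqrt (d / (X * Y) * (d / (X * Y) + c / X + b / Y + 2 * a))"
proof -
  have real: "realizable X Y a b c d" using data params by (auto simp: realizable_def)
  have pos: "X > 0" "Y > 0" "a > 0" "b > 0" "c > 0" "d > 0"
    using tet_data_transversal(1)[OF data params] by blast+
  have mono: "a < a' \<Longrightarrow> transversal_cosh X Y a b c d < transversal_cosh X Y a' b c d"
    "b < b' \<Longrightarrow> transversal_cosh X Y a b c d < transversal_cosh X Y a b' c d"
    "c < c' \<Longrightarrow> transversal_cosh X Y a b c d < transversal_cosh X Y a b c' d"
    "d < d' \<Longrightarrow> transversal_cosh X Y a b c d < transversal_cosh X Y a b c d'" for a' b' c' d'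
    by (rule transversal_cosh_mono[OF pos]; simp)+
  obtain s0 t0 where st: "critical_point (cosh_dist \<gamma> \<delta>) (s0, t0)"
    "\<forall>q. critical_point (cosh_dist \<gamma> \<delta>) q \<longrightarrow> q = (s0, t0)"
    "\<forall>q. cosh_dist \<gamma> \<delta> (s0, t0) \<le> cosh_dist \<gamma> \<delta> q"
    "cosh_dist \<gamma> \<delta> (s0, t0) = transversal_cosh X Y a b c d"
    "\<gamma> s0 \<in> trunc_tet P H x" "\<delta> t0 \<in> trunc_tet P H x"
    using tet_data_critical[OF data params gamma delta] by blast
  \<comment> \<open>Equal lengths give equal parameters, and the critical value of any configuration
    is the explicit expression in its parameters.\<close>
  have other: "cosh_dist \<gamma>' \<delta>' q' = cosh_dist \<gamma> \<delta> (s0, t0)"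
    if h: "tet_data P' H' x'" "tet_lengths P' x' = tet_lengths P x"
      "arclength_param \<gamma>' (edge_line P' x' 1 3)" "arclength_param \<delta>' (edge_line P' x' 2 4)"
      "critical_point (cosh_dist \<gamma>' \<delta>') q'" for P' H' x' \<gamma>' \<delta>' q'
  proof -
    have "tet_params P' x' = (X, Y, a, b, c, d)" using tet_params_lengths[OF h(2)] params by simp
    from tet_data_critical[OF h(1) this h(3,4)] h(5) st(4) show ?thesis by metis
  qed
  have "cosh_dist \<gamma> \<delta> (s0, t0) = cosh (transversal_length (edge P x 1 3) (edge P x 2 4))"
    using st(4) tet_data_transversal(3)[OF data params] by simp
  moreover have "cosh (T2rr X Y a b c d) = transversal_cosh X Y a b c d"
    by (rule realizable_T2rr(2)[OF real])
  ultimately show ?thesis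
    unfolding transversal_cosh_def[symmetric] T2rr_eq[OF data params, symmetric]
    using st(1-3,5,6) other T2rr_less[OF real] mono by blast
qed

end
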